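(* Let $\mathcal F$ be a saturated fusion system on a finite $p$-group $S$, and suppose that $\mathcal H,\mathcal K$ are saturated fusion subsystems of $\mathcal F$ on subgroups $R,T\le S$ respectively. Then the characteristic idempotents satisfy $$[R,\mathrm{id}]_S^R\circ\omega_{\mathcal F}\circ[T,\mathrm{id}]_T^S=\omega_{\mathcal H}\circ[R\cap T,\mathrm{id}]_T^R\circ\omega_{\mathcal K}\qquad\text{in }A(T,R)_{(p)}$$ if and only if $\mathcal F$ is the weak composition product of $\mathcal H$ and $\mathcal K$ and for all $Q\le R\cap T$ we have $$|\mathcal F(Q,S)|=\frac{|\mathcal H(Q,R)|\cdot|\mathcal K(Q,T)|}{|\mathrm{Hom}_{\mathcal H\cap\mathcal K}(Q,R\cap T)|}.$$
   Context: Here $p$ is a prime and $p$-groups are finite. A fusion system $\mathcal F$ on a $p$-group $S$ is a category whose objects are the subgroups of $S$, whose morphism sets $\mathcal F(P,Q)=\mathrm{Hom}_{\mathcal F}(P,Q)$ consist of injective group homomorphisms $P\to Q$ (composed as homomorphisms) and contain all homomorphisms $P\to Q$ induced by conjugation by elements of $S$, and such that for each $\varphi\in\mathcal F(P,Q)$ the isomorphism $\varphi\colon P\to\varphi P$ and its inverse are morphisms of $\mathcal F$. Write $\mathrm{Aut}_{\mathcal F}(P)=\mathcal F(P,P)$. Subgroups $P,Q$ are $\mathcal F$-conjugate if they are isomorphic in $\mathcal F$; $[P]_{\mathcal F}$ is the set of $\mathcal F$-conjugates of $P$. $P$ is fully $\mathcal F$-normalized (resp. fully $\mathcal F$-centralized)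 if $|N_SP|\ge|N_SQ|$ (resp. $|C_SP|\ge|C_SQ|$) for all $Q\in[P]_{\mathcal F}$. $\mathcal F$ is saturated if for all $P\le S$: (1) if $P$ is fully $\mathcal F$-normalized, then $P$ is fully $\mathcal F$-centralized and $\mathrm{Aut}_S(P)$ is a Sylow $p$-subgroup of $\mathrm{Aut}_{\mathcal F}(P)$; (2) every $\varphi\in\mathcal F(P,S)$ with $\varphi(P)$ fully $\mathcal F$-centralized extends to a morphism in $\mathcal F(N_\varphi,S)$, where $N_\varphi=\{x\in N_S(P)\mid \exists y\in S:\varphi\circ c_x=c_y\circ\varphi\}$. A fusion subsystem of $\mathcal F$ on $R\le S$ is a subcategory of $\mathcal F$ that is a fusion system on $R$. $\mathcal H\cap\mathcal K$ is the fusion system on $R\cap T$ with $\mathrm{Hom}_{\mathcal H\cap\mathcal K}(P,Q)=\mathcal H(P,Q)\cap\mathcal K(P,Q)$. Weak composition product (the composition product in the sense of Park–Ragnarsson–Stancu, written $\mathcal F=\mathcal H\mathcal K$ or $\mathcal F\approx\mathcal H\mathcal K$): $S=RT$, and for all $P\le T$ every morphism $\varphi\in\mathcal F(P,R)$ can be written as a composition $\varphi=\psi\rho$ where $\psi$ is a morphism of $\mathcal H$ and $\rho$ is a morphism of $\mathcal K$. Bisets: for finite groups $G,H$, a $(G,H)$-biset is a finite set with commuting right $G$-action and left $H$-action, regarded as a left $(H\times G)$-set via $(h,g).x=hxg^{-1}$. $A(G,H)$ is the Grothendieck group of isomorphism classes of $(G,H)$-bisets under disjoint union. Composition $\circ\colon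 A(H,K)\times A(G,H)\to A(G,K)$ is induced by $Y\circ X=Y\times_HX$. For $U\le G$ and a homomorphism $\varphi\colon U\to H$, $\Delta(U,\varphi)=\{(\varphi(u),u)\mid u\in U\}\le H\times G$ and $[U,\varphi]_G^H=[(H\times G)/\Delta(U,\varphi)]\in A(G,H)$. The subscript $(p)$ denotes tensoring with $\mathbb Z_{(p)}$. Characteristic idempotent: for a fusion system $\mathcal F$ on $S$, $X\in A(S,S)_{(p)}$ is $\mathcal F$-generated if it is a $\mathbb Z_{(p)}$-linear combination of elements $[P,\varphi]_S^S$ with $P\le S$, $\varphi\in\mathcal F(P,S)$. It is right $\mathcal F$-stable if $X\circ[P,\varphi]_P^S=X\circ[P,\mathrm{id}]_P^S$, and left $\mathcal F$-stable if $[\varphi P,\varphi^{-1}]_S^P\circ X=[P,\mathrm{id}]_S^P\circ X$, for all $P\le S$, $\varphi\in\mathcal F(P,S)$. It is $\mathcal F$-characteristic if it is $\mathcal F$-generated, left and right $\mathcal F$-stable, and $\varepsilon(X)$ is invertible in $\mathbb Z_{(p)}$, where $\varepsilon$ is the $\mathbb Z_{(p)}$-linear extension of $X\mapsto|X|/|S|$ to the span of left-free bisets. For each saturated $\mathcal F$ there is exactly one idempotent (with respect to $\circ$) in $A(S,S)_{(p)}$ that is $\mathcal F$-characteristic; it is the characteristic idempotent $\omega_{\mathcal F}$. Thus $\omega_{\mathcal H}\in A(R,R)_{(p)}$ and $\omega_{\mathcal K}\in A(T,T)_{(p)}$. *)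

theory Defs
  imports
    Complex_Main
    "HOL-Algebra.Group_Action"
    "HOL-Algebra.Generated_Groups"
    "HOL-Computational_Algebra.Primes"
    "HOL-Library.Poly_Mapping"
begin

section \<open>Finite \<open>p\<close>-groups\<close>

locale p_group = group G for G (structure) +
  fixes p :: nat
  assumes prime_p: "prime p"
    and order_p_power: "\<exists>n. order G = p ^ n"

definition centralizer :: "('a, 'm) monoid_scheme \<Rightarrow> 'a set \<Rightarrow> 'a set" where
  "centralizer G P = {x \<in> carrier G. \<forall>u\<in>P. x \<otimes>\<^bsub>G\<^esub> u = u \<otimes>\<^bsub>G\<^esub> x}"

definition conj_map :: "('a, 'm) monoid_scheme \<Rightarrow> 'a \<Rightarrow> 'a set \<Rightarrow> 'a \<Rightarrow> 'a" where
  "conj_map G x P = (\<lambda>u\<in>P. x \<otimes>\<^bsub>G\<^esub> u \<otimes>\<^bsub>G\<^esub> inv\<^bsub>G\<^esub> x)"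

definition sylow_subgroup :: "nat \<Rightarrow> 'a set \<Rightarrow> ('a, 'm) monoid_scheme \<Rightarrow> bool" where
  "sylow_subgroup p P A \<longleftrightarrow> subgroup P A \<and> card P = p ^ multiplicity p (order A)"


section \<open>Fusion systems\<close>

text \<open>A category on the subgroups of a group is given by its morphism sets. Morphisms out of
  \<open>P\<close> are functions extensional on \<open>P\<close>, so that equality of morphisms \<open>P \<rightarrow> Q\<close> is equality of
  functions and hom-sets have the right cardinality. Values at sets that are not subgroups
  are irrelevant.\<close>

type_synonym 'a hom_sets = "'a set \<Rightarrow> 'a set \<Rightarrow> ('a \<Rightarrow> 'a) set"

locale fusion_system = group G for G (structure) +
  fixes F :: "'a hom_sets"
  assumes morphism_mon:
      "\<lbrakk>subgroup P G; subgroup Q G; \<phi> \<in> F P Q\<rbrakk>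
        \<Longrightarrow> \<phi> \<in> mon (G\<lparr>carrier := P\<rparr>) (G\<lparr>carrier := Q\<rparr>) \<inter> extensional P"
    and morphism_compose:
      "\<lbrakk>subgroup P G; subgroup Q G; subgroup U G; \<phi> \<in> F P Q; \<psi> \<in> F Q U\<rbrakk>
        \<Longrightarrow> compose P \<psi> \<phi> \<in> F P U"
    and morphism_conj:
      "\<lbrakk>subgroup P G; subgroup Q G; x \<in> carrier G; conj_map G x P ` P \<subseteq> Q\<rbrakk>
        \<Longrightarrow> conj_map G x P \<in> F P Q"
    and morphism_onto_image:
      "\<lbrakk>subgroup P G; subgroup Q G; \<phi> \<in> F P Q\<rbrakk> \<Longrightarrow> \<phi> \<in> F P (\<phi> ` P)"
    and morphism_inverse:
      "\<lbrakk>subgroup P G; subgroup Q G; \<phi> \<in> F P Q\<rbrakk>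
        \<Longrightarrow> restrict (inv_into P \<phi>) (\<phi> ` P) \<in> F (\<phi> ` P) P"

definition conjugates :: "('a, 'm) monoid_scheme \<Rightarrow> 'a hom_sets \<Rightarrow> 'a set \<Rightarrow> 'a set set" where
  "conjugates G F P = {Q. subgroup Q G \<and>
     (\<exists>\<phi>\<in>F P Q. \<exists>\<psi>\<in>F Q P. compose P \<psi> \<phi> = (\<lambda>u\<in>P. u) \<and> compose Q \<phi> \<psi> = (\<lambda>u\<in>Q. u))}"

definition fully_normalized :: "('a, 'm) monoid_scheme \<Rightarrow> 'a hom_sets \<Rightarrow> 'a set \<Rightarrow> bool" where
  "fully_normalized G F P \<longleftrightarrow>
     (\<forall>Q\<in>conjugates G F P. card (normalizer G Q) \<le> card (normalizer G P))"

definition fully_centralized :: "('a, 'm) monoid_scheme \<Rightarrow> 'a hom_sets \<Rightarrow> 'a set \<Rightarrow> bool" where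
  "fully_centralized G F P \<longleftrightarrow>
     (\<forall>Q\<in>conjugates G F P. card (centralizer G Q) \<le> card (centralizer G P))"

definition aut_group :: "'a hom_sets \<Rightarrow> 'a set \<Rightarrow> ('a \<Rightarrow> 'a) monoid" where
  "aut_group F P = (BijGroup P)\<lparr>carrier := F P P\<rparr>"

definition inner_auts :: "('a, 'm) monoid_scheme \<Rightarrow> 'a set \<Rightarrow> ('a \<Rightarrow> 'a) set" where
  "inner_auts G P = (\<lambda>x. conj_map G x P) ` normalizer G P"

definition extension_domain ::
    "('a, 'm) monoid_scheme \<Rightarrow> 'a set \<Rightarrow> ('a \<Rightarrow> 'a) \<Rightarrow> 'a set" where
  "extension_domain G P \<phi> = {x \<in> normalizer G P. \<exists>y\<in>carrier G.
     compose P \<phi> (conj_map G x P) = compose P (conj_map G y (\<phi> ` P)) \<phi>}"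

locale saturated_fusion_system = p_group G p + fusion_system G F
  for p :: nat and G (structure) and F :: "'a hom_sets" +
  assumes sylow_axiom:
      "\<lbrakk>subgroup P G; fully_normalized G F P\<rbrakk>
        \<Longrightarrow> fully_centralized G F P \<and> sylow_subgroup p (inner_auts G P) (aut_group F P)"
    and extension_axiom:
      "\<lbrakk>subgroup P G; \<phi> \<in> F P (carrier G); fully_centralized G F (\<phi> ` P)\<rbrakk>
        \<Longrightarrow> \<exists>\<chi>\<in>F (extension_domain G P \<phi>) (carrier G). restrict \<chi> P = \<phi>"

definition fusion_subsystem ::
    "('a, 'm) monoid_scheme \<Rightarrow> 'a hom_sets \<Rightarrow> 'a set \<Rightarrow> 'a hom_sets \<Rightarrow> bool" where
  "fusion_subsystem G F R H \<longleftrightarrow> subgroup R G \<and> fusion_system (G\<lparr>carrier := R\<rparr>) H \<and>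
     (\<forall>P Q. subgroup P (G\<lparr>carrier := R\<rparr>) \<longrightarrow> subgroup Q (G\<lparr>carrier := R\<rparr>) \<longrightarrow> H P Q \<subseteq> F P Q)"

definition fusion_inter :: "'a hom_sets \<Rightarrow> 'a hom_sets \<Rightarrow> 'a hom_sets" where
  "fusion_inter H K = (\<lambda>P Q. H P Q \<inter> K P Q)"

definition weak_composition_product ::
    "('a, 'm) monoid_scheme \<Rightarrow> 'a hom_sets \<Rightarrow> 'a set \<Rightarrow> 'a hom_sets \<Rightarrow> 'a set \<Rightarrow> 'a hom_sets \<Rightarrow> bool" where
  "weak_composition_product G F R H T K \<longleftrightarrow>
     carrier G = R <#>\<^bsub>G\<^esub> T \<and>
     (\<forall>P. subgroup P (G\<lparr>carrier := T\<rparr>) \<longrightarrow> (\<forall>\<phi>\<in>F P R.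
        \<exists>Q. subgroup Q (G\<lparr>carrier := R\<rparr>) \<and> subgroup Q (G\<lparr>carrier := T\<rparr>) \<and>
          (\<exists>\<rho>\<in>K P Q. \<exists>\<psi>\<in>H Q R. \<phi> = compose P \<psi> \<rho>)))"


section \<open>Bisets\<close>

text \<open>A \<open>(G,H)\<close>-biset is a finite left \<open>(H \<times> G)\<close>-set, where \<open>(h,g)\<close> acts as \<open>x \<mapsto> h x g\<inverse>\<close>. It is
  encoded as the pair of its underlying set and its action map. In particular \<open>h x\<close> is
  the action of \<open>(h,1)\<close> and \<open>x g\<inverse>\<close> that of \<open>(1,g)\<close>.\<close>

type_synonym ('h, 'g, 'x) biset = "'x set \<times> ('h \<times> 'g \<Rightarrow> 'x \<Rightarrow> 'x)"

definition is_biset ::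
    "('g, 'm) monoid_scheme \<Rightarrow> ('h, 'n) monoid_scheme \<Rightarrow> ('h, 'g, 'x) biset \<Rightarrow> bool" where
  "is_biset G H X \<longleftrightarrow> finite (fst X) \<and> group_action (H \<times>\<times> G) (fst X) (snd X)"

definition biset_iso ::
    "('g, 'm) monoid_scheme \<Rightarrow> ('h, 'n) monoid_scheme
      \<Rightarrow> ('h, 'g, 'x) biset \<Rightarrow> ('h, 'g, 'y) biset \<Rightarrow> bool" where
  "biset_iso G H X Y \<longleftrightarrow> (\<exists>f. bij_betw f (fst X) (fst Y) \<and>
     (\<forall>a\<in>carrier (H \<times>\<times> G). \<forall>x\<in>fst X. f (snd X a x) = snd Y a (f x)))"

definition biset_sum :: "('h, 'g, 'x) biset \<Rightarrow> ('h, 'g, 'y) biset \<Rightarrow> ('h, 'g, 'x + 'y) biset" where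
  "biset_sum X Y = (fst X <+> fst Y,
     \<lambda>a. \<lambda>z\<in>fst X <+> fst Y. map_sum (snd X a) (snd Y a) z)"

text \<open>\<open>Y \<times>\<^bsub>H\<^esub> X\<close> identifies \<open>(y h, x)\<close> with \<open>(y, h x)\<close>; equivalently, \<open>(y, x)\<close> with
  \<open>(y h\<inverse>, h x)\<close>, so its elements are the orbits of the diagonal action of \<open>H\<close>.\<close>

definition balance_rel ::
    "('g, 'm) monoid_scheme \<Rightarrow> ('h, 'n) monoid_scheme \<Rightarrow> ('k, 'l) monoid_scheme
      \<Rightarrow> ('k, 'h, 'y) biset \<Rightarrow> ('h, 'g, 'x) biset \<Rightarrow> (('y \<times> 'x) \<times> ('y \<times> 'x)) set" where
  "balance_rel G H K Y X = {((y, x), (snd Y (\<one>\<^bsub>K\<^esub>, h) y, snd X (h, \<one>\<^bsub>G\<^esub>) x)) | y x h.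
     y \<in> fst Y \<and> x \<in> fst X \<and> h \<in> carrier H}"

definition biset_product ::
    "('g, 'm) monoid_scheme \<Rightarrow> ('h, 'n) monoid_scheme \<Rightarrow> ('k, 'l) monoid_scheme
      \<Rightarrow> ('k, 'h, 'y) biset \<Rightarrow> ('h, 'g, 'x) biset \<Rightarrow> ('k, 'g, ('y \<times> 'x) set) biset" where
  "biset_product G H K Y X =
     (let Z = (fst Y \<times> fst X) // balance_rel G H K Y X
      in (Z, \<lambda>(k, g). \<lambda>C\<in>Z. map_prod (snd Y (k, \<one>\<^bsub>H\<^esub>)) (snd X (\<one>\<^bsub>H\<^esub>, g)) ` C))"

definition twisted_diagonal :: "'g set \<Rightarrow> ('g \<Rightarrow> 'h) \<Rightarrow> ('h \<times> 'g) set" where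
  "twisted_diagonal U \<phi> = (\<lambda>u. (\<phi> u, u)) ` U"

definition transitive_biset ::
    "('g, 'm) monoid_scheme \<Rightarrow> ('h, 'n) monoid_scheme \<Rightarrow> 'g set \<Rightarrow> ('g \<Rightarrow> 'h)
      \<Rightarrow> ('h, 'g, ('h \<times> 'g) set) biset" where
  "transitive_biset G H U \<phi> =
     (let Z = (\<lambda>a. a <#\<^bsub>H \<times>\<times> G\<^esub> twisted_diagonal U \<phi>) ` carrier (H \<times>\<times> G)
      in (Z, \<lambda>a. \<lambda>C\<in>Z. a <#\<^bsub>H \<times>\<times> G\<^esub> C))"


section \<open>The \<open>p\<close>-localized Grothendieck group of bisets\<close>

text \<open>Every finite biset is isomorphic to one whose underlying set consists of natural numbers,
  so isomorphism classes are represented as sets of bisets of the latter kind.\<close>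

type_synonym ('h, 'g) biset_class = "('h, 'g, nat) biset set"

definition iso_class ::
    "('g, 'm) monoid_scheme \<Rightarrow> ('h, 'n) monoid_scheme \<Rightarrow> ('h, 'g, 'x) biset
      \<Rightarrow> ('h, 'g) biset_class" where
  "iso_class G H X = {Y. is_biset G H Y \<and> biset_iso G H X Y}"

definition biset_rep :: "('h, 'g) biset_class \<Rightarrow> ('h, 'g, nat) biset" where
  "biset_rep c = (SOME X. X \<in> c)"

definition localized_ints :: "nat \<Rightarrow> rat set" where
  "localized_ints p = {of_int a / of_int b | a b. \<not> int p dvd b}"

definition free_bisets ::
    "nat \<Rightarrow> ('g, 'm) monoid_scheme \<Rightarrow> ('h, 'n) monoid_scheme
      \<Rightarrow> (('h, 'g) biset_class \<Rightarrow>\<^sub>0 rat) monoid" where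
  "free_bisets p G H =
     \<lparr>carrier = {x. Poly_Mapping.keys x \<subseteq> {iso_class G H (X :: ('h, 'g, nat) biset) | X. is_biset G H X} \<and>
                   range (Poly_Mapping.lookup x) \<subseteq> localized_ints p},
      monoid.mult = (+), one = 0\<rparr>"

definition sum_relations ::
    "nat \<Rightarrow> ('g, 'm) monoid_scheme \<Rightarrow> ('h, 'n) monoid_scheme
      \<Rightarrow> (('h, 'g) biset_class \<Rightarrow>\<^sub>0 rat) set" where
  "sum_relations p G H = generate (free_bisets p G H)
     {Poly_Mapping.single (iso_class G H (biset_sum X Y)) r
        - Poly_Mapping.single (iso_class G H X) r - Poly_Mapping.single (iso_class G H Y) r
      | (X :: ('h, 'g, nat) biset) (Y :: ('h, 'g, nat) biset) r.
        is_biset G H X \<and> is_biset G H Y \<and> r \<in> localized_ints p}"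

text \<open>\<open>A(G,H)\<^bsub>(p)\<^esub>\<close>: tensoring the presentation of the Grothendieck group by the generators \<open>[X]\<close>
  and the relations \<open>[X \<squnion> Y] = [X] + [Y]\<close> with \<open>\<int>\<^bsub>(p)\<^esub>\<close> yields the free \<open>\<int>\<^bsub>(p)\<^esub>\<close>-module on the
  isomorphism classes modulo the \<open>\<int>\<^bsub>(p)\<^esub>\<close>-span of the same relations.\<close>

definition burnside ::
    "nat \<Rightarrow> ('g, 'm) monoid_scheme \<Rightarrow> ('h, 'n) monoid_scheme
      \<Rightarrow> (('h, 'g) biset_class \<Rightarrow>\<^sub>0 rat) set monoid" where
  "burnside p G H = free_bisets p G H Mod sum_relations p G H"

definition burnside_elem ::
    "nat \<Rightarrow> ('g, 'm) monoid_scheme \<Rightarrow> ('h, 'n) monoid_scheme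
      \<Rightarrow> (('h, 'g) biset_class \<Rightarrow>\<^sub>0 rat) \<Rightarrow> (('h, 'g) biset_class \<Rightarrow>\<^sub>0 rat) set" where
  "burnside_elem p G H x = sum_relations p G H #>\<^bsub>free_bisets p G H\<^esub> x"

definition transitive_elem ::
    "nat \<Rightarrow> ('g, 'm) monoid_scheme \<Rightarrow> ('h, 'n) monoid_scheme \<Rightarrow> 'g set \<Rightarrow> ('g \<Rightarrow> 'h)
      \<Rightarrow> (('h, 'g) biset_class \<Rightarrow>\<^sub>0 rat) set" where
  "transitive_elem p G H U \<phi> =
     burnside_elem p G H (Poly_Mapping.single (iso_class G H (transitive_biset G H U \<phi>)) 1)"

definition free_comp ::
    "('g, 'm) monoid_scheme \<Rightarrow> ('h, 'n) monoid_scheme \<Rightarrow> ('k, 'l) monoid_scheme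
      \<Rightarrow> (('k, 'h) biset_class \<Rightarrow>\<^sub>0 rat) \<Rightarrow> (('h, 'g) biset_class \<Rightarrow>\<^sub>0 rat)
      \<Rightarrow> (('k, 'g) biset_class \<Rightarrow>\<^sub>0 rat)" where
  "free_comp G H K y x = (\<Sum>d\<in>Poly_Mapping.keys y. \<Sum>c\<in>Poly_Mapping.keys x.
     Poly_Mapping.single (iso_class G K (biset_product G H K (biset_rep d) (biset_rep c)))
       (Poly_Mapping.lookup y d * Poly_Mapping.lookup x c))"

text \<open>Composition \<open>A(H,K)\<^bsub>(p)\<^esub> \<times> A(G,H)\<^bsub>(p)\<^esub> \<rightarrow> A(G,K)\<^bsub>(p)\<^esub>\<close>. The sets joined below all coincide,
  as the coset obtained does not depend on the choice of representatives.\<close>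

definition burnside_comp ::
    "nat \<Rightarrow> ('g, 'm) monoid_scheme \<Rightarrow> ('h, 'n) monoid_scheme \<Rightarrow> ('k, 'l) monoid_scheme
      \<Rightarrow> (('k, 'h) biset_class \<Rightarrow>\<^sub>0 rat) set \<Rightarrow> (('h, 'g) biset_class \<Rightarrow>\<^sub>0 rat) set
      \<Rightarrow> (('k, 'g) biset_class \<Rightarrow>\<^sub>0 rat) set" where
  "burnside_comp p G H K Y X = (\<Union>y\<in>Y. \<Union>x\<in>X. burnside_elem p G K (free_comp G H K y x))"


section \<open>Characteristic idempotents\<close>

definition fusion_generated ::
    "nat \<Rightarrow> ('a, 'm) monoid_scheme \<Rightarrow> 'a hom_sets \<Rightarrow> (('a, 'a) biset_class \<Rightarrow>\<^sub>0 rat) set \<Rightarrow> bool" where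
  "fusion_generated p G F X \<longleftrightarrow> (\<exists>x\<in>carrier (free_bisets p G G).
     Poly_Mapping.keys x \<subseteq> {iso_class G G (transitive_biset G G P \<phi>) | P \<phi>.
       subgroup P G \<and> \<phi> \<in> F P (carrier G)} \<and>
     X = burnside_elem p G G x)"

definition right_stable ::
    "nat \<Rightarrow> ('a, 'm) monoid_scheme \<Rightarrow> 'a hom_sets \<Rightarrow> (('a, 'a) biset_class \<Rightarrow>\<^sub>0 rat) set \<Rightarrow> bool" where
  "right_stable p G F X \<longleftrightarrow> (\<forall>P. subgroup P G \<longrightarrow> (\<forall>\<phi>\<in>F P (carrier G).
     burnside_comp p (G\<lparr>carrier := P\<rparr>) G G X (transitive_elem p (G\<lparr>carrier := P\<rparr>) G P \<phi>) =
     burnside_comp p (G\<lparr>carrier := P\<rparr>) G G X (transitive_elem p (G\<lparr>carrier := P\<rparr>) G P id)))"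

definition left_stable ::
    "nat \<Rightarrow> ('a, 'm) monoid_scheme \<Rightarrow> 'a hom_sets \<Rightarrow> (('a, 'a) biset_class \<Rightarrow>\<^sub>0 rat) set \<Rightarrow> bool" where
  "left_stable p G F X \<longleftrightarrow> (\<forall>P. subgroup P G \<longrightarrow> (\<forall>\<phi>\<in>F P (carrier G).
     burnside_comp p G G (G\<lparr>carrier := P\<rparr>)
       (transitive_elem p G (G\<lparr>carrier := P\<rparr>) (\<phi> ` P) (inv_into P \<phi>)) X =
     burnside_comp p G G (G\<lparr>carrier := P\<rparr>)
       (transitive_elem p G (G\<lparr>carrier := P\<rparr>) P id) X))"

text \<open>The linear extension of \<open>X \<mapsto> |X| / |S|\<close>, as a rational-valued map on all of \<open>A(S,S)\<^bsub>(p)\<^esub>\<close>.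
  It is constant on cosets because cardinality is additive. Its restriction to the span of
  the left-free bisets, which contains every generated element, has values in \<open>\<int>\<^bsub>(p)\<^esub>\<close>.\<close>

definition augmentation ::
    "('a, 'm) monoid_scheme \<Rightarrow> (('a, 'a) biset_class \<Rightarrow>\<^sub>0 rat) set \<Rightarrow> rat" where
  "augmentation G X = the_elem ((\<lambda>x. \<Sum>c\<in>Poly_Mapping.keys x.
     Poly_Mapping.lookup x c * (of_nat (card (fst (biset_rep c))) / of_nat (order G))) ` X)"

definition characteristic ::
    "nat \<Rightarrow> ('a, 'm) monoid_scheme \<Rightarrow> 'a hom_sets \<Rightarrow> (('a, 'a) biset_class \<Rightarrow>\<^sub>0 rat) set \<Rightarrow> bool" where
  "characteristic p G F X \<longleftrightarrow> X \<in> carrier (burnside p G G) \<and>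
     fusion_generated p G F X \<and> right_stable p G F X \<and> left_stable p G F X \<and>
     (\<exists>u\<in>localized_ints p. augmentation G X \<in> localized_ints p \<and> augmentation G X * u = 1)"

definition characteristic_idempotent ::
    "nat \<Rightarrow> ('a, 'm) monoid_scheme \<Rightarrow> 'a hom_sets \<Rightarrow> (('a, 'a) biset_class \<Rightarrow>\<^sub>0 rat) set \<Rightarrow> bool" where
  "characteristic_idempotent p G F \<omega> \<longleftrightarrow>
     characteristic p G F \<omega> \<and> burnside_comp p G G G \<omega> \<omega> = \<omega>"

end

theory Submission
  imports Defs
begin

text \<open>
  An element of \<open>A(G,H)\<^bsub>(p)\<^esub>\<close> is determined by its marks, the numbers of points fixed by the subgroups
  \<open>D \<le> H \<times> G\<close>. Both sides of the identity are built from left-free bisets, so their marks vanish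
  except at the twisted diagonals \<open>\<Delta>(Q,\<psi>) = {(\<psi> q, q) | q \<in> Q}\<close>, and the identity says that
  the marks of the two sides agree at \<open>\<Delta>(Q,\<psi>)\<close> for all \<open>Q \<le> T\<close> and all maps \<open>\<psi> : Q \<rightarrow> R\<close>.

  These marks are explicit. For left-free \<open>x\<close>, fixed points of a composite \<open>y \<circ> x\<close> are counted by the
  intermediate maps \<open>\<chi>\<close>,
  \<open>m(\<Delta>(Q,\<psi>), y \<circ> x) = (1/|H|) \<Sum>\<^sub>\<chi> m({(\<psi> q, \<chi> q)}, y) m(\<Delta>(Q,\<chi>), x)\<close> (\<open>mark_free_comp\<close>).
  Stability makes the mark of \<open>\<omega>\<^sub>F\<close> at \<open>\<Delta>(Q,\<chi>)\<close> a number \<open>m(Q)\<close> that is the same for all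
  \<open>\<chi> \<in> F(Q,S)\<close>, and generation makes it \<open>0\<close> for all other \<open>\<chi>\<close>. The formula then turns idempotence
  into \<open>|S| m(Q) = |F(Q,S)| m(Q)\<^sup>2\<close>. Counting, modulo \<open>p\<close>, the left \<open>S\<close>-orbits that \<open>Q\<close> fixes and using that
  \<open>\<epsilon>(\<omega>\<^sub>F)\<close> is a unit gives \<open>m(Q) \<noteq> 0\<close>, hence \<open>m(Q) = |S|/|F(Q,S)|\<close> (\<open>mark_eq\<close>).

  Composing with \<open>[T,id]\<close> and \<open>[R,id]\<close> only restricts the actions. So the left-hand side has mark
  \<open>|S|/|F(Q,S)|\<close> at \<open>\<Delta>(Q,\<psi>)\<close> if \<open>\<psi> \<in> F(Q,R)\<close>, and \<open>0\<close> otherwise, while the right-hand side has mark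
  \<open>(|R||T|/(|R \<inter> T||K(Q,T)|)) \<Sum>\<^sub>\<chi> 1/|H(\<chi> Q,R)|\<close>, summed over those \<open>\<chi> \<in> K(Q, R \<inter> T)\<close> for which
  \<open>\<psi> \<chi>\<inverse>\<close> is a morphism of \<open>H\<close>, that is, over the ways to factor \<open>\<psi>\<close> through \<open>R \<inter> T\<close>.
  If one factorisation exists, the others differ from it by a morphism of \<open>H \<inter> K\<close>, so the sum is
  \<open>|(H \<inter> K)(Q',R \<inter> T)|/|H(Q',R)|\<close> for a \<open>K\<close>-conjugate \<open>Q' \<le> R \<inter> T\<close> of \<open>Q\<close>. Equality of the marks at
  \<open>Q = 1\<close> is \<open>S = RT\<close>, at the inclusions of subgroups of \<open>R \<inter> T\<close> it is the counting formula, and at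
  a general \<open>\<psi>\<close> its left side is nonzero, which forces a factorisation. Conversely these three facts
  give all equalities (\<open>factor_sum_iff\<close>).
\<close>

section \<open>Bisets and point stabilizers\<close>

text \<open>Each \<open>a\<close> acts bijectively because \<open>a\<inverse>\<close> acts as the inverse map.\<close>
lemma group_actionI:
  assumes "group A"
    and ext: "\<And>a. a \<in> carrier A \<Longrightarrow> \<phi> a \<in> extensional E"
    and closed: "\<And>a x. \<lbrakk>a \<in> carrier A; x \<in> E\<rbrakk> \<Longrightarrow> \<phi> a x \<in> E"
    and one: "\<And>x. x \<in> E \<Longrightarrow> \<phi> \<one>\<^bsub>A\<^esub> x = x"
    and mult: "\<And>a b x. \<lbrakk>a \<in> carrier A; b \<in> carrier A; x \<in> E\<rbrakk> \<Longrightarrow> \<phi> (a \<otimes>\<^bsub>A\<^esub> b) x = \<phi> a (\<phi> b x)"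
  shows "group_action A E \<phi>"
proof -
  interpret group A by fact
  have inverse: "\<phi> (inv\<^bsub>A\<^esub> a) (\<phi> a x) = x" if "a \<in> carrier A" "x \<in> E" for a x
    using that mult[of "inv\<^bsub>A\<^esub> a" a x] one by simp
  have inverse': "\<phi> a (\<phi> (inv\<^bsub>A\<^esub> a) x) = x" if "a \<in> carrier A" "x \<in> E" for a x
    using that mult[of a "inv\<^bsub>A\<^esub> a" x] one by simp
  have bij: "\<phi> a \<in> Bij E" if a: "a \<in> carrier A" for a
  proof -
    have "bij_betw (\<phi> a) E E"
      by (rule bij_betw_byWitness[where f' = "\<phi> (inv\<^bsub>A\<^esub> a)"])
        (use a in \<open>auto intro!: closed inverse inverse'\<close>)
    then show ?thesis
      using ext[OF a] by (simp add: Bij_def)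
  qed
  have "\<phi> (a \<otimes>\<^bsub>A\<^esub> b) = compose E (\<phi> a) (\<phi> b)" if "a \<in> carrier A" "b \<in> carrier A" for a b
    by (rule extensionalityI[where A = E]) (use that ext mult in \<open>auto simp: compose_def\<close>)
  then have "\<phi> \<in> hom A (BijGroup E)"
    using bij by (auto simp: hom_def BijGroup_def)
  then show ?thesis
    by (intro group_action.intro group_hom.intro group_hom_axioms.intro group_BijGroup is_group)
qed

lemma (in group_action) act_one: "x \<in> E \<Longrightarrow> \<phi> \<one> x = x"
  by (simp add: id_eq_one[symmetric])

lemma (in group_action) act_closed: "\<lbrakk>g \<in> carrier G; x \<in> E\<rbrakk> \<Longrightarrow> \<phi> g x \<in> E"
  using element_image by blast

text \<open>All invariants of bisets used below have this shape: marks are the case \<open>g M = [D \<subseteq> M]\<close>, the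
  augmentation is the case of a constant \<open>g\<close>, and stabilizers of points of a composite are products of
  stabilizers. Sums of this shape are additive and isomorphism invariant for every \<open>g\<close>.\<close>
definition stab_sum ::
    "('a, 'm) monoid_scheme \<Rightarrow> 'x set \<times> ('a \<Rightarrow> 'x \<Rightarrow> 'x) \<Rightarrow> ('a set \<Rightarrow> rat) \<Rightarrow> rat" where
  "stab_sum A X g = (\<Sum>x\<in>fst X. g (stabilizer A (snd X) x))"

lemma biset_iso_stab_sum:
  assumes X: "is_biset G H X" and iso: "biset_iso G H X Y"
  shows "stab_sum (H \<times>\<times> G) X g = stab_sum (H \<times>\<times> G) Y g"
proof -
  obtain f where f: "bij_betw f (fst X) (fst Y)"
    and eq: "\<And>a x. \<lbrakk>a \<in> carrier (H \<times>\<times> G); x \<in> fst X\<rbrakk> \<Longrightarrow> f (snd X a x) = snd Y a (f x)"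
    using iso by (auto simp: biset_iso_def)
  interpret group_action "H \<times>\<times> G" "fst X" "snd X"
    using X by (simp add: is_biset_def)
  have "stabilizer (H \<times>\<times> G) (snd X) x = stabilizer (H \<times>\<times> G) (snd Y) (f x)" if x: "x \<in> fst X" for x
  proof -
    have "snd X a x = x \<longleftrightarrow> snd Y a (f x) = f x" if "a \<in> carrier (H \<times>\<times> G)" for a
      using eq[OF that x] element_image[OF that x refl] x bij_betw_imp_inj_on[OF f]
      by (metis inj_on_eq_iff)
    then show ?thesis
      by (auto simp: stabilizer_def)
  qed
  then have "stab_sum (H \<times>\<times> G) X g = (\<Sum>x\<in>fst X. g (stabilizer (H \<times>\<times> G) (snd Y) (f x)))"
    by (simp add: stab_sum_def)
  also have "\<dots> = stab_sum (H \<times>\<times> G) Y g"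
    unfolding stab_sum_def using f by (rule sum.reindex_bij_betw)
  finally show ?thesis .
qed

lemma biset_iso_refl: "biset_iso G H X X"
  unfolding biset_iso_def by (rule exI[where x = "\<lambda>x. x"]) (auto simp: bij_betw_def)

lemma biset_iso_sym:
  assumes X: "is_biset G H X" and iso: "biset_iso G H X Y"
  shows "biset_iso G H Y X"
proof -
  obtain f where f: "bij_betw f (fst X) (fst Y)"
    and eq: "\<And>a x. \<lbrakk>a \<in> carrier (H \<times>\<times> G); x \<in> fst X\<rbrakk> \<Longrightarrow> f (snd X a x) = snd Y a (f x)"
    using iso by (auto simp: biset_iso_def)
  interpret group_action "H \<times>\<times> G" "fst X" "snd X"
    using X by (simp add: is_biset_def)
  have inj: "inj_on f (fst X)" and img: "f ` fst X = fst Y"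
    using f by (auto simp: bij_betw_def)
  have "inv_into (fst X) f (snd Y a y) = snd X a (inv_into (fst X) f y)"
    if a: "a \<in> carrier (H \<times>\<times> G)" and y: "y \<in> fst Y" for a y
  proof -
    obtain x where x: "x \<in> fst X" "y = f x" using y img by auto
    then show ?thesis
      using eq[OF a x(1)] element_image[OF a x(1) refl] inj by (metis inv_into_f_f)
  qed
  with bij_betw_inv_into[OF f] show ?thesis
    unfolding biset_iso_def by (intro exI[where x = "inv_into (fst X) f"]) auto
qed

lemma biset_iso_trans:
  assumes "biset_iso G H X Y" and "biset_iso G H Y Z"
  shows "biset_iso G H X Z"
proof -
  obtain f where f: "bij_betw f (fst X) (fst Y)"
    and eqf: "\<And>a x. \<lbrakk>a \<in> carrier (H \<times>\<times> G); x \<in> fst X\<rbrakk> \<Longrightarrow> f (snd X a x) = snd Y a (f x)"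
    using assms(1) by (auto simp: biset_iso_def)
  obtain g where g: "bij_betw g (fst Y) (fst Z)"
    and eqg: "\<And>a x. \<lbrakk>a \<in> carrier (H \<times>\<times> G); x \<in> fst Y\<rbrakk> \<Longrightarrow> g (snd Y a x) = snd Z a (g x)"
    using assms(2) by (auto simp: biset_iso_def)
  show ?thesis
    unfolding biset_iso_def
    by (rule exI[where x = "g \<circ> f"]) (use f g eqf eqg in \<open>auto simp: bij_betw_trans bij_betwE\<close>)
qed

lemma iso_class_eqI:
  assumes "is_biset G H X" and "biset_iso G H X Y"
  shows "iso_class G H X = iso_class G H Y"
  unfolding iso_class_def
  by (auto intro: biset_iso_trans[OF assms(2)] biset_iso_trans[OF biset_iso_sym[OF assms]])

text \<open>Classes consist of bisets on natural numbers, so a biset on any other type is first carried over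
  along an enumeration of its points.\<close>
lemma nat_biset_exists:
  fixes G :: "('g, 'm) monoid_scheme" and H :: "('h, 'n) monoid_scheme"
  assumes X: "is_biset G H X"
  obtains Y :: "('h, 'g, nat) biset" where "is_biset G H Y" "biset_iso G H X Y"
proof -
  obtain f where f: "bij_betw f (fst X) {0..<card (fst X)}"
    using X ex_bij_betw_finite_nat by (auto simp: is_biset_def)
  interpret group_action "H \<times>\<times> G" "fst X" "snd X"
    using X by (simp add: is_biset_def)
  define E where "E = {0..<card (fst X)}"
  define f' where "f' = inv_into (fst X) f"
  define \<psi> where "\<psi> = (\<lambda>a. \<lambda>n\<in>E. f (snd X a (f' n)))"
  have ff': "\<And>x. x \<in> fst X \<Longrightarrow> f' (f x) = x"
    unfolding f'_def using bij_betw_inv_into_left[OF f] .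
  have f'f: "\<And>n. n \<in> E \<Longrightarrow> f (f' n) = n"
    unfolding f'_def E_def using bij_betw_inv_into_right[OF f] .
  have fE: "\<And>x. x \<in> fst X \<Longrightarrow> f x \<in> E"
    unfolding E_def using f by (rule bij_betw_apply)
  have f'E: "\<And>n. n \<in> E \<Longrightarrow> f' n \<in> fst X"
    unfolding E_def f'_def using bij_betw_inv_into[OF f] by (rule bij_betw_apply)
  have "group_action (H \<times>\<times> G) E \<psi>"
  proof (rule group_actionI)
    show "group (H \<times>\<times> G)" using group_hom by (simp add: group_hom_def)
    show "\<psi> \<one>\<^bsub>H \<times>\<times> G\<^esub> n = n" if "n \<in> E" for n
      using that by (simp add: \<psi>_def act_one f'E f'f del: one_DirProd)
    show "\<psi> (a \<otimes>\<^bsub>H \<times>\<times> G\<^esub> b) n = \<psi> a (\<psi> b n)"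
      if "a \<in> carrier (H \<times>\<times> G)" "b \<in> carrier (H \<times>\<times> G)" "n \<in> E" for a b n
      using that act_closed[OF that(2) f'E[OF that(3)]] composition_rule[OF f'E[OF that(3)] that(1,2)]
      by (simp add: \<psi>_def fE ff' del: carrier_DirProd)
  qed (simp_all add: \<psi>_def fE act_closed f'E del: carrier_DirProd)
  then have "is_biset G H (E, \<psi>)"
    by (simp add: is_biset_def E_def)
  moreover have "biset_iso G H X (E, \<psi>)"
    unfolding biset_iso_def using f fE ff'
    by (intro exI[where x = f]) (simp add: E_def[symmetric] \<psi>_def del: carrier_DirProd)
  ultimately show thesis by (rule that)
qed

definition biset_classes ::
    "('g, 'm) monoid_scheme \<Rightarrow> ('h, 'n) monoid_scheme \<Rightarrow> ('h, 'g) biset_class set" where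
  "biset_classes G H = {iso_class G H (X :: ('h, 'g, nat) biset) | X. is_biset G H X}"

lemma iso_class_in_biset_classes:
  fixes G :: "('g, 'm) monoid_scheme" and H :: "('h, 'n) monoid_scheme"
  assumes "is_biset G H X"
  shows "iso_class G H X \<in> biset_classes G H"
proof -
  obtain Y :: "('h, 'g, nat) biset" where Y: "is_biset G H Y" "biset_iso G H X Y"
    using nat_biset_exists[OF assms] .
  have "iso_class G H X = iso_class G H Y"
    using assms Y(2) by (rule iso_class_eqI)
  with Y(1) show ?thesis
    unfolding biset_classes_def mem_Collect_eq by (intro exI[where x = Y] conjI)
qed

lemma biset_rep:
  fixes G :: "('g, 'm) monoid_scheme" and H :: "('h, 'n) monoid_scheme"
  assumes "c \<in> biset_classes G H"
  shows "is_biset G H (biset_rep c)" and "iso_class G H (biset_rep c) = c"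
proof -
  obtain X :: "('h, 'g, nat) biset" where X: "is_biset G H X" "c = iso_class G H X"
    using assms by (auto simp: biset_classes_def)
  have "X \<in> c"
    using X biset_iso_refl[of G H X] by (auto simp: iso_class_def)
  then have "biset_rep c \<in> c"
    unfolding biset_rep_def by (rule someI)
  then have rep: "is_biset G H (biset_rep c)" "biset_iso G H X (biset_rep c)"
    using X by (auto simp: iso_class_def)
  show "is_biset G H (biset_rep c)" by fact
  show "iso_class G H (biset_rep c) = c"
    using iso_class_eqI[OF X(1) rep(2)] X(2) by simp
qed

lemma biset_rep_iso_class:
  fixes G :: "('g, 'm) monoid_scheme" and H :: "('h, 'n) monoid_scheme"
  assumes X: "is_biset G H X"
  shows "biset_iso G H X (biset_rep (iso_class G H X))"
proof -
  obtain Y :: "('h, 'g, nat) biset" where Y: "is_biset G H Y" "biset_iso G H X Y"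
    using nat_biset_exists[OF X] .
  then have "Y \<in> iso_class G H X"
    by (simp add: iso_class_def)
  then have "biset_rep (iso_class G H X) \<in> iso_class G H X"
    unfolding biset_rep_def by (rule someI)
  then show ?thesis
    by (simp add: iso_class_def)
qed

lemma stab_sum_biset_rep:
  "is_biset G H X \<Longrightarrow> stab_sum (H \<times>\<times> G) (biset_rep (iso_class G H X)) g = stab_sum (H \<times>\<times> G) X g"
  by (rule biset_iso_stab_sum[OF _ biset_rep_iso_class, symmetric])

lemma is_biset_sum:
  assumes "is_biset G H X" and "is_biset G H Y"
  shows "is_biset G H (biset_sum X Y)"
proof -
  interpret X: group_action "H \<times>\<times> G" "fst X" "snd X"
    using assms by (simp add: is_biset_def)
  interpret Y: group_action "H \<times>\<times> G" "fst Y" "snd Y"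
    using assms by (simp add: is_biset_def)
  have "group_action (H \<times>\<times> G) (fst X <+> fst Y) (\<lambda>a. \<lambda>z\<in>fst X <+> fst Y. map_sum (snd X a) (snd Y a) z)"
  proof (rule group_actionI)
    show "group (H \<times>\<times> G)" using X.group_hom by (simp add: group_hom_def)
    show "(\<lambda>z\<in>fst X <+> fst Y. map_sum (snd X \<one>\<^bsub>H \<times>\<times> G\<^esub>) (snd Y \<one>\<^bsub>H \<times>\<times> G\<^esub>) z) z = z"
      if "z \<in> fst X <+> fst Y" for z
      using that by (auto simp: X.act_one Y.act_one simp del: one_DirProd)
    show "(\<lambda>z\<in>fst X <+> fst Y. map_sum (snd X (a \<otimes>\<^bsub>H \<times>\<times> G\<^esub> b)) (snd Y (a \<otimes>\<^bsub>H \<times>\<times> G\<^esub> b)) z) z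
        = (\<lambda>z\<in>fst X <+> fst Y. map_sum (snd X a) (snd Y a) z)
            ((\<lambda>z\<in>fst X <+> fst Y. map_sum (snd X b) (snd Y b) z) z)"
      if "a \<in> carrier (H \<times>\<times> G)" "b \<in> carrier (H \<times>\<times> G)" "z \<in> fst X <+> fst Y" for a b z
      using that(3)
      by (rule PlusE)
        (use that(1,2) in \<open>simp_all add: X.composition_rule Y.composition_rule X.act_closed Y.act_closed
          InlI InrI del: carrier_DirProd\<close>)
    show "(\<lambda>z\<in>fst X <+> fst Y. map_sum (snd X a) (snd Y a) z) z \<in> fst X <+> fst Y"
      if "a \<in> carrier (H \<times>\<times> G)" "z \<in> fst X <+> fst Y" for a z
      using that(2)
      by (rule PlusE) (use that(1) in \<open>simp_all add: X.act_closed Y.act_closed InlI InrI del: carrier_DirProd\<close>)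
  qed auto
  with assms show ?thesis
    by (simp add: is_biset_def biset_sum_def)
qed

lemma stab_sum_biset_sum:
  assumes "is_biset G H X" and "is_biset G H Y"
  shows "stab_sum (H \<times>\<times> G) (biset_sum X Y) g = stab_sum (H \<times>\<times> G) X g + stab_sum (H \<times>\<times> G) Y g"
proof -
  have "stabilizer (H \<times>\<times> G) (snd (biset_sum X Y)) (Inl x) = stabilizer (H \<times>\<times> G) (snd X) x"
    if "x \<in> fst X" for x
    using that by (auto simp: stabilizer_def biset_sum_def)
  moreover have "stabilizer (H \<times>\<times> G) (snd (biset_sum X Y)) (Inr y) = stabilizer (H \<times>\<times> G) (snd Y) y"
    if "y \<in> fst Y" for y
    using that by (auto simp: stabilizer_def biset_sum_def)
  ultimately show ?thesis
    using assms by (simp add: stab_sum_def is_biset_def biset_sum_def sum.Plus)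
qed

lemma is_biset_invariant_subset:
  assumes "is_biset G H X" and "E \<subseteq> fst X"
    and "\<And>a x. \<lbrakk>a \<in> carrier (H \<times>\<times> G); x \<in> E\<rbrakk> \<Longrightarrow> snd X a x \<in> E"
  shows "is_biset G H (E, \<lambda>a. restrict (snd X a) E)"
proof -
  interpret group_action "H \<times>\<times> G" "fst X" "snd X"
    using assms by (simp add: is_biset_def)
  have "group_action (H \<times>\<times> G) E (\<lambda>a. restrict (snd X a) E)"
  proof (rule group_actionI)
    show "group (H \<times>\<times> G)" using group_hom by (simp add: group_hom_def)
    show "restrict (snd X \<one>\<^bsub>H \<times>\<times> G\<^esub>) E x = x" if "x \<in> E" for x
      using that assms(2) act_one by (auto simp del: one_DirProd)
    show "restrict (snd X (a \<otimes>\<^bsub>H \<times>\<times> G\<^esub> b)) E x = restrict (snd X a) E (restrict (snd X b) E x)"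
      if "a \<in> carrier (H \<times>\<times> G)" "b \<in> carrier (H \<times>\<times> G)" "x \<in> E" for a b x
      using that assms(3)[OF that(2,3)] composition_rule[OF subsetD[OF assms(2) that(3)] that(1,2)] by simp
  qed (use assms(3) in auto)
  then show ?thesis
    using assms finite_subset by (auto simp: is_biset_def)
qed

definition transitive_on where
  "transitive_on A X \<longleftrightarrow> fst X \<noteq> {} \<and> (\<forall>x\<in>fst X. \<forall>y\<in>fst X. \<exists>a\<in>carrier A. snd X a x = y)"

lemma transitive_on_eq_image:
  assumes "group_action A (fst X) (snd X)" "transitive_on A X" "x \<in> fst X"
  shows "fst X = (\<lambda>a. snd X a x) ` carrier A"
  using assms group_action.act_closed[OF assms(1)] by (force simp: transitive_on_def)

lemma (in group_action) action_eq_iff: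
  assumes "x \<in> E" "a \<in> carrier G" "b \<in> carrier G"
  shows "\<phi> a x = \<phi> b x \<longleftrightarrow> inv b \<otimes> a \<in> stabilizer G \<phi> x"
proof -
  interpret group G
    using group_hom by (simp add: group_hom_def)
  have "\<phi> (inv b \<otimes> a) x = \<phi> (inv b) (\<phi> a x)"
    using assms by (simp add: composition_rule)
  moreover have "\<phi> b (\<phi> (inv b) (\<phi> a x)) = \<phi> a x"
    using orbit_sym_aux[of "inv b" "\<phi> a x"] element_image[OF assms(2,1) refl] assms by simp
  ultimately show ?thesis
    using assms orbit_sym_aux[OF assms(3,1)] by (auto simp: stabilizer_def)
qed

text \<open>Both sets are the coset space of the common stabilizer: by \<open>action_eq_iff\<close> the assignment
  \<open>a x \<mapsto> a y\<close> is well defined and injective.\<close>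
lemma transitive_biset_isoI:
  assumes X: "is_biset G H X" "transitive_on (H \<times>\<times> G) X" "x \<in> fst X"
    and Y: "is_biset G H Y" "transitive_on (H \<times>\<times> G) Y" "y \<in> fst Y"
    and stab: "stabilizer (H \<times>\<times> G) (snd X) x = stabilizer (H \<times>\<times> G) (snd Y) y"
  shows "biset_iso G H X Y"
proof -
  interpret X: group_action "H \<times>\<times> G" "fst X" "snd X"
    using X by (simp add: is_biset_def)
  interpret Y: group_action "H \<times>\<times> G" "fst Y" "snd Y"
    using Y by (simp add: is_biset_def)
  interpret group "H \<times>\<times> G"
    using X.group_hom by (simp add: group_hom_def)
  define b where "b z = (SOME a. a \<in> carrier (H \<times>\<times> G) \<and> snd X a x = z)" for z
  define f where "f z = snd Y (b z) y" for z
  have b: "b z \<in> carrier (H \<times>\<times> G)" "snd X (b z) x = z" if "z \<in> fst X" for z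
    using someI_ex[of "\<lambda>a. a \<in> carrier (H \<times>\<times> G) \<and> snd X a x = z"] X that
    unfolding b_def transitive_on_def by blast+
  have eq: "snd X a x = snd X c x \<longleftrightarrow> snd Y a y = snd Y c y"
    if "a \<in> carrier (H \<times>\<times> G)" "c \<in> carrier (H \<times>\<times> G)" for a c
    using X.action_eq_iff[OF X(3) that] Y.action_eq_iff[OF Y(3) that] stab by simp
  have f: "f (snd X a x) = snd Y a y" if "a \<in> carrier (H \<times>\<times> G)" for a
    unfolding f_def using that b[OF X.element_image[OF that X(3) refl]] eq by blast
  have X_img: "fst X = (\<lambda>a. snd X a x) ` carrier (H \<times>\<times> G)"
    using X.group_action_axioms X(2,3) by (rule transitive_on_eq_image)
  have Y_img: "fst Y = (\<lambda>a. snd Y a y) ` carrier (H \<times>\<times> G)"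
    using Y.group_action_axioms Y(2,3) by (rule transitive_on_eq_image)
  have "inj_on f (fst X)"
    unfolding X_img using f eq by (auto simp: inj_on_def simp del: carrier_DirProd)
  moreover have "f ` fst X = fst Y"
    unfolding X_img Y_img using f by (simp add: image_image cong: image_cong_simp del: carrier_DirProd)
  moreover have "f (snd X a z) = snd Y a (f z)" if "a \<in> carrier (H \<times>\<times> G)" "z \<in> fst X" for a z
    using f[of "a \<otimes>\<^bsub>H \<times>\<times> G\<^esub> b z"] f[OF b(1)[OF that(2)]] that b[OF that(2)]
      X.composition_rule[OF X(3) that(1) b(1)[OF that(2)]]
      Y.composition_rule[OF Y(3) that(1) b(1)[OF that(2)]] by (simp del: carrier_DirProd)
  ultimately show ?thesis
    unfolding biset_iso_def bij_betw_def by blast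
qed

lemma transitive_biset_card:
  assumes X: "is_biset G H X" "transitive_on (H \<times>\<times> G) X" "x \<in> fst X"
  shows "card (fst X) * card (stabilizer (H \<times>\<times> G) (snd X) x) = order (H \<times>\<times> G)"
proof -
  interpret X: group_action "H \<times>\<times> G" "fst X" "snd X"
    using X by (simp add: is_biset_def)
  have "fst X = orbit (H \<times>\<times> G) (snd X) x"
    using transitive_on_eq_image[OF X.group_action_axioms X(2,3)] by (auto simp: orbit_def)
  then show ?thesis
    using X.orbit_stabilizer_theorem[OF X(3)] by simp
qed

section \<open>Marks and the relations of the Burnside module\<close>

lemma localized_ints_of_int: "prime p \<Longrightarrow> of_int k \<in> localized_ints p"
  unfolding localized_ints_def
  by (rule CollectI, rule exI[where x = k], rule exI[where x = 1]) (auto dest: not_prime_unit)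

lemma localized_ints_diff:
  assumes p: "prime p" and x: "x \<in> localized_ints p" and y: "y \<in> localized_ints p"
  shows "x - y \<in> localized_ints p"
proof -
  obtain a b where ab: "x = of_int a / of_int b" "\<not> int p dvd b"
    using x by (auto simp: localized_ints_def)
  obtain c d where cd: "y = of_int c / of_int d" "\<not> int p dvd d"
    using y by (auto simp: localized_ints_def)
  have nz: "b \<noteq> 0" "d \<noteq> 0" using ab cd by auto
  have "x - y = of_int (a * d - c * b) / of_int (b * d)"
    using ab cd nz by (simp add: diff_frac_eq)
  moreover have "\<not> int p dvd b * d"
    using ab cd p by (simp add: prime_dvd_mult_iff)
  ultimately show ?thesis
    unfolding localized_ints_def by blast
qed

lemma localized_ints_zero: "prime p \<Longrightarrow> 0 \<in> localized_ints p"
  using localized_ints_of_int[of p 0] by simp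

lemma localized_ints_one: "prime p \<Longrightarrow> 1 \<in> localized_ints p"
  using localized_ints_of_int[of p 1] by simp

lemma localized_ints_uminus: "\<lbrakk>prime p; x \<in> localized_ints p\<rbrakk> \<Longrightarrow> - x \<in> localized_ints p"
  using localized_ints_diff[OF _ localized_ints_zero, of p x] by simp

lemma localized_ints_add:
  "\<lbrakk>prime p; x \<in> localized_ints p; y \<in> localized_ints p\<rbrakk> \<Longrightarrow> x + y \<in> localized_ints p"
  using localized_ints_diff[of p x "- y"] localized_ints_uminus[of p y] by simp

lemma localized_ints_mult:
  assumes p: "prime p" and x: "x \<in> localized_ints p" and y: "y \<in> localized_ints p"
  shows "x * y \<in> localized_ints p"
proof -
  obtain a b where ab: "x = of_int a / of_int b" "\<not> int p dvd b"
    using x by (auto simp: localized_ints_def)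
  obtain c d where cd: "y = of_int c / of_int d" "\<not> int p dvd d"
    using y by (auto simp: localized_ints_def)
  have "x * y = of_int (a * c) / of_int (b * d)"
    using ab cd by simp
  moreover have "\<not> int p dvd b * d"
    using ab cd p by (simp add: prime_dvd_mult_iff)
  ultimately show ?thesis
    unfolding localized_ints_def by blast
qed

lemma free_bisets_carrier_iff:
  "x \<in> carrier (free_bisets p G H) \<longleftrightarrow>
     Poly_Mapping.keys x \<subseteq> biset_classes G H \<and> (\<forall>c. Poly_Mapping.lookup x c \<in> localized_ints p)"
  by (auto simp: free_bisets_def biset_classes_def)

lemma single_in_free_bisets:
  "\<lbrakk>prime p; c \<in> biset_classes G H; r \<in> localized_ints p\<rbrakk>
    \<Longrightarrow> Poly_Mapping.single c r \<in> carrier (free_bisets p G H)"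
  by (simp add: free_bisets_carrier_iff lookup_single when_def localized_ints_zero)

lemma keys_minus_subset: "Poly_Mapping.keys (x - y) \<subseteq> Poly_Mapping.keys x \<union> Poly_Mapping.keys y"
  for x y :: "'c \<Rightarrow>\<^sub>0 rat"
  by (auto simp: in_keys_iff lookup_minus)

lemma keys_plus_subset: "Poly_Mapping.keys (x + y) \<subseteq> Poly_Mapping.keys x \<union> Poly_Mapping.keys y"
  for x y :: "'c \<Rightarrow>\<^sub>0 rat"
  by (rule keys_add)

lemma free_bisets_minus_closed:
  "\<lbrakk>prime p; x \<in> carrier (free_bisets p G H); y \<in> carrier (free_bisets p G H)\<rbrakk>
    \<Longrightarrow> x - y \<in> carrier (free_bisets p G H)"
  using keys_minus_subset[of x y]
  by (auto simp: free_bisets_carrier_iff lookup_minus localized_ints_diff)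

lemma free_bisets_plus_closed:
  "\<lbrakk>prime p; x \<in> carrier (free_bisets p G H); y \<in> carrier (free_bisets p G H)\<rbrakk>
    \<Longrightarrow> x + y \<in> carrier (free_bisets p G H)"
  using keys_plus_subset[of x y]
  by (auto simp: free_bisets_carrier_iff lookup_add localized_ints_add)

lemma free_bisets_zero_closed: "prime p \<Longrightarrow> 0 \<in> carrier (free_bisets p G H)"
  by (auto simp: free_bisets_carrier_iff localized_ints_zero)

lemma free_bisets_sum_closed:
  "\<lbrakk>prime p; \<And>i. i \<in> I \<Longrightarrow> f i \<in> carrier (free_bisets p G H)\<rbrakk>
    \<Longrightarrow> (\<Sum>i\<in>I. f i) \<in> carrier (free_bisets p G H)"
  by (induction I rule: infinite_finite_induct)
    (auto simp: free_bisets_zero_closed free_bisets_plus_closed)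

lemma free_bisets_comm_group:
  assumes p: "prime p"
  shows "comm_group (free_bisets p G H)"
proof (rule comm_groupI)
  fix x assume x: "x \<in> carrier (free_bisets p G H)"
  then have "- x \<in> carrier (free_bisets p G H)"
    using free_bisets_minus_closed[OF p free_bisets_zero_closed[OF p] x] by simp
  then show "\<exists>y\<in>carrier (free_bisets p G H).
      y \<otimes>\<^bsub>free_bisets p G H\<^esub> x = \<one>\<^bsub>free_bisets p G H\<^esub>"
    by (intro bexI[where x = "- x"]) (simp_all add: free_bisets_def)
qed (use p in \<open>auto simp: free_bisets_zero_closed free_bisets_plus_closed free_bisets_def[THEN arg_cong[where f = monoid.mult]]
  free_bisets_def[THEN arg_cong[where f = one]] ac_simps\<close>)

lemma free_bisets_inv:
  assumes p: "prime p" and x: "x \<in> carrier (free_bisets p G H)"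
  shows "inv\<^bsub>free_bisets p G H\<^esub> x = - x"
proof -
  interpret comm_group "free_bisets p G H"
    using p by (rule free_bisets_comm_group)
  have "- x \<in> carrier (free_bisets p G H)"
    using free_bisets_minus_closed[OF p free_bisets_zero_closed[OF p] x] by simp
  then show ?thesis
    using x by (intro inv_equality) (simp_all add: free_bisets_def)
qed

definition burnside_sum ::
    "('g, 'm) monoid_scheme \<Rightarrow> ('h, 'n) monoid_scheme \<Rightarrow> (('h, 'g) biset_class \<Rightarrow>\<^sub>0 rat)
      \<Rightarrow> (('h \<times> 'g) set \<Rightarrow> rat) \<Rightarrow> rat" where
  "burnside_sum G H x g =
     (\<Sum>c\<in>Poly_Mapping.keys x. Poly_Mapping.lookup x c * stab_sum (H \<times>\<times> G) (biset_rep c) g)"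

lemma burnside_sum_superset:
  assumes "finite S" "Poly_Mapping.keys x \<subseteq> S"
  shows "burnside_sum G H x g = (\<Sum>c\<in>S. Poly_Mapping.lookup x c * stab_sum (H \<times>\<times> G) (biset_rep c) g)"
  unfolding burnside_sum_def
  by (rule sum.mono_neutral_left) (use assms in \<open>auto simp: in_keys_iff\<close>)

lemma burnside_sum_zero [simp]: "burnside_sum G H 0 g = 0"
  by (simp add: burnside_sum_def)

lemma burnside_sum_plus: "burnside_sum G H (x + y) g = burnside_sum G H x g + burnside_sum G H y g"
proof -
  let ?S = "Poly_Mapping.keys x \<union> Poly_Mapping.keys y"
  have "burnside_sum G H z g = (\<Sum>c\<in>?S. Poly_Mapping.lookup z c * stab_sum (H \<times>\<times> G) (biset_rep c) g)"
    if "Poly_Mapping.keys z \<subseteq> ?S" for z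
    using that by (intro burnside_sum_superset) auto
  from this[of x] this[of y] this[of "x + y"] keys_plus_subset[of x y] show ?thesis
    by (simp add: lookup_add ring_distribs sum.distrib)
qed

lemma burnside_sum_minus: "burnside_sum G H (x - y) g = burnside_sum G H x g - burnside_sum G H y g"
  using burnside_sum_plus[of G H "x - y" y g] by simp

lemma burnside_sum_sum: "burnside_sum G H (\<Sum>i\<in>I. f i) g = (\<Sum>i\<in>I. burnside_sum G H (f i) g)"
  by (induction I rule: infinite_finite_induct) (auto simp: burnside_sum_plus)

lemma burnside_sum_single:
  assumes "is_biset G H X"
  shows "burnside_sum G H (Poly_Mapping.single (iso_class G H X) r) g = r * stab_sum (H \<times>\<times> G) X g"
  using assms by (simp add: burnside_sum_def stab_sum_biset_rep)

lemma sum_relations_subgroup: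
  fixes G :: "('g, 'm) monoid_scheme" and H :: "('h, 'n) monoid_scheme"
  assumes p: "prime p"
  shows "subgroup (sum_relations p G H) (free_bisets p G H)"
  unfolding sum_relations_def
proof (rule group.generate_is_subgroup)
  show "group (free_bisets p G H)"
    using free_bisets_comm_group[OF p] by (rule comm_group.axioms(2))
  have "Poly_Mapping.single (iso_class G H (biset_sum X Y)) r
      - Poly_Mapping.single (iso_class G H X) r - Poly_Mapping.single (iso_class G H Y) r
    \<in> carrier (free_bisets p G H)"
    if "is_biset G H X" "is_biset G H Y" "r \<in> localized_ints p"
    for X Y :: "('h, 'g, nat) biset" and r
    using p that by (intro free_bisets_minus_closed single_in_free_bisets iso_class_in_biset_classes is_biset_sum)
  then show "{Poly_Mapping.single (iso_class G H (biset_sum X Y)) r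
        - Poly_Mapping.single (iso_class G H X) r - Poly_Mapping.single (iso_class G H Y) r
      | (X :: ('h, 'g, nat) biset) (Y :: ('h, 'g, nat) biset) r.
        is_biset G H X \<and> is_biset G H Y \<and> r \<in> localized_ints p} \<subseteq> carrier (free_bisets p G H)"
    by blast
qed

lemma sum_relations_plus:
  assumes "prime p" "x \<in> sum_relations p G H" "y \<in> sum_relations p G H"
  shows "x + y \<in> sum_relations p G H"
  using subgroup.m_closed[OF sum_relations_subgroup[OF assms(1)] assms(2,3)] by (simp add: free_bisets_def)

lemma sum_relations_zero: "prime p \<Longrightarrow> 0 \<in> sum_relations p G H"
  using subgroup.one_closed[OF sum_relations_subgroup, of p G H] by (simp add: free_bisets_def)

lemma sum_relations_uminus:
  assumes "prime p" "x \<in> sum_relations p G H"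
  shows "- x \<in> sum_relations p G H"
  using subgroup.m_inv_closed[OF sum_relations_subgroup[OF assms(1)] assms(2)]
    free_bisets_inv[OF assms(1) subgroup.mem_carrier[OF sum_relations_subgroup[OF assms(1)] assms(2)]]
  by simp

lemma sum_relations_carrier:
  "\<lbrakk>prime p; x \<in> sum_relations p G H\<rbrakk> \<Longrightarrow> x \<in> carrier (free_bisets p G H)"
  by (rule subgroup.mem_carrier[OF sum_relations_subgroup])

lemma sum_relations_sum:
  "\<lbrakk>prime p; \<And>i. i \<in> I \<Longrightarrow> f i \<in> sum_relations p G H\<rbrakk> \<Longrightarrow> (\<Sum>i\<in>I. f i) \<in> sum_relations p G H"
  by (induction I rule: infinite_finite_induct) (auto simp: sum_relations_zero sum_relations_plus)

text \<open>Hence these sums descend to the Burnside module. They are all that is ever used to tell its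
  elements apart.\<close>
lemma burnside_sum_sum_relations:
  fixes G :: "('g, 'm) monoid_scheme" and H :: "('h, 'n) monoid_scheme"
  assumes p: "prime p" and x: "x \<in> sum_relations p G H"
  shows "burnside_sum G H x g = 0"
proof -
  let ?R = "{Poly_Mapping.single (iso_class G H (biset_sum X Y)) r
        - Poly_Mapping.single (iso_class G H X) r - Poly_Mapping.single (iso_class G H Y) r
      | (X :: ('h, 'g, nat) biset) (Y :: ('h, 'g, nat) biset) r.
        is_biset G H X \<and> is_biset G H Y \<and> r \<in> localized_ints p}"
  have gen: "burnside_sum G H h g = 0 \<and> h \<in> carrier (free_bisets p G H)" if h: "h \<in> ?R" for h
  proof -
    obtain X Y :: "('h, 'g, nat) biset" and r where XY: "is_biset G H X" "is_biset G H Y"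
      and "h = Poly_Mapping.single (iso_class G H (biset_sum X Y)) r
        - Poly_Mapping.single (iso_class G H X) r - Poly_Mapping.single (iso_class G H Y) r"
      using h by blast
    then have "burnside_sum G H h g = 0"
      using is_biset_sum[OF XY] stab_sum_biset_sum[OF XY]
      by (simp add: burnside_sum_minus burnside_sum_single ring_distribs)
    moreover have "h \<in> sum_relations p G H"
      unfolding sum_relations_def using h by (rule generate.incl)
    ultimately show ?thesis
      using sum_relations_carrier[OF p] by blast
  qed
  show ?thesis
    using x unfolding sum_relations_def
  proof (induction rule: generate.induct)
    case one
    then show ?case by (simp add: free_bisets_def)
  next
    case (incl h)
    then show ?case using gen by blast
  next
    case (inv h)
    then have "inv\<^bsub>free_bisets p G H\<^esub> h = 0 - h" "burnside_sum G H h g = 0"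
      using free_bisets_inv[OF p, of h G H] gen[OF inv] by simp_all
    then show ?case by (metis burnside_sum_minus burnside_sum_zero diff_zero)
  next
    case (eng x y)
    then show ?case by (simp add: free_bisets_def burnside_sum_plus)
  qed
qed

definition transitive_classes ::
    "('g, 'm) monoid_scheme \<Rightarrow> ('h, 'n) monoid_scheme \<Rightarrow> ('h, 'g) biset_class set" where
  "transitive_classes G H = {c \<in> biset_classes G H. transitive_on (H \<times>\<times> G) (biset_rep c)}"

lemma transitive_on_biset_iso:
  assumes iso: "biset_iso G H X Y" and X: "transitive_on (H \<times>\<times> G) X"
  shows "transitive_on (H \<times>\<times> G) Y"
proof -
  obtain f where f: "bij_betw f (fst X) (fst Y)"
    and eq: "\<And>a x. \<lbrakk>a \<in> carrier (H \<times>\<times> G); x \<in> fst X\<rbrakk> \<Longrightarrow> f (snd X a x) = snd Y a (f x)"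
    using iso by (auto simp: biset_iso_def)
  have img: "fst Y = f ` fst X"
    using f by (simp add: bij_betw_def)
  have "\<exists>a\<in>carrier (H \<times>\<times> G). snd Y a (f x) = f x'" if xx': "x \<in> fst X" "x' \<in> fst X" for x x'
  proof -
    obtain a where a: "a \<in> carrier (H \<times>\<times> G)" "snd X a x = x'"
      using X xx' unfolding transitive_on_def by meson
    show ?thesis
      using eq[OF a(1) xx'(1)] a by (intro bexI[where x = a]) simp_all
  qed
  then show ?thesis
    using X unfolding transitive_on_def img by auto
qed

text \<open>Splitting off one orbit at a time. The empty biset is a relation by itself, because it is
  isomorphic to two copies of itself.\<close>
lemma decompose_biset:
  fixes G :: "('g, 'm) monoid_scheme" and H :: "('h, 'n) monoid_scheme"
    and X :: "('h, 'g, nat) biset"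
  assumes p: "prime p" and r: "r \<in> localized_ints p" and "is_biset G H X"
  shows "\<exists>x'\<in>carrier (free_bisets p G H). Poly_Mapping.keys x' \<subseteq> transitive_classes G H \<and>
    Poly_Mapping.single (iso_class G H X) r - x' \<in> sum_relations p G H"
  using assms(3)
proof (induction "card (fst X)" arbitrary: X rule: less_induct)
  case less
  have relation: "Poly_Mapping.single (iso_class G H (biset_sum Y Z)) r
        - Poly_Mapping.single (iso_class G H Y) r - Poly_Mapping.single (iso_class G H Z) r
      \<in> sum_relations p G H" if "is_biset G H Y" "is_biset G H Z" for Y Z :: "('h, 'g, nat) biset"
    unfolding sum_relations_def using that r by (intro generate.incl) blast
  interpret group_action "H \<times>\<times> G" "fst X" "snd X"
    using less.prems by (simp add: is_biset_def)
  interpret group "H \<times>\<times> G"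
    using group_hom by (simp add: group_hom_def)
  show ?case
  proof (cases "fst X = {}")
    case True
    have "biset_iso G H X (biset_sum X X)"
      unfolding biset_iso_def by (rule exI[where x = Inl]) (simp add: True biset_sum_def bij_betw_def Plus_def)
    then have "iso_class G H (biset_sum X X) = iso_class G H X"
      using iso_class_eqI[OF less.prems] by metis
    then have "- Poly_Mapping.single (iso_class G H X) r \<in> sum_relations p G H"
      using relation[OF less.prems less.prems] by simp
    then have "Poly_Mapping.single (iso_class G H X) r - 0 \<in> sum_relations p G H"
      using sum_relations_uminus[OF p] by fastforce
    then show ?thesis
      using free_bisets_zero_closed[OF p, of G H] by (intro bexI[where x = 0]) simp_all
  next
    case False
    then obtain z where z: "z \<in> fst X" by auto
    define E where "E = orbit (H \<times>\<times> G) (snd X) z"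
    have E: "E = (\<lambda>a. snd X a z) ` carrier (H \<times>\<times> G)"
      by (auto simp: E_def orbit_def)
    have EX: "E \<subseteq> fst X"
      unfolding E using act_closed z by blast
    have invE: "snd X a w \<in> E" if aw: "a \<in> carrier (H \<times>\<times> G)" "w \<in> E" for a w
    proof -
      obtain b where b: "b \<in> carrier (H \<times>\<times> G)" "w = snd X b z"
        using aw(2) unfolding E by blast
      then have "snd X a w = snd X (a \<otimes>\<^bsub>H \<times>\<times> G\<^esub> b) z"
        using composition_rule[OF z aw(1) b(1)] by (simp del: carrier_DirProd)
      moreover have "a \<otimes>\<^bsub>H \<times>\<times> G\<^esub> b \<in> carrier (H \<times>\<times> G)"
        using aw(1) b(1) by (rule m_closed)
      ultimately show ?thesis
        unfolding E by blast
    qed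
    have invE': "snd X a w \<in> fst X - E" if a: "a \<in> carrier (H \<times>\<times> G)" and w: "w \<in> fst X - E" for a w
    proof -
      have wX: "w \<in> fst X" using w by simp
      have "snd X a w \<in> E \<Longrightarrow> w \<in> E"
        using invE[OF inv_closed[OF a], of "snd X a w"] orbit_sym_aux[OF a wX refl] by simp
      then show ?thesis
        using w act_closed[OF a wX] by blast
    qed
    define X1 where "X1 = (E, \<lambda>a. restrict (snd X a) E)"
    define X2 where "X2 = (fst X - E, \<lambda>a. restrict (snd X a) (fst X - E))"
    have X1: "is_biset G H X1" and X2: "is_biset G H X2"
      unfolding X1_def X2_def using less.prems EX invE invE'
      by (auto intro!: is_biset_invariant_subset simp del: carrier_DirProd)
    have "biset_iso G H X (biset_sum X1 X2)"
    proof -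
      let ?f = "\<lambda>w. if w \<in> E then Inl w else Inr w"
      have "bij_betw ?f (fst X) (fst (biset_sum X1 X2))"
        using EX by (auto simp: bij_betw_def inj_on_def biset_sum_def X1_def X2_def)
      moreover have "?f (snd X a w) = snd (biset_sum X1 X2) a (?f w)"
        if "a \<in> carrier (H \<times>\<times> G)" "w \<in> fst X" for a w
        using that invE[OF that(1), of w] invE'[OF that(1), of w]
        by (auto simp: biset_sum_def X1_def X2_def simp del: carrier_DirProd)
      ultimately show ?thesis
        unfolding biset_iso_def by blast
    qed
    then have rel: "Poly_Mapping.single (iso_class G H X) r
        - Poly_Mapping.single (iso_class G H X1) r - Poly_Mapping.single (iso_class G H X2) r
      \<in> sum_relations p G H"
      using relation[OF X1 X2] iso_class_eqI[OF less.prems] by metis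
    have "card (fst X2) < card (fst X)"
      unfolding X2_def using less.prems z orbit_refl[OF z]
      by (auto simp: is_biset_def E_def intro!: psubset_card_mono)
    from less.hyps[OF this X2] obtain x2 where x2: "x2 \<in> carrier (free_bisets p G H)"
        "Poly_Mapping.keys x2 \<subseteq> transitive_classes G H"
        "Poly_Mapping.single (iso_class G H X2) r - x2 \<in> sum_relations p G H"
      by blast
    have "transitive_on (H \<times>\<times> G) X1"
      unfolding transitive_on_def
    proof (intro conjI ballI)
      show "fst X1 \<noteq> {}" using orbit_refl[OF z] by (auto simp: X1_def E_def)
      fix w w' assume w: "w \<in> fst X1" "w' \<in> fst X1"
      then obtain b b' where b: "b \<in> carrier (H \<times>\<times> G)" "w = snd X b z" "b' \<in> carrier (H \<times>\<times> G)" "w' = snd X b' z"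
        by (auto simp: X1_def E simp del: carrier_DirProd)
      have "snd X (b' \<otimes>\<^bsub>H \<times>\<times> G\<^esub> inv\<^bsub>H \<times>\<times> G\<^esub> b) w = w'"
        using composition_rule[OF act_closed[OF b(1) z] b(3) inv_closed[OF b(1)]] orbit_sym_aux[OF b(1) z refl] b
        by (simp del: carrier_DirProd)
      then show "\<exists>a\<in>carrier (H \<times>\<times> G). snd X1 a w = w'"
        using b(1,3) w by (intro bexI[where x = "b' \<otimes>\<^bsub>H \<times>\<times> G\<^esub> inv\<^bsub>H \<times>\<times> G\<^esub> b"])
          (simp_all add: X1_def m_closed inv_closed del: carrier_DirProd)
    qed
    then have "iso_class G H X1 \<in> transitive_classes G H"
      using iso_class_in_biset_classes[OF X1] transitive_on_biset_iso[OF biset_rep_iso_class[OF X1]]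
      by (simp add: transitive_classes_def)
    then have "Poly_Mapping.keys (Poly_Mapping.single (iso_class G H X1) r + x2) \<subseteq> transitive_classes G H"
      using keys_plus_subset[of "Poly_Mapping.single (iso_class G H X1) r" x2] x2 by (auto split: if_splits)
    moreover have "Poly_Mapping.single (iso_class G H X1) r + x2 \<in> carrier (free_bisets p G H)"
      using p r x2 X1 by (intro free_bisets_plus_closed single_in_free_bisets iso_class_in_biset_classes)
    moreover have "Poly_Mapping.single (iso_class G H X) r - (Poly_Mapping.single (iso_class G H X1) r + x2)
        \<in> sum_relations p G H"
      using sum_relations_plus[OF p rel x2(3)] by (simp add: algebra_simps)
    ultimately show ?thesis by blast
  qed
qed

lemma decompose_free_bisets:
  fixes G :: "('g, 'm) monoid_scheme" and H :: "('h, 'n) monoid_scheme"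
  assumes p: "prime p" and x: "x \<in> carrier (free_bisets p G H)"
  shows "\<exists>x'\<in>carrier (free_bisets p G H). Poly_Mapping.keys x' \<subseteq> transitive_classes G H \<and>
    x - x' \<in> sum_relations p G H"
proof -
  have "\<exists>x'\<in>carrier (free_bisets p G H). Poly_Mapping.keys x' \<subseteq> transitive_classes G H \<and>
    Poly_Mapping.single c (Poly_Mapping.lookup x c) - x' \<in> sum_relations p G H"
    if c: "c \<in> Poly_Mapping.keys x" for c
  proof -
    have "c \<in> biset_classes G H" and r: "Poly_Mapping.lookup x c \<in> localized_ints p"
      using x c by (auto simp: free_bisets_carrier_iff)
    from biset_rep[OF this(1)] show ?thesis
      using decompose_biset[OF p r, of G H "biset_rep c"] by simp
  qed
  then obtain f where f: "\<And>c. c \<in> Poly_Mapping.keys x \<Longrightarrow> f c \<in> carrier (free_bisets p G H)"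
    "\<And>c. c \<in> Poly_Mapping.keys x \<Longrightarrow> Poly_Mapping.keys (f c) \<subseteq> transitive_classes G H"
    "\<And>c. c \<in> Poly_Mapping.keys x \<Longrightarrow>
      Poly_Mapping.single c (Poly_Mapping.lookup x c) - f c \<in> sum_relations p G H"
    by metis
  let ?x = "\<Sum>c\<in>Poly_Mapping.keys x. f c"
  have "Poly_Mapping.keys ?x \<subseteq> (\<Union>c\<in>Poly_Mapping.keys x. Poly_Mapping.keys (f c))"
    by (rule keys_sum)
  then have "Poly_Mapping.keys ?x \<subseteq> transitive_classes G H"
    using f(2) by blast
  moreover have "?x \<in> carrier (free_bisets p G H)"
    using p f(1) by (rule free_bisets_sum_closed)
  moreover have "x = (\<Sum>c\<in>Poly_Mapping.keys x. Poly_Mapping.single c (Poly_Mapping.lookup x c))"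
    by (rule poly_mapping_eqI) (simp add: lookup_sum lookup_single when_def in_keys_iff)
  then have "x - ?x = (\<Sum>c\<in>Poly_Mapping.keys x. Poly_Mapping.single c (Poly_Mapping.lookup x c) - f c)"
    by (simp add: sum_subtractf)
  then have "x - ?x \<in> sum_relations p G H"
    using sum_relations_sum[OF p f(3)] by simp
  ultimately show ?thesis by blast
qed

definition mark ::
    "('g, 'm) monoid_scheme \<Rightarrow> ('h, 'n) monoid_scheme \<Rightarrow> ('h \<times> 'g) set
      \<Rightarrow> (('h, 'g) biset_class \<Rightarrow>\<^sub>0 rat) \<Rightarrow> rat" where
  "mark G H D x = burnside_sum G H x (\<lambda>M. of_bool (D \<subseteq> M))"

text \<open>This is the triangularity of the table of marks. Among the classes that occur choose one of least
  cardinality, that is, with largest stabilizer \<open>D\<close>. In any other class a point fixed by \<open>D\<close> would have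
  stabilizer exactly \<open>D\<close> and make the two classes equal, so the mark at \<open>D\<close> sees this class alone.\<close>
lemma transitive_free_bisets_eq_zeroI:
  fixes G :: "('g, 'm) monoid_scheme" and H :: "('h, 'n) monoid_scheme"
  assumes fin: "finite (carrier (H \<times>\<times> G))"
    and keys: "Poly_Mapping.keys x \<subseteq> transitive_classes G H"
    and marks: "\<And>D. subgroup D (H \<times>\<times> G) \<Longrightarrow> mark G H D x = 0"
  shows "x = 0"
proof (rule ccontr)
  assume "x \<noteq> 0"
  define n where "n c = card (fst (biset_rep c))" for c :: "('h, 'g) biset_class"
  obtain c where c: "c \<in> Poly_Mapping.keys x" and min: "\<And>d. d \<in> Poly_Mapping.keys x \<Longrightarrow> n c \<le> n d"
    using \<open>x \<noteq> 0\<close> arg_min_if_finite[of "Poly_Mapping.keys x" n] by (metis finite_keys keys_eq_empty not_less)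
  have rep: "is_biset G H (biset_rep d)" "transitive_on (H \<times>\<times> G) (biset_rep d)" "iso_class G H (biset_rep d) = d"
    if "d \<in> Poly_Mapping.keys x" for d
    using that keys biset_rep[of d G H] by (auto simp: transitive_classes_def)
  obtain z where z: "z \<in> fst (biset_rep c)"
    using rep(2)[OF c] by (auto simp: transitive_on_def)
  define D where "D = stabilizer (H \<times>\<times> G) (snd (biset_rep c)) z"
  have act: "group_action (H \<times>\<times> G) (fst (biset_rep d)) (snd (biset_rep d))" if "d \<in> Poly_Mapping.keys x" for d
    using rep(1)[OF that] by (simp add: is_biset_def)
  have "d = c" if d: "d \<in> Poly_Mapping.keys x" and w: "w \<in> fst (biset_rep d)"
    and sub: "D \<subseteq> stabilizer (H \<times>\<times> G) (snd (biset_rep d)) w" for d w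
  proof -
    let ?M = "stabilizer (H \<times>\<times> G) (snd (biset_rep d)) w"
    have finM: "finite ?M"
      using finite_subset[OF group_action.stabilizer_subset[OF act[OF d]] fin] .
    have pos: "0 < n c"
      using z rep(1)[OF c] by (auto simp: n_def is_biset_def card_gt_0_iff)
    have "n c * card ?M \<le> n d * card ?M"
      using min[OF d] by simp
    also have "\<dots> = n c * card D"
      using transitive_biset_card[OF rep(1,2)[OF d] w] transitive_biset_card[OF rep(1,2)[OF c] z]
      by (simp add: n_def D_def)
    finally have "card ?M \<le> card D"
      using pos by simp
    then have "D = ?M"
      using card_seteq[OF finM sub] by simp
    then have "biset_iso G H (biset_rep c) (biset_rep d)"
      unfolding D_def by (rule transitive_biset_isoI[OF rep(1,2)[OF c] z rep(1,2)[OF d] w])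
    then show ?thesis
      using iso_class_eqI[OF rep(1)[OF c]] rep(3)[OF c] rep(3)[OF d] by metis
  qed
  then have "stab_sum (H \<times>\<times> G) (biset_rep d) (\<lambda>M. of_bool (D \<subseteq> M)) = 0"
    if "d \<in> Poly_Mapping.keys x - {c}" for d
    using that by (auto simp: stab_sum_def intro!: sum.neutral)
  then have "mark G H D x = Poly_Mapping.lookup x c * stab_sum (H \<times>\<times> G) (biset_rep c) (\<lambda>M. of_bool (D \<subseteq> M))"
    unfolding mark_def burnside_sum_def using c by (subst sum.remove[OF finite_keys c]) simp
  moreover have "mark G H D x = 0"
    using marks group_action.stabilizer_subgroup[OF act[OF c] z] by (simp add: D_def)
  moreover have "0 < stab_sum (H \<times>\<times> G) (biset_rep c) (\<lambda>M. of_bool (D \<subseteq> M))"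
    unfolding stab_sum_def
  proof (rule sum_pos2)
    show "finite (fst (biset_rep c))" using rep(1)[OF c] by (simp add: is_biset_def)
    show "z \<in> fst (biset_rep c)" by fact
    show "0 < (of_bool (D \<subseteq> stabilizer (H \<times>\<times> G) (snd (biset_rep c)) z) :: rat)"
      unfolding D_def by simp
  qed simp
  ultimately show False
    using c by (simp add: in_keys_iff)
qed

lemma sum_relationsI:
  assumes p: "prime p" and fin: "finite (carrier (H \<times>\<times> G))"
    and x: "x \<in> carrier (free_bisets p G H)"
    and marks: "\<And>D. subgroup D (H \<times>\<times> G) \<Longrightarrow> mark G H D x = 0"
  shows "x \<in> sum_relations p G H"
proof -
  obtain x' where x': "Poly_Mapping.keys x' \<subseteq> transitive_classes G H" "x - x' \<in> sum_relations p G H"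
    using decompose_free_bisets[OF p x] by blast
  have "mark G H D x' = 0" if "subgroup D (H \<times>\<times> G)" for D
    using marks[OF that] burnside_sum_sum_relations[OF p x'(2)] by (simp add: mark_def burnside_sum_minus)
  then have "x' = 0"
    by (rule transitive_free_bisets_eq_zeroI[OF fin x'(1)])
  with x'(2) show ?thesis by simp
qed

lemma burnside_elem_eq: "burnside_elem p G H x = (\<lambda>n. n + x) ` sum_relations p G H"
  by (auto simp: burnside_elem_def r_coset_def free_bisets_def)

lemma burnside_elem_eq_iff:
  assumes p: "prime p"
  shows "burnside_elem p G H x = burnside_elem p G H y \<longleftrightarrow> x - y \<in> sum_relations p G H"
proof
  assume "burnside_elem p G H x = burnside_elem p G H y"
  moreover have "0 + x \<in> burnside_elem p G H x"
    unfolding burnside_elem_eq using sum_relations_zero[OF p] by blast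
  ultimately show "x - y \<in> sum_relations p G H"
    by (auto simp: burnside_elem_eq)
next
  assume xy: "x - y \<in> sum_relations p G H"
  have "n + x \<in> burnside_elem p G H y" if "n \<in> sum_relations p G H" for n
    unfolding burnside_elem_eq
    by (rule image_eqI[where x = "n + (x - y)"]) (use that xy in \<open>simp_all add: sum_relations_plus[OF p]\<close>)
  moreover have "n + y \<in> burnside_elem p G H x" if "n \<in> sum_relations p G H" for n
    unfolding burnside_elem_eq
    by (rule image_eqI[where x = "n + - (x - y)"])
      (use sum_relations_plus[OF p that sum_relations_uminus[OF p xy]] in simp_all)
  ultimately show "burnside_elem p G H x = burnside_elem p G H y"
    by (auto simp: burnside_elem_eq)
qed

text \<open>The form in which equalities in \<open>A(G,H)\<^bsub>(p)\<^esub>\<close> are both used and proved.\<close>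
lemma burnside_elem_eq_iff_marks:
  assumes p: "prime p" and fin: "finite (carrier (H \<times>\<times> G))"
    and x: "x \<in> carrier (free_bisets p G H)" and y: "y \<in> carrier (free_bisets p G H)"
  shows "burnside_elem p G H x = burnside_elem p G H y \<longleftrightarrow>
    (\<forall>D. subgroup D (H \<times>\<times> G) \<longrightarrow> mark G H D x = mark G H D y)"
  unfolding burnside_elem_eq_iff[OF p]
  using burnside_sum_sum_relations[OF p, of "x - y" G H]
    sum_relationsI[OF p fin free_bisets_minus_closed[OF p x y]]
  by (force simp: mark_def burnside_sum_minus)

lemma burnside_sum_burnside_elem_cong:
  assumes p: "prime p" and eq: "burnside_elem p G H x = burnside_elem p G H y"
  shows "burnside_sum G H x g = burnside_sum G H y g"
  using burnside_sum_sum_relations[OF p, of "x - y" G H g] eq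
  by (simp add: burnside_elem_eq_iff[OF p] burnside_sum_minus)

lemma burnside_elem_memD:
  assumes p: "prime p" and y: "y \<in> burnside_elem p G H x" and x: "x \<in> carrier (free_bisets p G H)"
  shows "y \<in> carrier (free_bisets p G H)" and "burnside_elem p G H y = burnside_elem p G H x"
proof -
  obtain n where n: "n \<in> sum_relations p G H" "y = n + x"
    using y by (auto simp: burnside_elem_eq)
  show "y \<in> carrier (free_bisets p G H)"
    using n x free_bisets_plus_closed[OF p] sum_relations_carrier[OF p] by blast
  show "burnside_elem p G H y = burnside_elem p G H x"
    using n by (simp add: burnside_elem_eq_iff[OF p])
qed

lemma burnside_elem_self: "prime p \<Longrightarrow> x \<in> burnside_elem p G H x"
  unfolding burnside_elem_eq by (rule image_eqI[where x = 0]) (simp_all add: sum_relations_zero)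

section \<open>Composition in terms of stabilizers\<close>

text \<open>The weight of a pair \<open>(y, x)\<close> with stabilizers \<open>L\<close> and \<open>M\<close>: the reciprocal of the size of its
  \<open>H\<close>-orbit. Weighting pairs in this way replaces a sum over \<open>Y \<times>\<^bsub>H\<^esub> X\<close> by a sum over \<open>Y \<times> X\<close>.\<close>
definition balance_weight ::
    "('g, 'm) monoid_scheme \<Rightarrow> ('h, 'n) monoid_scheme \<Rightarrow> ('k, 'l) monoid_scheme
      \<Rightarrow> ('k \<times> 'h) set \<Rightarrow> ('h \<times> 'g) set \<Rightarrow> rat" where
  "balance_weight G H K L M =
     of_nat (card {h \<in> carrier H. (\<one>\<^bsub>K\<^esub>, h) \<in> L \<and> (h, \<one>\<^bsub>G\<^esub>) \<in> M}) / of_nat (order H)"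

locale composable_bisets =
  G: group G + H: group H + K: group K
  for G :: "('g, 'm) monoid_scheme" and H :: "('h, 'n) monoid_scheme" and K :: "('k, 'l) monoid_scheme" +
  fixes Y :: "('k, 'h, 'y) biset" and X :: "('h, 'g, 'x) biset"
  assumes Y: "is_biset H K Y" and X: "is_biset G H X" and fin_H: "finite (carrier H)"
begin

sublocale Y: group_action "K \<times>\<times> H" "fst Y" "snd Y"
  using Y by (simp add: is_biset_def)

sublocale X: group_action "H \<times>\<times> G" "fst X" "snd X"
  using X by (simp add: is_biset_def)

lemma finite_Y: "finite (fst Y)" and finite_X: "finite (fst X)"
  using X Y by (simp_all add: is_biset_def)

lemma Y_closed: "\<lbrakk>k \<in> carrier K; h \<in> carrier H; y \<in> fst Y\<rbrakk> \<Longrightarrow> snd Y (k, h) y \<in> fst Y"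
  using Y.act_closed[of "(k, h)"] by simp

lemma X_closed: "\<lbrakk>h \<in> carrier H; g \<in> carrier G; x \<in> fst X\<rbrakk> \<Longrightarrow> snd X (h, g) x \<in> fst X"
  using X.act_closed[of "(h, g)"] by simp

lemma Y_mult:
  "\<lbrakk>k \<in> carrier K; h \<in> carrier H; k' \<in> carrier K; h' \<in> carrier H; y \<in> fst Y\<rbrakk>
    \<Longrightarrow> snd Y (k, h) (snd Y (k', h') y) = snd Y (k \<otimes>\<^bsub>K\<^esub> k', h \<otimes>\<^bsub>H\<^esub> h') y"
  using Y.composition_rule[of y "(k, h)" "(k', h')"] by simp

lemma X_mult:
  "\<lbrakk>h \<in> carrier H; g \<in> carrier G; h' \<in> carrier H; g' \<in> carrier G; x \<in> fst X\<rbrakk>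
    \<Longrightarrow> snd X (h, g) (snd X (h', g') x) = snd X (h \<otimes>\<^bsub>H\<^esub> h', g \<otimes>\<^bsub>G\<^esub> g') x"
  using X.composition_rule[of x "(h, g)" "(h', g')"] by simp

lemma Y_one: "y \<in> fst Y \<Longrightarrow> snd Y (\<one>\<^bsub>K\<^esub>, \<one>\<^bsub>H\<^esub>) y = y"
  using Y.act_one[of y] by simp

lemma X_one: "x \<in> fst X \<Longrightarrow> snd X (\<one>\<^bsub>H\<^esub>, \<one>\<^bsub>G\<^esub>) x = x"
  using X.act_one[of x] by simp

definition pairs where "pairs = fst Y \<times> fst X"

text \<open>\<open>Y \<times>\<^bsub>H\<^esub> X\<close> is the orbit set of this action of \<open>H\<close>, which gives access to the orbit-stabilizer
  theorem.\<close>
definition diag where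
  "diag h = (\<lambda>z\<in>pairs. (snd Y (\<one>\<^bsub>K\<^esub>, h) (fst z), snd X (h, \<one>\<^bsub>G\<^esub>) (snd z)))"

lemma finite_pairs: "finite pairs"
  by (simp add: pairs_def finite_X finite_Y)

lemma diag_action: "group_action H pairs diag"
  by (rule group_actionI[OF H.is_group])
    (auto simp: diag_def pairs_def Y_closed X_closed Y_one X_one Y_mult X_mult)

sublocale D: group_action H pairs diag
  by (rule diag_action)

abbreviation "orb \<equiv> orbit H diag"

lemma balance_class: "z \<in> pairs \<Longrightarrow> balance_rel G H K Y X `` {z} = orb z"
  by (cases z) (force simp: balance_rel_def orbit_def diag_def pairs_def)

lemma product_carrier: "(fst Y \<times> fst X) // balance_rel G H K Y X = orb ` pairs"
  unfolding quotient_def pairs_def[symmetric] using balance_class by blast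

lemma product_carrier_orbits: "orb ` pairs = orbits H pairs diag"
  by (auto simp: orbits_def)

lemma orb_in_orbits: "z \<in> pairs \<Longrightarrow> orb z \<in> orbits H pairs diag"
  unfolding product_carrier_orbits[symmetric] by (rule imageI)

lemma orb_eq_iff: "\<lbrakk>z \<in> pairs; w \<in> pairs\<rbrakk> \<Longrightarrow> orb z = orb w \<longleftrightarrow> (\<exists>h\<in>carrier H. w = diag h z)"
proof
  assume zw: "z \<in> pairs" "w \<in> pairs" and "orb z = orb w"
  then have "w \<in> orb z" using D.orbit_refl by simp
  then show "\<exists>h\<in>carrier H. w = diag h z" by (auto simp: orbit_def)
next
  assume zw: "z \<in> pairs" "w \<in> pairs" and "\<exists>h\<in>carrier H. w = diag h z"
  then have w: "w \<in> orb z" by (auto simp: orbit_def)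
  then have "orb w \<inter> orb z \<noteq> {}" using D.orbit_refl[OF zw(2)] by blast
  then show "orb z = orb w"
    using D.disjoint_union[of "orb z" "orb w"] orb_in_orbits[OF zw(1)] orb_in_orbits[OF zw(2)] by (simp add: Int_commute)
qed

lemma outer_orb:
  assumes k: "k \<in> carrier K" and g: "g \<in> carrier G" and y: "y \<in> fst Y" and x: "x \<in> fst X"
  shows "map_prod (snd Y (k, \<one>\<^bsub>H\<^esub>)) (snd X (\<one>\<^bsub>H\<^esub>, g)) ` orb (y, x)
    = orb (snd Y (k, \<one>\<^bsub>H\<^esub>) y, snd X (\<one>\<^bsub>H\<^esub>, g) x)"
proof -
  have orb: "orb z = (\<lambda>h. diag h z) ` carrier H" for z
    by (auto simp: orbit_def)
  show ?thesis
    unfolding orb image_image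
    by (rule image_cong[OF refl]) (use assms in \<open>simp add: diag_def pairs_def Y_closed X_closed Y_mult X_mult\<close>)
qed

lemma product_def:
  "biset_product G H K Y X = (orb ` pairs,
     \<lambda>a. \<lambda>C\<in>orb ` pairs. map_prod (snd Y (fst a, \<one>\<^bsub>H\<^esub>)) (snd X (\<one>\<^bsub>H\<^esub>, snd a)) ` C)"
  by (simp add: biset_product_def product_carrier Let_def fun_eq_iff)

lemma is_biset_product: "is_biset G K (biset_product G H K Y X)"
proof -
  let ?act = "\<lambda>a. \<lambda>C\<in>orb ` pairs. map_prod (snd Y (fst a, \<one>\<^bsub>H\<^esub>)) (snd X (\<one>\<^bsub>H\<^esub>, snd a)) ` C"
  have act: "?act a (orb z) = orb (snd Y (fst a, \<one>\<^bsub>H\<^esub>) (fst z), snd X (\<one>\<^bsub>H\<^esub>, snd a) (snd z))"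
    if "a \<in> carrier (K \<times>\<times> G)" "z \<in> pairs" for a z
    using that outer_orb[of "fst a" "snd a" "fst z" "snd z"] by (simp add: pairs_def mem_Times_iff)
  have closed: "(snd Y (fst a, \<one>\<^bsub>H\<^esub>) (fst z), snd X (\<one>\<^bsub>H\<^esub>, snd a) (snd z)) \<in> pairs"
    if "a \<in> carrier (K \<times>\<times> G)" "z \<in> pairs" for a z
    using that by (auto simp: pairs_def Y_closed X_closed)
  have "group_action (K \<times>\<times> G) (orb ` pairs) ?act"
  proof (rule group_actionI[OF DirProd_group[OF K.is_group G.is_group]])
    fix a C assume a: "a \<in> carrier (K \<times>\<times> G)" and "C \<in> orb ` pairs"
    then obtain z where z: "z \<in> pairs" "C = orb z" by blast
    then show "?act a C \<in> orb ` pairs"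
      using act[OF a z(1)] closed[OF a z(1)] by simp
  next
    fix C assume "C \<in> orb ` pairs"
    then obtain z where z: "z \<in> pairs" "C = orb z" by blast
    have "\<one>\<^bsub>K \<times>\<times> G\<^esub> \<in> carrier (K \<times>\<times> G)" by simp
    from act[OF this z(1)] show "?act \<one>\<^bsub>K \<times>\<times> G\<^esub> C = C"
      using z by (auto simp: pairs_def Y_one X_one)
  next
    fix a b C assume a: "a \<in> carrier (K \<times>\<times> G)" and b: "b \<in> carrier (K \<times>\<times> G)" and "C \<in> orb ` pairs"
    then obtain z where z: "z \<in> pairs" "C = orb z" by blast
    have ab: "a \<otimes>\<^bsub>K \<times>\<times> G\<^esub> b \<in> carrier (K \<times>\<times> G)"
      using a b by (auto simp: mult_DirProd')
    have yx: "fst z \<in> fst Y" "snd z \<in> fst X" and ab': "fst a \<in> carrier K" "snd a \<in> carrier G" "fst b \<in> carrier K" "snd b \<in> carrier G"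
      using z a b by (auto simp: pairs_def)
    show "?act (a \<otimes>\<^bsub>K \<times>\<times> G\<^esub> b) C = ?act a (?act b C)"
      unfolding z(2) act[OF b z(1)] act[OF a closed[OF b z(1)]] act[OF ab z(1)]
      using yx ab' by (simp add: mult_DirProd' Y_mult X_mult)
  qed simp
  then show ?thesis
    by (simp add: is_biset_def product_def finite_pairs)
qed

text \<open>The pair \<open>(k, g)\<close> fixes the class of \<open>(y, x)\<close> iff \<open>(k y, x g\<inverse>) = (y h\<inverse>, h x)\<close> for some \<open>h\<close>. Replacing
  \<open>h\<close> by its inverse, this is membership in the relational composite of the two stabilizers.\<close>
lemma product_stabilizer:
  assumes y: "y \<in> fst Y" and x: "x \<in> fst X"
  shows "stabilizer (K \<times>\<times> G) (snd (biset_product G H K Y X)) (orb (y, x))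
    = stabilizer (K \<times>\<times> H) (snd Y) y O stabilizer (H \<times>\<times> G) (snd X) x" (is "?S = ?L O ?M")
proof -
  have "(k, g) \<in> ?S \<longleftrightarrow> (k, g) \<in> ?L O ?M" if k: "k \<in> carrier K" and g: "g \<in> carrier G" for k g
  proof -
    have orb_in: "orb (y, x) \<in> orb ` pairs"
      using y x by (simp add: pairs_def)
    have "(k, g) \<in> ?S \<longleftrightarrow> orb (snd Y (k, \<one>\<^bsub>H\<^esub>) y, snd X (\<one>\<^bsub>H\<^esub>, g) x) = orb (y, x)"
      using k g orb_in by (simp add: stabilizer_def product_def outer_orb[OF k g y x])
    also have "\<dots> \<longleftrightarrow> (\<exists>h\<in>carrier H. (y, x) = diag h (snd Y (k, \<one>\<^bsub>H\<^esub>) y, snd X (\<one>\<^bsub>H\<^esub>, g) x))"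
      using y x k g by (intro orb_eq_iff) (simp_all add: pairs_def Y_closed X_closed)
    \<comment> \<open>The element \<open>h\<close> here moves the translated pair back, so it is the inverse of the one in \<open>balance_rel\<close>.\<close>
    also have "\<dots> \<longleftrightarrow> (\<exists>h\<in>carrier H. snd Y (k, h) y = y \<and> snd X (h, g) x = x)"
      using y x k g by (intro bex_cong refl) (auto simp: diag_def pairs_def Y_closed X_closed Y_mult X_mult)
    also have "\<dots> \<longleftrightarrow> (k, g) \<in> ?L O ?M"
      using k g by (auto simp: stabilizer_def)
    finally show ?thesis .
  qed
  moreover have "?S \<subseteq> carrier K \<times> carrier G" "?L O ?M \<subseteq> carrier K \<times> carrier G"
    by (auto simp: stabilizer_def)
  ultimately show ?thesis by blast
qed

lemma stab_sum_product:
  "stab_sum (K \<times>\<times> G) (biset_product G H K Y X) f =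
     stab_sum (K \<times>\<times> H) Y (\<lambda>L. stab_sum (H \<times>\<times> G) X (\<lambda>M. balance_weight G H K L M * f (L O M)))"
proof -
  let ?St = "stabilizer (K \<times>\<times> G) (snd (biset_product G H K Y X))"
  have orbit_sum: "f (?St C) = (\<Sum>z\<in>C. f (?St (orb z)) / of_nat (card (orb z)))"
    if C: "C \<in> orbits H pairs diag" for C
  proof -
    obtain w where w: "w \<in> pairs" "C = orb w"
      using C by (auto simp: orbits_def)
    have "orb z = C" if z: "z \<in> C" for z
    proof -
      obtain h where h: "h \<in> carrier H" "z = diag h w"
        using z w by (auto simp: orbit_def)
      then show ?thesis
        using w orb_eq_iff[OF w(1) D.act_closed[OF h(1) w(1)]] by blast
    qed
    then have "(\<Sum>z\<in>C. f (?St (orb z)) / of_nat (card (orb z))) = of_nat (card C) * (f (?St C) / of_nat (card C))"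
      by simp
    moreover have "finite C"
      using w fin_H by (simp add: orbit_def)
    moreover have "C \<noteq> {}"
      using w(2) D.orbit_refl[OF w(1)] by blast
    ultimately show ?thesis by simp
  qed
  have "stab_sum (K \<times>\<times> G) (biset_product G H K Y X) f = (\<Sum>C\<in>orbits H pairs diag. f (?St C))"
    by (simp add: stab_sum_def product_def product_carrier_orbits)
  also have "\<dots> = (\<Sum>C\<in>orbits H pairs diag. \<Sum>z\<in>C. f (?St (orb z)) / of_nat (card (orb z)))"
    by (rule sum.cong[OF refl orbit_sum])
  also have "\<dots> = (\<Sum>z\<in>pairs. f (?St (orb z)) / of_nat (card (orb z)))"
    by (rule D.disjoint_sum[OF finite_pairs])
  also have "\<dots> = (\<Sum>z\<in>pairs. balance_weight G H K (stabilizer (K \<times>\<times> H) (snd Y) (fst z)) (stabilizer (H \<times>\<times> G) (snd X) (snd z))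
      * f (stabilizer (K \<times>\<times> H) (snd Y) (fst z) O stabilizer (H \<times>\<times> G) (snd X) (snd z)))"
  proof (rule sum.cong[OF refl])
    fix z assume z: "z \<in> pairs"
    then obtain y x where yx: "z = (y, x)" "y \<in> fst Y" "x \<in> fst X"
      by (auto simp: pairs_def)
    have pos: "order H > 0" using fin_H by (simp add: H.order_gt_0_iff_finite)
    have "stabilizer H diag z = {h \<in> carrier H. (\<one>\<^bsub>K\<^esub>, h) \<in> stabilizer (K \<times>\<times> H) (snd Y) y \<and>
        (h, \<one>\<^bsub>G\<^esub>) \<in> stabilizer (H \<times>\<times> G) (snd X) x}"
      using yx by (auto simp: stabilizer_def diag_def pairs_def)
    then have "balance_weight G H K (stabilizer (K \<times>\<times> H) (snd Y) y) (stabilizer (H \<times>\<times> G) (snd X) x)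
        = of_nat (card (stabilizer H diag z)) / of_nat (order H)"
      by (simp add: balance_weight_def)
    also have "\<dots> = 1 / of_nat (card (orb z))"
    proof -
      have "card (orb z) * card (stabilizer H diag z) \<noteq> 0"
        unfolding D.orbit_stabilizer_theorem[OF z] using pos by simp
      moreover have "of_nat (order H) = (of_nat (card (orb z)) * of_nat (card (stabilizer H diag z)) :: rat)"
        unfolding D.orbit_stabilizer_theorem[OF z, symmetric] by simp
      ultimately show ?thesis
        by (simp add: divide_eq_eq)
    qed
    finally show "f (?St (orb z)) / of_nat (card (orb z)) = balance_weight G H K (stabilizer (K \<times>\<times> H) (snd Y) (fst z))
        (stabilizer (H \<times>\<times> G) (snd X) (snd z))
      * f (stabilizer (K \<times>\<times> H) (snd Y) (fst z) O stabilizer (H \<times>\<times> G) (snd X) (snd z))"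
      using yx product_stabilizer[OF yx(2,3)] by simp
  qed
  finally show ?thesis
    by (simp add: stab_sum_def pairs_def sum.cartesian_product case_prod_beta)
qed

end

lemma stab_sum_linear: "stab_sum A X (\<lambda>M. \<Sum>i\<in>I. r i * g i M) = (\<Sum>i\<in>I. r i * stab_sum A X (g i))"
  unfolding stab_sum_def by (subst sum.swap) (simp add: sum_distrib_left)

lemma burnside_sum_linear:
  "burnside_sum G H x (\<lambda>M. \<Sum>i\<in>I. r i * g i M) = (\<Sum>i\<in>I. r i * burnside_sum G H x (g i))"
  unfolding burnside_sum_def stab_sum_linear sum_distrib_left
  by (subst sum.swap) (simp add: mult_ac)

text \<open>Every invariant of a composite is an iterated sum over the stabilizers of the two factors. In
  particular it depends on the two factors only through their classes in the Burnside modules.\<close>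
lemma burnside_sum_free_comp:
  fixes G :: "('g, 'm) monoid_scheme" and H :: "('h, 'n) monoid_scheme" and K :: "('k, 'l) monoid_scheme"
  assumes "group G" "group H" "group K" "finite (carrier H)"
    and y: "y \<in> carrier (free_bisets p H K)" and x: "x \<in> carrier (free_bisets p G H)"
  shows "burnside_sum G K (free_comp G H K y x) f =
    burnside_sum H K y (\<lambda>L. burnside_sum G H x (\<lambda>M. balance_weight G H K L M * f (L O M)))"
proof -
  have "burnside_sum G K (Poly_Mapping.single
        (iso_class G K (biset_product G H K (biset_rep d) (biset_rep c))) r) f
      = r * stab_sum (K \<times>\<times> H) (biset_rep d)
          (\<lambda>L. stab_sum (H \<times>\<times> G) (biset_rep c) (\<lambda>M. balance_weight G H K L M * f (L O M)))"
    if "d \<in> Poly_Mapping.keys y" "c \<in> Poly_Mapping.keys x" for d c r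
  proof -
    have "is_biset H K (biset_rep d)" "is_biset G H (biset_rep c)"
      using that y x by (auto simp: free_bisets_carrier_iff intro!: biset_rep)
    then interpret composable_bisets G H K "biset_rep d" "biset_rep c"
      using assms by (intro composable_bisets.intro composable_bisets_axioms.intro)
    show ?thesis
      using is_biset_product by (simp add: burnside_sum_single stab_sum_product)
  qed
  then have "burnside_sum G K (free_comp G H K y x) f =
    (\<Sum>d\<in>Poly_Mapping.keys y. \<Sum>c\<in>Poly_Mapping.keys x.
      Poly_Mapping.lookup y d * Poly_Mapping.lookup x c * stab_sum (K \<times>\<times> H) (biset_rep d)
        (\<lambda>L. stab_sum (H \<times>\<times> G) (biset_rep c) (\<lambda>M. balance_weight G H K L M * f (L O M))))"
    unfolding free_comp_def burnside_sum_sum by (intro sum.cong refl) simp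
  also have "\<dots> = burnside_sum H K y (\<lambda>L. burnside_sum G H x (\<lambda>M. balance_weight G H K L M * f (L O M)))"
    unfolding burnside_sum_def stab_sum_linear sum_distrib_left by (simp add: mult_ac)
  finally show ?thesis .
qed

lemma free_comp_closed:
  fixes G :: "('g, 'm) monoid_scheme" and H :: "('h, 'n) monoid_scheme" and K :: "('k, 'l) monoid_scheme"
  assumes p: "prime p" and "group G" "group H" "group K" "finite (carrier H)"
    and y: "y \<in> carrier (free_bisets p H K)" and x: "x \<in> carrier (free_bisets p G H)"
  shows "free_comp G H K y x \<in> carrier (free_bisets p G K)"
  unfolding free_comp_def
proof (intro free_bisets_sum_closed[OF p] single_in_free_bisets[OF p])
  fix d c assume dc: "d \<in> Poly_Mapping.keys y" "c \<in> Poly_Mapping.keys x"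
  have "is_biset H K (biset_rep d)" "is_biset G H (biset_rep c)"
    using dc y x by (auto simp: free_bisets_carrier_iff intro!: biset_rep)
  then interpret composable_bisets G H K "biset_rep d" "biset_rep c"
    using assms by (intro composable_bisets.intro composable_bisets_axioms.intro)
  show "iso_class G K (biset_product G H K (biset_rep d) (biset_rep c)) \<in> biset_classes G K"
    using is_biset_product by (rule iso_class_in_biset_classes)
  show "Poly_Mapping.lookup y d * Poly_Mapping.lookup x c \<in> localized_ints p"
    using x y by (simp add: free_bisets_carrier_iff localized_ints_mult[OF p])
qed

text \<open>The union in the definition of the composition is over equal cosets, because marks of
  \<open>free_comp\<close> do not change within the cosets of the factors.\<close>
lemma burnside_comp_burnside_elem:
  fixes G :: "('g, 'm) monoid_scheme" and H :: "('h, 'n) monoid_scheme" and K :: "('k, 'l) monoid_scheme"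
  assumes p: "prime p" and groups: "group G" "group H" "group K"
    and fin: "finite (carrier G)" "finite (carrier H)" "finite (carrier K)"
    and y: "y \<in> carrier (free_bisets p H K)" and x: "x \<in> carrier (free_bisets p G H)"
  shows "burnside_comp p G H K (burnside_elem p H K y) (burnside_elem p G H x)
    = burnside_elem p G K (free_comp G H K y x)"
proof -
  have "burnside_elem p G K (free_comp G H K y' x') = burnside_elem p G K (free_comp G H K y x)"
    if y': "y' \<in> burnside_elem p H K y" and x': "x' \<in> burnside_elem p G H x" for y' x'
  proof -
    note y'c = burnside_elem_memD[OF p y' y] and x'c = burnside_elem_memD[OF p x' x]
    have "burnside_sum G K (free_comp G H K y' x') f = burnside_sum G K (free_comp G H K y x) f" for f
      using burnside_sum_burnside_elem_cong[OF p y'c(2)] burnside_sum_burnside_elem_cong[OF p x'c(2)]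
      by (simp add: burnside_sum_free_comp[OF groups fin(2) y'c(1) x'c(1)]
        burnside_sum_free_comp[OF groups fin(2) y x])
    then show ?thesis
      by (subst burnside_elem_eq_iff_marks[OF p])
        (simp_all add: mark_def fin free_comp_closed[OF p groups fin(2)] y'c(1) x'c(1) y x)
  qed
  then have "burnside_comp p G H K (burnside_elem p H K y) (burnside_elem p G H x) =
    (\<Union>y'\<in>burnside_elem p H K y. \<Union>x'\<in>burnside_elem p G H x. burnside_elem p G K (free_comp G H K y x))"
    unfolding burnside_comp_def by (intro SUP_cong refl)
  also have "\<dots> = burnside_elem p G K (free_comp G H K y x)"
    using burnside_elem_self[OF p, of y H K] burnside_elem_self[OF p, of x G H] by auto
  finally show ?thesis .
qed

section \<open>Marks at twisted diagonals\<close>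

lemma burnside_sum_diff:
  "burnside_sum G H x (\<lambda>M. f M - g M) = burnside_sum G H x f - burnside_sum G H x g"
  by (simp add: burnside_sum_def stab_sum_def sum_subtractf right_diff_distrib)

lemma burnside_sum_cmult: "burnside_sum G H x (\<lambda>M. r * g M) = r * burnside_sum G H x g"
  by (simp add: burnside_sum_def stab_sum_def sum_distrib_left mult_ac)

text \<open>The stabilizers occurring in \<open>x\<close> satisfy \<open>P\<close>, up to cancellation. Stated through sums, this is a
  property of the class of \<open>x\<close> and passes to composites by \<open>burnside_sum_free_comp\<close>.\<close>
definition supported_on where
  "supported_on G H P x \<longleftrightarrow> (\<forall>g. (\<forall>M. P M \<longrightarrow> g M = 0) \<longrightarrow> burnside_sum G H x g = 0)"

lemma supported_on_cong:
  assumes "supported_on G H P x" and "\<And>M. P M \<Longrightarrow> f M = g M"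
  shows "burnside_sum G H x f = burnside_sum G H x g"
proof -
  have "burnside_sum G H x (\<lambda>M. f M - g M) = 0"
    using assms(2) assms(1)[unfolded supported_on_def, rule_format, of "\<lambda>M. f M - g M"] by simp
  then show ?thesis
    by (simp add: burnside_sum_diff)
qed

lemma supported_on_conj:
  assumes P: "supported_on G H P x" and Q: "supported_on G H Q x"
  shows "supported_on G H (\<lambda>M. P M \<and> Q M) x"
  unfolding supported_on_def
proof (intro allI impI)
  fix g :: "_ \<Rightarrow> rat" assume g: "\<forall>M. P M \<and> Q M \<longrightarrow> g M = 0"
  have "burnside_sum G H x g = burnside_sum G H x (\<lambda>M. if P M then g M else 0)"
    by (rule supported_on_cong[OF P]) simp
  also have "\<dots> = burnside_sum G H x (\<lambda>M. 0)"
    by (rule supported_on_cong[OF Q]) (use g in simp)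
  also have "\<dots> = 0"
    by (simp add: burnside_sum_def stab_sum_def)
  finally show "burnside_sum G H x g = 0" .
qed

lemma supported_on_subgroups:
  assumes x: "x \<in> carrier (free_bisets p G H)"
  shows "supported_on G H (\<lambda>M. subgroup M (H \<times>\<times> G)) x"
proof -
  have "subgroup (stabilizer (H \<times>\<times> G) (snd (biset_rep c)) z) (H \<times>\<times> G)"
    if c: "c \<in> Poly_Mapping.keys x" "z \<in> fst (biset_rep c)" for c z
  proof (rule group_action.stabilizer_subgroup)
    have "c \<in> biset_classes G H"
      using c x by (auto simp: free_bisets_carrier_iff)
    from biset_rep(1)[OF this]
    show "group_action (H \<times>\<times> G) (fst (biset_rep c)) (snd (biset_rep c))"
      by (simp add: is_biset_def)
  qed (use c in simp)
  then show ?thesis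
    unfolding supported_on_def burnside_sum_def stab_sum_def
    by (auto intro!: sum.neutral)
qed

lemma supported_on_free_comp:
  assumes "group G" "group H" "group K" "finite (carrier H)"
    and "y \<in> carrier (free_bisets p H K)" "x \<in> carrier (free_bisets p G H)"
    and y: "supported_on H K P y" and x: "supported_on G H Q x"
    and R: "\<And>L M. \<lbrakk>P L; Q M\<rbrakk> \<Longrightarrow> R (L O M)"
  shows "supported_on G K R (free_comp G H K y x)"
  unfolding supported_on_def
proof (intro allI impI)
  fix f :: "_ \<Rightarrow> rat" assume f: "\<forall>M. R M \<longrightarrow> f M = 0"
  have "burnside_sum G H x (\<lambda>M. balance_weight G H K L M * f (L O M)) = burnside_sum G H x (\<lambda>M. 0)" if "P L" for L
    by (rule supported_on_cong[OF x]) (use that f R in simp)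
  then have "burnside_sum H K y (\<lambda>L. burnside_sum G H x (\<lambda>M. balance_weight G H K L M * f (L O M)))
      = burnside_sum H K y (\<lambda>L. burnside_sum G H x (\<lambda>M. 0))"
    by (intro supported_on_cong[OF y])
  also have "\<dots> = 0"
    by (simp add: burnside_sum_def stab_sum_def)
  finally show "burnside_sum G K (free_comp G H K y x) f = 0"
    using assms by (simp add: burnside_sum_free_comp)
qed

text \<open>The point stabilizers of bisets with free left \<open>H\<close>-action.\<close>
definition left_free ::
    "('g, 'm) monoid_scheme \<Rightarrow> ('h, 'n) monoid_scheme \<Rightarrow> ('h \<times> 'g) set \<Rightarrow> bool" where
  "left_free G H M \<longleftrightarrow> subgroup M (H \<times>\<times> G) \<and> (\<forall>h. (h, \<one>\<^bsub>G\<^esub>) \<in> M \<longrightarrow> h = \<one>\<^bsub>H\<^esub>)"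

lemma left_free_unique:
  assumes "group G" "group H" and M: "left_free G H M" and "(h, g) \<in> M" "(h', g) \<in> M"
  shows "h = h'"
proof -
  interpret G: group G by fact
  interpret H: group H by fact
  have sub: "subgroup M (H \<times>\<times> G)" using M by (simp add: left_free_def)
  have carr: "h \<in> carrier H" "h' \<in> carrier H" "g \<in> carrier G"
    using subgroup.subset[OF sub] assms(4,5) by auto
  have "(h, g) \<otimes>\<^bsub>H \<times>\<times> G\<^esub> inv\<^bsub>H \<times>\<times> G\<^esub> (h', g) \<in> M"
    using assms(4,5) by (intro subgroup.m_closed[OF sub] subgroup.m_inv_closed[OF sub])
  then have "(h \<otimes>\<^bsub>H\<^esub> inv\<^bsub>H\<^esub> h', \<one>\<^bsub>G\<^esub>) \<in> M"
    using carr by (simp add: inv_DirProd[OF H.is_group G.is_group])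
  then have "h \<otimes>\<^bsub>H\<^esub> inv\<^bsub>H\<^esub> h' = \<one>\<^bsub>H\<^esub>"
    using M by (simp add: left_free_def)
  then show ?thesis
    using carr H.inv_solve_right[of h h' "\<one>\<^bsub>H\<^esub>"] H.inv_equality[of h "inv\<^bsub>H\<^esub> h'"] by simp
qed

lemma balance_weight_left_free:
  assumes G: "group G" and H: "group H" and K: "group K" and L: "subgroup L (K \<times>\<times> H)" and M: "left_free G H M"
  shows "balance_weight G H K L M = 1 / of_nat (order H)"
proof -
  interpret G: group G by fact
  interpret H: group H by fact
  have "(\<one>\<^bsub>K\<^esub>, \<one>\<^bsub>H\<^esub>) \<in> L"
    using subgroup.one_closed[OF L] by simp
  moreover have "(\<one>\<^bsub>H\<^esub>, \<one>\<^bsub>G\<^esub>) \<in> M"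
  proof -
    have "subgroup M (H \<times>\<times> G)"
      using M by (simp add: left_free_def)
    from subgroup.one_closed[OF this] show ?thesis by simp
  qed
  moreover have "h = \<one>\<^bsub>H\<^esub>" if "(h, \<one>\<^bsub>G\<^esub>) \<in> M" for h
    using M that unfolding left_free_def by blast
  ultimately have "{h \<in> carrier H. (\<one>\<^bsub>K\<^esub>, h) \<in> L \<and> (h, \<one>\<^bsub>G\<^esub>) \<in> M} = {\<one>\<^bsub>H\<^esub>}"
    using H.one_closed by blast
  then show ?thesis
    by (simp add: balance_weight_def)
qed

lemma left_free_relcomp:
  assumes "left_free H K L" "left_free G H M"
  shows "\<forall>k. (k, \<one>\<^bsub>G\<^esub>) \<in> L O M \<longrightarrow> k = \<one>\<^bsub>K\<^esub>"
  using assms by (auto simp: left_free_def)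

lemma supported_on_left_free_comp:
  assumes "prime p" "group G" "group H" "group K" "finite (carrier H)"
    and "y \<in> carrier (free_bisets p H K)" "x \<in> carrier (free_bisets p G H)"
    and y: "supported_on H K (left_free H K) y" and x: "supported_on G H (left_free G H) x"
  shows "supported_on G K (left_free G K) (free_comp G H K y x)"
proof -
  have "supported_on G K (\<lambda>M. subgroup M (K \<times>\<times> G) \<and> (\<forall>k. (k, \<one>\<^bsub>G\<^esub>) \<in> M \<longrightarrow> k = \<one>\<^bsub>K\<^esub>)) (free_comp G H K y x)"
  proof (rule supported_on_conj)
    show "supported_on G K (\<lambda>M. subgroup M (K \<times>\<times> G)) (free_comp G H K y x)"
      using free_comp_closed[OF assms(1-7)] by (rule supported_on_subgroups)
    show "supported_on G K (\<lambda>M. \<forall>k. (k, \<one>\<^bsub>G\<^esub>) \<in> M \<longrightarrow> k = \<one>\<^bsub>K\<^esub>) (free_comp G H K y x)"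
      using assms(2-7) y x left_free_relcomp by (rule supported_on_free_comp)
  qed
  then show ?thesis
    by (simp add: left_free_def[abs_def])
qed

lemma mark_eq_0_left_free:
  assumes x: "supported_on G H (left_free G H) x" and D: "(h, \<one>\<^bsub>G\<^esub>) \<in> D" "h \<noteq> \<one>\<^bsub>H\<^esub>"
  shows "mark G H D x = 0"
proof -
  have "mark G H D x = burnside_sum G H x (\<lambda>M. 0)"
    unfolding mark_def by (rule supported_on_cong[OF x]) (use D in \<open>auto simp: left_free_def\<close>)
  then show ?thesis
    by (simp add: burnside_sum_def stab_sum_def)
qed

abbreviation pair_image :: "('q \<Rightarrow> 'h) \<Rightarrow> ('q \<Rightarrow> 'g) \<Rightarrow> 'q set \<Rightarrow> ('h \<times> 'g) set" where
  "pair_image \<alpha> \<beta> Q \<equiv> (\<lambda>q. (\<alpha> q, \<beta> q)) ` Q"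

text \<open>If the relation \<open>M\<close> is single-valued, then \<open>\<Delta>(Q,\<psi>) \<subseteq> L O M\<close> selects the intermediate elements
  uniquely and thus a single map \<open>\<chi>\<close>; this makes the containment a sum over all maps.\<close>
lemma of_bool_relcomp:
  assumes "finite Q" "finite A" and M: "M \<subseteq> A \<times> UNIV"
    and uniq: "\<And>q h h'. \<lbrakk>q \<in> Q; (h, q) \<in> M; (h', q) \<in> M\<rbrakk> \<Longrightarrow> h = h'"
  shows "(of_bool (twisted_diagonal Q \<psi> \<subseteq> L O M) :: rat) =
    (\<Sum>\<chi>\<in>Q \<rightarrow>\<^sub>E A. of_bool (pair_image \<psi> \<chi> Q \<subseteq> L) * of_bool (twisted_diagonal Q \<chi> \<subseteq> M))"
proof (cases "twisted_diagonal Q \<psi> \<subseteq> L O M")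
  case True
  then have "\<forall>q\<in>Q. \<exists>h. (\<psi> q, h) \<in> L \<and> (h, q) \<in> M"
    by (auto simp: twisted_diagonal_def)
  then obtain \<chi> where \<chi>: "\<And>q. q \<in> Q \<Longrightarrow> (\<psi> q, \<chi> q) \<in> L" "\<And>q. q \<in> Q \<Longrightarrow> (\<chi> q, q) \<in> M"
    by metis
  have in_PiE: "restrict \<chi> Q \<in> Q \<rightarrow>\<^sub>E A"
    using \<chi>(2) M by auto
  have "\<chi>' = restrict \<chi> Q" if "\<chi>' \<in> Q \<rightarrow>\<^sub>E A" "twisted_diagonal Q \<chi>' \<subseteq> M" for \<chi>'
    by (rule PiE_ext[OF that(1) in_PiE]) (use that(2) \<chi>(2) uniq in \<open>auto simp: twisted_diagonal_def\<close>)
  then have "(\<Sum>\<chi>'\<in>Q \<rightarrow>\<^sub>E A. of_bool (pair_image \<psi> \<chi>' Q \<subseteq> L) * of_bool (twisted_diagonal Q \<chi>' \<subseteq> M))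
      = (\<Sum>\<chi>'\<in>Q \<rightarrow>\<^sub>E A. of_bool (\<chi>' = restrict \<chi> Q) :: rat)"
    using \<chi> by (intro sum.cong refl) (auto simp: twisted_diagonal_def)
  also have "\<dots> = 1"
    using in_PiE assms(1,2) by (simp add: of_bool_def sum.delta' finite_PiE)
  finally show ?thesis
    using True by simp
next
  case False
  then have "\<not> (pair_image \<psi> \<chi> Q \<subseteq> L \<and> twisted_diagonal Q \<chi> \<subseteq> M)" for \<chi>
    by (auto simp: twisted_diagonal_def)
  then have "(\<Sum>\<chi>\<in>Q \<rightarrow>\<^sub>E A. of_bool (pair_image \<psi> \<chi> Q \<subseteq> L) * of_bool (twisted_diagonal Q \<chi> \<subseteq> M)) = (0 :: rat)"
    by (intro sum.neutral) auto
  with False show ?thesis by simp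
qed

text \<open>For left-free \<open>x\<close> the weight is the constant \<open>1/|H|\<close>, and the containment in \<open>L O M\<close> splits by
  \<open>of_bool_relcomp\<close>.\<close>
lemma mark_free_comp:
  assumes G: "group G" and H: "group H" and K: "group K" and fin: "finite (carrier H)"
    and y: "y \<in> carrier (free_bisets p H K)" and x: "x \<in> carrier (free_bisets p G H)"
    and free: "supported_on G H (left_free G H) x"
    and Q: "finite Q"
  shows "mark G K (twisted_diagonal Q \<psi>) (free_comp G H K y x) =
    (\<Sum>\<chi>\<in>Q \<rightarrow>\<^sub>E carrier H. mark H K (pair_image \<psi> \<chi> Q) y * mark G H (twisted_diagonal Q \<chi>) x) / of_nat (order H)"
proof -
  let ?I = "Q \<rightarrow>\<^sub>E carrier H"
  let ?a = "\<lambda>\<chi> L. of_bool (pair_image \<psi> \<chi> Q \<subseteq> L) :: rat"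
  let ?b = "\<lambda>\<chi> M. of_bool (twisted_diagonal Q \<chi> \<subseteq> M) :: rat"
  have pointwise: "balance_weight G H K L M * of_bool (twisted_diagonal Q \<psi> \<subseteq> L O M)
      = (\<Sum>\<chi>\<in>?I. (?a \<chi> L / of_nat (order H)) * ?b \<chi> M)"
    if L: "subgroup L (K \<times>\<times> H)" and M: "left_free G H M" for L M
  proof -
    have "M \<subseteq> carrier H \<times> UNIV"
      using M subgroup.subset[of M "H \<times>\<times> G"] by (auto simp: left_free_def)
    then have "of_bool (twisted_diagonal Q \<psi> \<subseteq> L O M) = (\<Sum>\<chi>\<in>?I. ?a \<chi> L * ?b \<chi> M)"
      using left_free_unique[OF G H M] by (intro of_bool_relcomp Q fin)
    then show ?thesis
      by (simp add: balance_weight_left_free[OF G H K L M] sum_divide_distrib)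
  qed
  have "mark G K (twisted_diagonal Q \<psi>) (free_comp G H K y x) =
      burnside_sum H K y (\<lambda>L. burnside_sum G H x (\<lambda>M. balance_weight G H K L M * of_bool (twisted_diagonal Q \<psi> \<subseteq> L O M)))"
    unfolding mark_def using G H K fin y x by (rule burnside_sum_free_comp)
  also have "\<dots> = burnside_sum H K y (\<lambda>L. burnside_sum G H x (\<lambda>M. \<Sum>\<chi>\<in>?I. (?a \<chi> L / of_nat (order H)) * ?b \<chi> M))"
    by (rule supported_on_cong[OF supported_on_subgroups[OF y]], rule supported_on_cong[OF free], rule pointwise)
  also have "\<dots> = burnside_sum H K y (\<lambda>L. \<Sum>\<chi>\<in>?I. (mark G H (twisted_diagonal Q \<chi>) x / of_nat (order H)) * ?a \<chi> L)"
  proof -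
    have "burnside_sum G H x (\<lambda>M. \<Sum>\<chi>\<in>?I. (?a \<chi> L / of_nat (order H)) * ?b \<chi> M)
        = (\<Sum>\<chi>\<in>?I. (mark G H (twisted_diagonal Q \<chi>) x / of_nat (order H)) * ?a \<chi> L)" for L
      unfolding burnside_sum_linear mark_def by (simp add: mult_ac)
    then show ?thesis by simp
  qed
  also have "\<dots> = (\<Sum>\<chi>\<in>?I. (mark G H (twisted_diagonal Q \<chi>) x / of_nat (order H)) * mark H K (pair_image \<psi> \<chi> Q) y)"
    unfolding mark_def by (rule burnside_sum_linear)
  finally show ?thesis
    by (simp add: sum_divide_distrib mult_ac)
qed

definition conj_by :: "('a, 'm) monoid_scheme \<Rightarrow> 'a \<Rightarrow> 'a \<Rightarrow> 'a" where
  "conj_by A a x = a \<otimes>\<^bsub>A\<^esub> x \<otimes>\<^bsub>A\<^esub> inv\<^bsub>A\<^esub> a"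

abbreviation conj_set :: "('a, 'm) monoid_scheme \<Rightarrow> 'a \<Rightarrow> 'a set \<Rightarrow> 'a set" where
  "conj_set A a D \<equiv> conj_by A a ` D"

context group
begin

lemma conj_by_closed [simp]: "\<lbrakk>a \<in> carrier G; x \<in> carrier G\<rbrakk> \<Longrightarrow> conj_by G a x \<in> carrier G"
  by (simp add: conj_by_def)

lemma conj_by_mult:
  "\<lbrakk>a \<in> carrier G; b \<in> carrier G; x \<in> carrier G\<rbrakk>
    \<Longrightarrow> conj_by G a (conj_by G b x) = conj_by G (a \<otimes> b) x"
  by (simp add: conj_by_def inv_mult_group m_assoc)

lemma conj_by_one [simp]: "x \<in> carrier G \<Longrightarrow> conj_by G \<one> x = x"
  by (simp add: conj_by_def)

lemma conj_by_inv [simp]: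
  assumes "a \<in> carrier G" "x \<in> carrier G"
  shows "conj_by G (inv a) (conj_by G a x) = x" and "conj_by G a (conj_by G (inv a) x) = x"
  using assms by (simp_all add: conj_by_mult)

lemma conj_by_eq_iff:
  assumes "a \<in> carrier G" "x \<in> carrier G" "y \<in> carrier G"
  shows "y = conj_by G a x \<longleftrightarrow> x = conj_by G (inv a) y"
  using assms by auto

end

lemma (in group_hom) hom_conj_by:
  "\<lbrakk>a \<in> carrier G; x \<in> carrier G\<rbrakk> \<Longrightarrow> h (conj_by G a x) = conj_by H (h a) (h x)"
  by (simp add: conj_by_def)

lemma conj_by_DirProd:
  "\<lbrakk>group G; group H; h \<in> carrier H; g \<in> carrier G\<rbrakk>
    \<Longrightarrow> conj_by (H \<times>\<times> G) (h, g) z = (conj_by H h (fst z), conj_by G g (snd z))"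
  by (cases z) (simp add: conj_by_def)

lemma (in group_action) stabilizer_translate:
  assumes x: "x \<in> E" and a: "a \<in> carrier G"
  shows "stabilizer G \<phi> (\<phi> a x) = conj_set G a (stabilizer G \<phi> x)"
proof -
  interpret group G
    using group_hom by (simp add: group_hom_def)
  have "b \<in> stabilizer G \<phi> (\<phi> a x) \<longleftrightarrow> conj_by G (inv a) b \<in> stabilizer G \<phi> x" if b: "b \<in> carrier G" for b
    using action_eq_iff[of x "b \<otimes> a" a] x a b
    by (simp add: stabilizer_def composition_rule m_assoc conj_by_def)
  then show ?thesis
    using conj_by_inv[OF a] conj_by_closed[OF a] stabilizer_subset[of x] stabilizer_subset[of "\<phi> a x"]
    by (intro equalityI subsetI) (metis image_eqI subsetD, auto simp: subset_iff)
qed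

lemma burnside_sum_conj_set:
  assumes x: "x \<in> carrier (free_bisets p G H)" and a: "a \<in> carrier (H \<times>\<times> G)"
  shows "burnside_sum G H x (\<lambda>M. g (conj_set (H \<times>\<times> G) a M)) = burnside_sum G H x g"
proof -
  have "stab_sum (H \<times>\<times> G) (biset_rep c) (\<lambda>M. g (conj_set (H \<times>\<times> G) a M)) = stab_sum (H \<times>\<times> G) (biset_rep c) g"
    if c: "c \<in> Poly_Mapping.keys x" for c
  proof -
    have "c \<in> biset_classes G H"
      using c x by (auto simp: free_bisets_carrier_iff)
    from biset_rep(1)[OF this]
    interpret group_action "H \<times>\<times> G" "fst (biset_rep c)" "snd (biset_rep c)"
      by (simp add: is_biset_def)
    have "bij_betw (snd (biset_rep c) a) (fst (biset_rep c)) (fst (biset_rep c))"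
      using bij_prop0[OF a] by (simp add: Bij_def)
    then have "(\<Sum>z\<in>fst (biset_rep c). g (stabilizer (H \<times>\<times> G) (snd (biset_rep c)) (snd (biset_rep c) a z)))
        = stab_sum (H \<times>\<times> G) (biset_rep c) g"
      unfolding stab_sum_def by (rule sum.reindex_bij_betw)
    then show ?thesis
      by (simp add: stab_sum_def stabilizer_translate[OF _ a] del: carrier_DirProd)
  qed
  then show ?thesis
    by (simp add: burnside_sum_def)
qed

text \<open>Translating points by \<open>a\<close> conjugates all stabilizers, so marks are class functions.\<close>
lemma mark_conj_set:
  assumes "group G" and "group H" and x: "x \<in> carrier (free_bisets p G H)"
    and a: "a \<in> carrier (H \<times>\<times> G)" and D: "D \<subseteq> carrier (H \<times>\<times> G)"
  shows "mark G H (conj_set (H \<times>\<times> G) a D) x = mark G H D x"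
proof -
  interpret group "H \<times>\<times> G"
    using assms(2,1) by (rule DirProd_group)
  have inj: "inj_on (conj_by (H \<times>\<times> G) a) (carrier (H \<times>\<times> G))"
    by (rule inj_on_inverseI[where g = "conj_by (H \<times>\<times> G) (inv\<^bsub>H \<times>\<times> G\<^esub> a)"], rule conj_by_inv(1)[OF a])
  have sub: "conj_set (H \<times>\<times> G) a D \<subseteq> conj_set (H \<times>\<times> G) a M \<longleftrightarrow> D \<subseteq> M"
    if "subgroup M (H \<times>\<times> G)" for M
    using inj_on_image_mem_iff[OF inj _ subgroup.subset[OF that]] D by blast
  have "mark G H (conj_set (H \<times>\<times> G) a D) x
    = burnside_sum G H x (\<lambda>M. of_bool (conj_set (H \<times>\<times> G) a D \<subseteq> conj_set (H \<times>\<times> G) a M))"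
    unfolding mark_def by (rule burnside_sum_conj_set[OF x a, symmetric])
  also have "\<dots> = mark G H D x"
    unfolding mark_def
    by (rule supported_on_cong[OF supported_on_subgroups[OF x]]) (simp only: sub)
  finally show ?thesis .
qed

lemma conj_set_pair_image:
  assumes "group G" "group H" "h \<in> carrier H" "g \<in> carrier G"
  shows "conj_set (H \<times>\<times> G) (h, g) (pair_image \<alpha> \<beta> Q) =
    pair_image (\<lambda>q. conj_by H h (\<alpha> q)) (\<lambda>q. conj_by G g (\<beta> q)) Q"
  using conj_by_DirProd[OF assms] by (simp add: image_image)

lemma mark_conj:
  assumes G: "group G" and H: "group H" and x: "x \<in> carrier (free_bisets p G H)"
    and \<alpha>: "\<And>q. q \<in> Q \<Longrightarrow> \<alpha> q \<in> carrier H" and \<beta>: "\<And>q. q \<in> Q \<Longrightarrow> \<beta> q \<in> carrier G"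
  shows mark_conj_left: "h \<in> carrier H \<Longrightarrow>
      mark G H (pair_image (\<lambda>q. conj_by H h (\<alpha> q)) \<beta> Q) x = mark G H (pair_image \<alpha> \<beta> Q) x"
    and mark_conj_right: "g \<in> carrier G \<Longrightarrow>
      mark G H (pair_image \<alpha> (\<lambda>q. conj_by G g (\<beta> q)) Q) x = mark G H (pair_image \<alpha> \<beta> Q) x"
proof -
  interpret G: group G by fact
  interpret H: group H by fact
  have D: "pair_image \<alpha> \<beta> Q \<subseteq> carrier (H \<times>\<times> G)"
    using \<alpha> \<beta> by auto
  show "mark G H (pair_image (\<lambda>q. conj_by H h (\<alpha> q)) \<beta> Q) x = mark G H (pair_image \<alpha> \<beta> Q) x"
    if "h \<in> carrier H"
  proof -
    have "pair_image (\<lambda>q. conj_by H h (\<alpha> q)) \<beta> Q = conj_set (H \<times>\<times> G) (h, \<one>\<^bsub>G\<^esub>) (pair_image \<alpha> \<beta> Q)"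
      unfolding conj_set_pair_image[OF G H that G.one_closed] by (rule image_cong[OF refl]) (simp add: \<beta>)
    then show ?thesis using mark_conj_set[OF G H x _ D] that by simp
  qed
  show "mark G H (pair_image \<alpha> (\<lambda>q. conj_by G g (\<beta> q)) Q) x = mark G H (pair_image \<alpha> \<beta> Q) x"
    if "g \<in> carrier G"
  proof -
    have "pair_image \<alpha> (\<lambda>q. conj_by G g (\<beta> q)) Q = conj_set (H \<times>\<times> G) (\<one>\<^bsub>H\<^esub>, g) (pair_image \<alpha> \<beta> Q)"
      unfolding conj_set_pair_image[OF G H H.one_closed that] by (rule image_cong[OF refl]) (simp add: \<alpha>)
    then show ?thesis using mark_conj_set[OF G H x _ D] that by simp
  qed
qed

section \<open>Composition with transitive bisets\<close>

text \<open>A transitive biset is the case of the group \<open>H \<times> G\<close>. The generality also covers the action of \<open>S\<close> on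
  \<open>S/P\<close>, which is needed for the count modulo \<open>p\<close>.\<close>
definition lcosets_act ::
    "('a, 'm) monoid_scheme \<Rightarrow> 'a set \<Rightarrow> 'a set set \<times> ('a \<Rightarrow> 'a set \<Rightarrow> 'a set)" where
  "lcosets_act A D =
     (let Z = (\<lambda>a. a <#\<^bsub>A\<^esub> D) ` carrier A in (Z, \<lambda>a. \<lambda>C\<in>Z. a <#\<^bsub>A\<^esub> C))"

context group
begin

lemma lcosets_act_carrier: "fst (lcosets_act G D) = (\<lambda>a. a <# D) ` carrier G"
  by (simp add: lcosets_act_def Let_def)

lemma lcosets_act_apply:
  assumes "D \<subseteq> carrier G" "a \<in> carrier G" "b \<in> carrier G"
  shows "snd (lcosets_act G D) a (b <# D) = (a \<otimes> b) <# D"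
  using assms by (simp add: lcosets_act_def Let_def lcos_m_assoc)

lemma lcosets_action:
  assumes D: "D \<subseteq> carrier G"
  shows "group_action G (fst (lcosets_act G D)) (snd (lcosets_act G D))"
  unfolding lcosets_act_carrier
proof (rule group_actionI[OF is_group])
  fix a C assume a: "a \<in> carrier G" and "C \<in> (\<lambda>a. a <# D) ` carrier G"
  then obtain b where b: "b \<in> carrier G" "C = b <# D" by blast
  show "snd (lcosets_act G D) a C \<in> (\<lambda>a. a <# D) ` carrier G"
    unfolding b(2) lcosets_act_apply[OF D a b(1)] using a b by simp
next
  fix C assume "C \<in> (\<lambda>a. a <# D) ` carrier G"
  then obtain b where b: "b \<in> carrier G" "C = b <# D" by blast
  show "snd (lcosets_act G D) \<one> C = C"
    unfolding b(2) lcosets_act_apply[OF D one_closed b(1)] using b by simp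
next
  fix a a' C assume a: "a \<in> carrier G" "a' \<in> carrier G" and "C \<in> (\<lambda>a. a <# D) ` carrier G"
  then obtain b where b: "b \<in> carrier G" "C = b <# D" by blast
  show "snd (lcosets_act G D) (a \<otimes> a') C = snd (lcosets_act G D) a (snd (lcosets_act G D) a' C)"
    unfolding b(2) using a b(1) by (simp add: lcosets_act_apply[OF D] m_assoc)
qed (simp add: lcosets_act_def Let_def)

lemma lcosets_base:
  assumes D: "D \<subseteq> carrier G"
  shows "\<one> <# D = D" and "D \<in> fst (lcosets_act G D)"
    and "b \<in> carrier G \<Longrightarrow> snd (lcosets_act G D) b D = b <# D"
proof -
  show one: "\<one> <# D = D" using D by (rule lcos_mult_one)
  show "D \<in> fst (lcosets_act G D)"
    unfolding lcosets_act_carrier using one one_closed by (metis imageI)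
  show "snd (lcosets_act G D) b D = b <# D" if "b \<in> carrier G"
    using lcosets_act_apply[OF D that one_closed] one that by simp
qed

lemma lcosets_stabilizer:
  assumes D: "subgroup D G" and a: "a \<in> carrier G"
  shows "stabilizer G (snd (lcosets_act G D)) (a <# D) = conj_set G a D"
proof -
  have Dsub: "D \<subseteq> carrier G" using D by (rule subgroup.subset)
  interpret group_action G "fst (lcosets_act G D)" "snd (lcosets_act G D)"
    using Dsub by (rule lcosets_action)
  note base = lcosets_base[OF Dsub]
  have "b <# D = D \<longleftrightarrow> b \<in> D" if b: "b \<in> carrier G" for b
  proof
    assume "b <# D = D"
    moreover have "b \<otimes> \<one> \<in> b <# D"
      using subgroup.one_closed[OF D] unfolding l_coset_def by blast
    ultimately show "b \<in> D" using b by simp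
  next
    assume bD: "b \<in> D"
    have "d \<in> b <# D" if d: "d \<in> D" for d
    proof -
      have "b \<otimes> (inv b \<otimes> d) = d"
        using b d Dsub by (simp add: m_assoc[symmetric] subsetD)
      moreover have "inv b \<otimes> d \<in> D"
        using D bD d by (simp add: subgroup.m_closed subgroup.m_inv_closed)
      ultimately show ?thesis
        unfolding l_coset_def by force
    qed
    then show "b <# D = D"
      using subgroup.m_closed[OF D bD] by (auto simp: l_coset_def)
  qed
  then have "stabilizer G (snd (lcosets_act G D)) D = D"
    using Dsub base(3) by (auto simp: stabilizer_def subset_iff cong: conj_cong)
  then show ?thesis
    using stabilizer_translate[OF base(2) a] base(3)[OF a] by simp
qed

lemma conj_set_subgroup:
  assumes D: "subgroup D G" and a: "a \<in> carrier G"
  shows "subgroup (conj_set G a D) G"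
  unfolding lcosets_stabilizer[OF assms, symmetric]
  by (rule group_action.stabilizer_subgroup[OF lcosets_action[OF subgroup.subset[OF D]]])
    (use a in \<open>simp add: lcosets_act_carrier\<close>)

text \<open>The stabilizer of the coset \<open>a D\<close> is the conjugate of \<open>D\<close> by \<open>a\<close>, and every coset arises from
  \<open>|D|\<close> elements \<open>a\<close>.\<close>
lemma stab_sum_lcosets:
  assumes D: "subgroup D G" and fin: "finite (carrier G)"
  shows "stab_sum G (lcosets_act G D) g = (\<Sum>a\<in>carrier G. g (conj_set G a D)) / of_nat (card D)"
proof -
  have Dsub: "D \<subseteq> carrier G" using D by (rule subgroup.subset)
  interpret group_action G "fst (lcosets_act G D)" "snd (lcosets_act G D)"
    using Dsub by (rule lcosets_action)
  let ?f = "\<lambda>a. a <# D"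
  have finD: "finite D" using Dsub fin by (rule finite_subset)
  have D0: "card D > 0"
    using finD subgroup.one_closed[OF D] by (auto simp: card_gt_0_iff)
  note base = lcosets_base[OF Dsub]
  have stabD: "stabilizer G (snd (lcosets_act G D)) D = D"
    using lcosets_stabilizer[OF D one_closed] base(1) subsetD[OF Dsub] by simp
  have card_fibre: "card {a \<in> carrier G. ?f a = ?f b} = card D" if b: "b \<in> carrier G" for b
  proof -
    have "{a \<in> carrier G. ?f a = ?f b} = (\<lambda>d. b \<otimes> d) ` D"
    proof (intro equalityI subsetI)
      fix a assume "a \<in> {a \<in> carrier G. ?f a = ?f b}"
      then have a: "a \<in> carrier G" "inv b \<otimes> a \<in> D"
        using action_eq_iff[OF base(2), of a b] b stabD by (simp_all add: base(3))
      moreover have "a = b \<otimes> (inv b \<otimes> a)"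
        using a b by (simp add: m_assoc[symmetric])
      ultimately show "a \<in> (\<lambda>d. b \<otimes> d) ` D" by blast
    next
      fix a assume "a \<in> (\<lambda>d. b \<otimes> d) ` D"
      then obtain d where d: "d \<in> D" "a = b \<otimes> d" by blast
      then have dc: "d \<in> carrier G" using Dsub by blast
      have "inv b \<otimes> a = d" unfolding d(2) using b dc by (simp add: m_assoc[symmetric])
      then show "a \<in> {a \<in> carrier G. ?f a = ?f b}"
        using action_eq_iff[OF base(2), of a b] b dc d stabD by (simp add: base(3))
    qed
    moreover have "inj_on (\<lambda>d. b \<otimes> d) D"
      using Dsub b by (auto simp: inj_on_def subsetD)
    ultimately show ?thesis
      by (simp add: card_image)
  qed
  have "(\<Sum>a\<in>carrier G. g (conj_set G a D)) = (\<Sum>a\<in>carrier G. g (stabilizer G (snd (lcosets_act G D)) (?f a)))"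
    by (simp add: lcosets_stabilizer[OF D])
  also have "\<dots> = (\<Sum>C\<in>?f ` carrier G. \<Sum>a\<in>{a \<in> carrier G. ?f a = C}. g (stabilizer G (snd (lcosets_act G D)) (?f a)))"
    by (rule sum.image_gen[OF fin])
  also have "\<dots> = (\<Sum>C\<in>?f ` carrier G. of_nat (card D) * g (stabilizer G (snd (lcosets_act G D)) C))"
    by (rule sum.cong[OF refl]) (auto simp: card_fibre)
  also have "\<dots> = of_nat (card D) * stab_sum G (lcosets_act G D) g"
    by (simp add: stab_sum_def lcosets_act_carrier sum_distrib_left)
  finally show ?thesis
    using D0 by simp
qed

end

lemma transitive_biset_eq_lcosets_act:
  "transitive_biset G H U \<phi> = lcosets_act (H \<times>\<times> G) (twisted_diagonal U \<phi>)"
  by (simp add: transitive_biset_def lcosets_act_def)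

definition transitive_gen ::
    "('g, 'm) monoid_scheme \<Rightarrow> ('h, 'n) monoid_scheme \<Rightarrow> 'g set \<Rightarrow> ('g \<Rightarrow> 'h)
      \<Rightarrow> (('h, 'g) biset_class \<Rightarrow>\<^sub>0 rat)" where
  "transitive_gen G H U \<phi> = Poly_Mapping.single (iso_class G H (transitive_biset G H U \<phi>)) 1"

locale finite_groups =
  dom: group G + cod: group H
  for G :: "('g, 'm) monoid_scheme" and H :: "('h, 'n) monoid_scheme" +
  assumes fin_dom: "finite (carrier G)" and fin_cod: "finite (carrier H)"
begin

lemma fin_HG: "finite (carrier (H \<times>\<times> G))"
  by (simp add: fin_dom fin_cod)

sublocale HG: group "H \<times>\<times> G"
  using cod.is_group dom.is_group by (rule DirProd_group)

lemma is_biset_transitive: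
  assumes "twisted_diagonal U \<phi> \<subseteq> carrier (H \<times>\<times> G)"
  shows "is_biset G H (transitive_biset G H U \<phi>)"
  using HG.lcosets_action[OF assms] fin_HG
  by (simp add: is_biset_def transitive_biset_eq_lcosets_act HG.lcosets_act_carrier)

lemma transitive_gen_closed:
  assumes "prime p" and "twisted_diagonal U \<phi> \<subseteq> carrier (H \<times>\<times> G)"
  shows "transitive_gen G H U \<phi> \<in> carrier (free_bisets p G H)"
  unfolding transitive_gen_def using assms
  by (intro single_in_free_bisets iso_class_in_biset_classes is_biset_transitive localized_ints_one)

lemma stab_sum_transitive_biset:
  assumes "subgroup (twisted_diagonal U \<phi>) (H \<times>\<times> G)"
  shows "stab_sum (H \<times>\<times> G) (transitive_biset G H U \<phi>) g =
    (\<Sum>a\<in>carrier (H \<times>\<times> G). g (conj_set (H \<times>\<times> G) a (twisted_diagonal U \<phi>)))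
      / of_nat (card (twisted_diagonal U \<phi>))"
  unfolding transitive_biset_eq_lcosets_act
  using assms fin_HG by (rule HG.stab_sum_lcosets)

lemma burnside_sum_transitive_gen:
  assumes "subgroup (twisted_diagonal U \<phi>) (H \<times>\<times> G)"
  shows "burnside_sum G H (transitive_gen G H U \<phi>) g =
    (\<Sum>a\<in>carrier (H \<times>\<times> G). g (conj_set (H \<times>\<times> G) a (twisted_diagonal U \<phi>)))
      / of_nat (card (twisted_diagonal U \<phi>))"
  unfolding transitive_gen_def
  using is_biset_transitive[OF subgroup.subset[OF assms]] stab_sum_transitive_biset[OF assms]
  by (simp add: burnside_sum_single)

lemma subgroup_pair_image:
  assumes Q: "group Q" and \<alpha>: "\<alpha> \<in> hom Q H" and \<beta>: "\<beta> \<in> hom Q G"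
  shows "subgroup (pair_image \<alpha> \<beta> (carrier Q)) (H \<times>\<times> G)"
proof -
  have "(\<lambda>q. (\<alpha> q, \<beta> q)) \<in> hom Q (H \<times>\<times> G)"
    using \<alpha> \<beta> by (simp add: hom_paired)
  then interpret group_hom Q "H \<times>\<times> G" "\<lambda>q. (\<alpha> q, \<beta> q)"
    using Q HG.is_group by (intro group_hom.intro group_hom_axioms.intro)
  show ?thesis by (rule img_is_subgroup)
qed

lemma subgroup_twisted_diagonal:
  assumes U: "subgroup U G" and \<phi>: "\<phi> \<in> hom (G\<lparr>carrier := U\<rparr>) H"
  shows "subgroup (twisted_diagonal U \<phi>) (H \<times>\<times> G)"
proof -
  have "(\<lambda>u. u) \<in> hom (G\<lparr>carrier := U\<rparr>) G"
    using subgroup.subset[OF U] by (auto simp: hom_def)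
  from subgroup_pair_image[OF dom.subgroup_imp_group[OF U] \<phi> this] show ?thesis
    by (simp add: twisted_diagonal_def)
qed

lemma left_free_conj_twisted_diagonal:
  assumes U: "subgroup U G" and \<phi>: "\<phi> \<in> hom (G\<lparr>carrier := U\<rparr>) H" and a: "a \<in> carrier (H \<times>\<times> G)"
  shows "left_free G H (conj_set (H \<times>\<times> G) a (twisted_diagonal U \<phi>))"
  unfolding left_free_def
proof (intro conjI allI impI)
  show "subgroup (conj_set (H \<times>\<times> G) a (twisted_diagonal U \<phi>)) (H \<times>\<times> G)"
    using subgroup_twisted_diagonal[OF U \<phi>] a by (rule HG.conj_set_subgroup)
  obtain h g where hg: "a = (h, g)" "h \<in> carrier H" "g \<in> carrier G"
    using a by auto
  note conj = conj_set_pair_image[OF dom.is_group cod.is_group hg(2,3)]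
  interpret \<phi>: group_hom "G\<lparr>carrier := U\<rparr>" H \<phi>
    using dom.subgroup_imp_group[OF U] cod.is_group \<phi> by (intro group_hom.intro group_hom_axioms.intro)
  fix k assume "(k, \<one>\<^bsub>G\<^esub>) \<in> conj_set (H \<times>\<times> G) a (twisted_diagonal U \<phi>)"
  then obtain u where u: "u \<in> U" "k = conj_by H h (\<phi> u)" "conj_by G g u = \<one>\<^bsub>G\<^esub>"
    unfolding hg(1) twisted_diagonal_def conj by force
  have "u \<in> carrier G" using u(1) subgroup.subset[OF U] by blast
  then have "u = \<one>\<^bsub>G\<^esub>"
    using u(3) hg dom.conj_by_eq_iff[OF hg(3), of u "\<one>\<^bsub>G\<^esub>"] by (simp add: conj_by_def)
  then show "k = \<one>\<^bsub>H\<^esub>"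
    using u(2) hg \<phi>.hom_one by (simp add: conj_by_def)
qed

lemma transitive_gen_of_hom:
  assumes U: "subgroup U G" and \<phi>: "\<phi> \<in> hom (G\<lparr>carrier := U\<rparr>) H"
  shows "prime p \<Longrightarrow> transitive_gen G H U \<phi> \<in> carrier (free_bisets p G H)"
    and "supported_on G H (left_free G H) (transitive_gen G H U \<phi>)"
  unfolding supported_on_def
  using left_free_conj_twisted_diagonal[OF assms]
    transitive_gen_closed[OF _ subgroup.subset[OF subgroup_twisted_diagonal[OF assms]]]
  by (simp_all add: burnside_sum_transitive_gen[OF subgroup_twisted_diagonal[OF assms]] del: carrier_DirProd)

lemma card_twisted_diagonal: "card (twisted_diagonal U \<phi>) = card U"
  unfolding twisted_diagonal_def by (rule card_image) (auto simp: inj_on_def)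

end

text \<open>Composing with \<open>[G,\<phi>]\<close> restricts the right action along \<open>\<phi>\<close>. The stabilizers of \<open>[G,\<phi>]\<close> are the
  conjugates of \<open>\<Delta>(G,\<phi>)\<close>, which are the graphs of conjugates of \<open>\<phi>\<close> by elements \<open>m\<close> of \<open>H\<close>; all of
  these contribute equally because marks are class functions.\<close>
lemma mark_comp_transitive_right:
  assumes p: "prime p" and GH: "finite_groups G H" and K: "group K"
    and y: "y \<in> carrier (free_bisets p H K)" and \<phi>: "\<phi> \<in> hom G H"
    and Q: "Q \<subseteq> carrier G" and \<psi>: "\<And>q. q \<in> Q \<Longrightarrow> \<psi> q \<in> carrier K"
  shows "mark G K (twisted_diagonal Q \<psi>) (free_comp G H K y (transitive_gen G H (carrier G) \<phi>))
    = mark H K (pair_image \<psi> \<phi> Q) y"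
proof -
  interpret finite_groups G H by fact
  interpret K: group K by fact
  interpret \<phi>: group_hom G H \<phi>
    using \<phi> by unfold_locales
  let ?D = "twisted_diagonal (carrier G) \<phi>"
  have \<phi>': "\<phi> \<in> hom (G\<lparr>carrier := carrier G\<rparr>) H"
    using \<phi> by (simp add: hom_def)
  note D = subgroup_twisted_diagonal[OF dom.subgroup_self \<phi>']
  note free = left_free_conj_twisted_diagonal[OF dom.subgroup_self \<phi>']
  note gen = transitive_gen_of_hom(1)[OF dom.subgroup_self \<phi>' p]
  \<comment> \<open>\<open>h \<phi>(g\<inverse> q g) h\<inverse> = m \<phi>(q) m\<inverse>\<close> for \<open>m = h \<phi>(g)\<inverse>\<close>.\<close>
  define m where "m a = fst a \<otimes>\<^bsub>H\<^esub> inv\<^bsub>H\<^esub> (\<phi> (snd a))" for a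
  have m: "m a \<in> carrier H" if "a \<in> carrier (H \<times>\<times> G)" for a
    using that by (auto simp: m_def)
  have sub_iff: "twisted_diagonal Q \<psi> \<subseteq> L O conj_set (H \<times>\<times> G) a ?D \<longleftrightarrow>
      pair_image \<psi> (\<lambda>q. conj_by H (m a) (\<phi> q)) Q \<subseteq> L"
    if a: "a \<in> carrier (H \<times>\<times> G)" for a L
  proof -
    obtain h g where hg: "a = (h, g)" "h \<in> carrier H" "g \<in> carrier G"
      using a by auto
    have mem: "(k, q) \<in> conj_set (H \<times>\<times> G) a ?D \<longleftrightarrow> k = conj_by H (m a) (\<phi> q)"
      if q: "q \<in> carrier G" for k q
    proof -
      have "(k, q) \<in> conj_set (H \<times>\<times> G) a ?D \<longleftrightarrow>
          (\<exists>u\<in>carrier G. q = conj_by G g u \<and> k = conj_by H h (\<phi> u))"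
        unfolding hg(1) twisted_diagonal_def conj_set_pair_image[OF dom.is_group cod.is_group hg(2,3)] by auto
      also have "\<dots> \<longleftrightarrow> (\<exists>u\<in>carrier G. u = conj_by G (inv\<^bsub>G\<^esub> g) q \<and> k = conj_by H h (\<phi> u))"
        using dom.conj_by_eq_iff[OF hg(3) _ q] by (intro bex_cong refl) simp
      also have "\<dots> \<longleftrightarrow> k = conj_by H h (\<phi> (conj_by G (inv\<^bsub>G\<^esub> g) q))"
        using q hg by auto
      also have "conj_by H h (\<phi> (conj_by G (inv\<^bsub>G\<^esub> g) q)) = conj_by H (m a) (\<phi> q)"
        using q hg by (simp add: m_def \<phi>.hom_conj_by cod.conj_by_mult)
      finally show ?thesis .
    qed
    have "(\<psi> q, q) \<in> L O conj_set (H \<times>\<times> G) a ?D \<longleftrightarrow> (\<psi> q, conj_by H (m a) (\<phi> q)) \<in> L"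
      if "q \<in> Q" for q
      by (simp only: relcomp_unfold mem_Collect_eq case_prod_conv mem[OF subsetD[OF Q that]]) auto
    then show ?thesis
      by (simp add: twisted_diagonal_def image_subset_iff)
  qed
  have inner: "burnside_sum G H (transitive_gen G H (carrier G) \<phi>)
        (\<lambda>M. balance_weight G H K L M * of_bool (twisted_diagonal Q \<psi> \<subseteq> L O M))
      = (\<Sum>a\<in>carrier (H \<times>\<times> G). (1 / of_nat (order H * order G))
          * of_bool (pair_image \<psi> (\<lambda>q. conj_by H (m a) (\<phi> q)) Q \<subseteq> L))"
    if L: "subgroup L (K \<times>\<times> H)" for L
    unfolding burnside_sum_transitive_gen[OF D] card_twisted_diagonal sum_divide_distrib
    by (rule sum.cong[OF refl])
      (simp add: balance_weight_left_free[OF dom.is_group cod.is_group K.is_group L free] sub_iff order_def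
        del: carrier_DirProd)
  have conj: "mark H K (pair_image \<psi> (\<lambda>q. conj_by H (m a) (\<phi> q)) Q) y = mark H K (pair_image \<psi> \<phi> Q) y"
    if a: "a \<in> carrier (H \<times>\<times> G)" for a
    by (rule mark_conj_right[OF cod.is_group K.is_group y _ _ m[OF a]]) (use \<psi> Q \<phi>.hom_closed in blast)+
  have "mark G K (twisted_diagonal Q \<psi>) (free_comp G H K y (transitive_gen G H (carrier G) \<phi>))
    = burnside_sum H K y (\<lambda>L. \<Sum>a\<in>carrier (H \<times>\<times> G). (1 / of_nat (order H * order G))
          * of_bool (pair_image \<psi> (\<lambda>q. conj_by H (m a) (\<phi> q)) Q \<subseteq> L))"
    unfolding mark_def burnside_sum_free_comp[OF dom.is_group cod.is_group K.is_group fin_cod y gen]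
    by (rule supported_on_cong[OF supported_on_subgroups[OF y] inner])
  also have "\<dots> = (\<Sum>a\<in>carrier (H \<times>\<times> G). (1 / of_nat (order H * order G)) * mark H K (pair_image \<psi> \<phi> Q) y)"
    unfolding burnside_sum_linear using conj by (simp add: mark_def del: carrier_DirProd)
  also have "\<dots> = mark H K (pair_image \<psi> \<phi> Q) y"
    using dom.one_closed cod.one_closed fin_dom fin_cod
    by (auto simp: order_def card_cartesian_product)
  finally show ?thesis .
qed

text \<open>The biset is described by the homomorphism \<open>\<theta>\<close> from \<open>V \<le> K\<close> to \<open>H\<close> whose graph, transposed, is the
  twisted diagonal; this fits both \<open>[\<phi> P, \<phi>\<inverse>]\<close>, with \<open>\<theta> = \<phi>\<close>, and inclusions. The
  diagonal conjugated by \<open>(k, h)\<close> reaches \<open>\<psi>\<close> only if conjugation by \<open>k\<inverse>\<close> makes \<open>\<psi>\<close> take values in \<open>V\<close>;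
  then \<open>\<theta>\<close> carries the result to \<open>H\<close>, where the conjugation by \<open>h\<close> is absorbed by the mark.\<close>
lemma mark_comp_transitive_left:
  assumes p: "prime p" and G: "group G" and HK: "finite_groups H K"
    and x: "x \<in> carrier (free_bisets p G H)" and free: "supported_on G H (left_free G H) x"
    and V: "subgroup V K" and \<theta>: "\<theta> \<in> hom (K\<lparr>carrier := V\<rparr>) H"
    and diag: "twisted_diagonal U \<phi> = pair_image (\<lambda>v. v) \<theta> V"
    and Q: "Q \<subseteq> carrier G" and \<psi>: "\<And>q. q \<in> Q \<Longrightarrow> \<psi> q \<in> carrier K"
  shows "mark G K (twisted_diagonal Q \<psi>) (free_comp G H K (transitive_gen H K U \<phi>) x) =
    (\<Sum>k\<in>carrier K. of_bool (\<forall>q\<in>Q. conj_by K (inv\<^bsub>K\<^esub> k) (\<psi> q) \<in> V)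
      * mark G H (twisted_diagonal Q (\<lambda>q. \<theta> (conj_by K (inv\<^bsub>K\<^esub> k) (\<psi> q)))) x) / of_nat (card V)"
proof -
  interpret G: group G by fact
  interpret finite_groups H K by fact
  let ?D = "twisted_diagonal U \<phi>"
  have "(\<lambda>v. v) \<in> hom (K\<lparr>carrier := V\<rparr>) K"
    using subgroup.subset[OF V] by (auto simp: hom_def)
  from subgroup_pair_image[OF cod.subgroup_imp_group[OF V] this \<theta>]
  have D: "subgroup ?D (K \<times>\<times> H)"
    by (simp add: diag)
  have gen: "transitive_gen H K U \<phi> \<in> carrier (free_bisets p H K)"
    using p subgroup.subset[OF D] by (rule transitive_gen_closed)
  have card_D: "card ?D = card V"
    unfolding diag by (rule card_image) (auto simp: inj_on_def)
  have \<theta>V: "\<theta> v \<in> carrier H" if "v \<in> V" for v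
    using \<theta> that by (auto simp: hom_def)
  let ?c = "\<lambda>k q. conj_by K (inv\<^bsub>K\<^esub> k) (\<psi> q)"
  let ?C = "\<lambda>k. \<forall>q\<in>Q. ?c k q \<in> V"
  have sub_iff: "twisted_diagonal Q \<psi> \<subseteq> conj_set (K \<times>\<times> H) (k, h) ?D O M \<longleftrightarrow>
      ?C k \<and> pair_image (\<lambda>q. conj_by H h (\<theta> (?c k q))) (\<lambda>q. q) Q \<subseteq> M"
    if k: "k \<in> carrier K" and h: "h \<in> carrier H" for k h M
  proof -
    have "(\<psi> q, q) \<in> conj_set (K \<times>\<times> H) (k, h) ?D O M \<longleftrightarrow>
        ?c k q \<in> V \<and> (conj_by H h (\<theta> (?c k q)), q) \<in> M" if q: "q \<in> Q" for q
    proof -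
      have "(\<psi> q, q) \<in> conj_set (K \<times>\<times> H) (k, h) ?D O M \<longleftrightarrow>
        (\<exists>v\<in>V. \<psi> q = conj_by K k v \<and> (conj_by H h (\<theta> v), q) \<in> M)"
        unfolding diag conj_set_pair_image[OF dom.is_group cod.is_group k h] by auto
      also have "\<dots> \<longleftrightarrow> (\<exists>v\<in>V. v = ?c k q \<and> (conj_by H h (\<theta> v), q) \<in> M)"
        using cod.conj_by_eq_iff[OF k _ \<psi>[OF q]] subgroup.subset[OF V] by (intro bex_cong refl) auto
      finally show ?thesis by auto
    qed
    then show ?thesis
      by (auto simp: twisted_diagonal_def image_subset_iff)
  qed
  have inner: "burnside_sum G H x (\<lambda>M. balance_weight G H K (conj_set (K \<times>\<times> H) a ?D) M
        * of_bool (twisted_diagonal Q \<psi> \<subseteq> conj_set (K \<times>\<times> H) a ?D O M))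
      = of_bool (?C (fst a)) * mark G H (twisted_diagonal Q (\<lambda>q. \<theta> (?c (fst a) q))) x / of_nat (order H)"
    if a: "a \<in> carrier (K \<times>\<times> H)" for a
  proof -
    obtain k h where kh: "a = (k, h)" "k \<in> carrier K" "h \<in> carrier H"
      using a by auto
    note L = HG.conj_set_subgroup[OF D a]
    let ?M = "pair_image (\<lambda>q. conj_by H h (\<theta> (?c k q))) (\<lambda>q. q) Q"
    have "burnside_sum G H x (\<lambda>M. balance_weight G H K (conj_set (K \<times>\<times> H) a ?D) M
        * of_bool (twisted_diagonal Q \<psi> \<subseteq> conj_set (K \<times>\<times> H) a ?D O M))
      = burnside_sum G H x (\<lambda>M. (of_bool (?C k) / of_nat (order H)) * of_bool (?M \<subseteq> M))"
      by (rule supported_on_cong[OF free])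
        (simp add: kh(1) sub_iff[OF kh(2,3)]
          balance_weight_left_free[OF G dom.is_group cod.is_group L[unfolded kh(1)]])
    also have "\<dots> = of_bool (?C k) * mark G H ?M x / of_nat (order H)"
      unfolding burnside_sum_cmult mark_def by simp
    also have "of_bool (?C k) * mark G H ?M x = of_bool (?C k) * mark G H (twisted_diagonal Q (\<lambda>q. \<theta> (?c k q))) x"
    proof (cases "?C k")
      case True
      have "mark G H ?M x = mark G H (pair_image (\<lambda>q. \<theta> (?c k q)) (\<lambda>q. q) Q) x"
        by (rule mark_conj_left[OF G.is_group dom.is_group x _ _ kh(3)]) (use Q True \<theta>V in blast)+
      then show ?thesis
        by (simp only: twisted_diagonal_def)
    qed simp
    finally show ?thesis
      by (simp add: kh(1))
  qed
  have "mark G K (twisted_diagonal Q \<psi>) (free_comp G H K (transitive_gen H K U \<phi>) x) =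
    (\<Sum>a\<in>carrier (K \<times>\<times> H).
      of_bool (?C (fst a)) * mark G H (twisted_diagonal Q (\<lambda>q. \<theta> (?c (fst a) q))) x / of_nat (order H)) / of_nat (card V)"
    unfolding mark_def burnside_sum_free_comp[OF G dom.is_group cod.is_group fin_dom gen x]
      burnside_sum_transitive_gen[OF D] card_D
    by (simp add: inner mark_def del: carrier_DirProd)
  also have "\<dots> = (\<Sum>k\<in>carrier K. of_bool (?C k) * mark G H (twisted_diagonal Q (\<lambda>q. \<theta> (?c k q))) x) / of_nat (card V)"
  proof -
    have "card (carrier H) \<noteq> 0"
      using fin_dom dom.one_closed by auto
    then have "(\<Sum>a\<in>carrier (K \<times>\<times> H). f (fst a) / of_nat (order H)) = (\<Sum>k\<in>carrier K. f k)" for f :: "_ \<Rightarrow> rat"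
      unfolding carrier_DirProd sum.cartesian_product' by (simp add: order_def)
    from this[of "\<lambda>k. of_bool (?C k) * mark G H (twisted_diagonal Q (\<lambda>q. \<theta> (?c k q))) x"]
    show ?thesis by (simp only:)
  qed
  finally show ?thesis .
qed

section \<open>Morphisms of fusion systems\<close>

context fusion_system
begin

lemma morphismD:
  assumes "subgroup P G" "subgroup Q G" "\<phi> \<in> F P Q"
  shows "\<phi> \<in> hom (G\<lparr>carrier := P\<rparr>) (G\<lparr>carrier := Q\<rparr>)" and "inj_on \<phi> P"
    and "\<phi> \<in> extensional P" and "\<phi> ` P \<subseteq> Q"
  using morphism_mon[OF assms] by (auto simp: mon_def hom_def)

lemma morphism_PiE:
  assumes "subgroup P G" "subgroup Q G" "\<phi> \<in> F P Q"
  shows "\<phi> \<in> P \<rightarrow>\<^sub>E Q"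
  using morphismD(3,4)[OF assms] by (auto simp: PiE_def)

lemma morphism_hom:
  assumes "subgroup P G" "subgroup Q G" "\<phi> \<in> F P Q"
  shows "\<phi> \<in> hom (G\<lparr>carrier := P\<rparr>) G"
  using morphismD(1)[OF assms] subgroup.subset[OF assms(2)] by (auto simp: hom_def)

lemma morphism_image_subgroup:
  assumes "subgroup P G" "subgroup Q G" "\<phi> \<in> F P Q"
  shows "subgroup (\<phi> ` P) G"
proof -
  interpret group_hom "G\<lparr>carrier := P\<rparr>" G \<phi>
    using subgroup_imp_group[OF assms(1)] is_group morphism_hom[OF assms]
    by (intro group_hom.intro group_hom_axioms.intro)
  show ?thesis using img_is_subgroup by simp
qed

lemma inclusion_morphism:
  assumes P: "subgroup P G" and Q: "subgroup Q G" and "P \<subseteq> Q"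
  shows "(\<lambda>u\<in>P. u) \<in> F P Q"
proof -
  have eq: "conj_map G \<one> P = (\<lambda>u\<in>P. u)"
    unfolding conj_map_def by (rule restrict_ext) (use subgroup.mem_carrier[OF P] in simp)
  show ?thesis
    using morphism_conj[OF P Q one_closed] assms(3) unfolding eq by auto
qed

lemma morphism_restrict:
  assumes P: "subgroup P G" and Q: "subgroup Q G" and \<phi>: "\<phi> \<in> F P Q"
    and A: "subgroup A G" "A \<subseteq> P"
  shows "restrict \<phi> A \<in> F A Q"
proof -
  have "compose A \<phi> (\<lambda>u\<in>A. u) \<in> F A Q"
    using morphism_compose[OF A(1) P Q inclusion_morphism[OF A(1) P A(2)] \<phi>] .
  moreover have "compose A \<phi> (\<lambda>u\<in>A. u) = restrict \<phi> A"
    by (auto simp: compose_def)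
  ultimately show ?thesis by simp
qed

lemma morphism_codomain:
  assumes P: "subgroup P G" and Q: "subgroup Q G" and \<phi>: "\<phi> \<in> F P Q"
    and Q': "subgroup Q' G" "\<phi> ` P \<subseteq> Q'"
  shows "\<phi> \<in> F P Q'"
proof -
  note I = morphism_image_subgroup[OF P Q \<phi>]
  have "compose P (\<lambda>u\<in>\<phi> ` P. u) \<phi> \<in> F P Q'"
    using morphism_compose[OF P I Q'(1) morphism_onto_image[OF P Q \<phi>] inclusion_morphism[OF I Q']] .
  moreover have "compose P (\<lambda>u\<in>\<phi> ` P. u) \<phi> = \<phi>"
    using morphismD(3)[OF P Q \<phi>] by (auto simp: compose_def fun_eq_iff extensional_def)
  ultimately show ?thesis by simp
qed

lemma finite_morphisms:
  assumes "subgroup P G" "subgroup Q G" "finite (carrier G)"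
  shows "finite (F P Q)"
proof (rule finite_subset)
  show "F P Q \<subseteq> P \<rightarrow>\<^sub>E Q" using morphism_PiE[OF assms(1,2)] by blast
  show "finite (P \<rightarrow>\<^sub>E Q)"
    using assms finite_subset[OF subgroup.subset] by (intro finite_PiE) auto
qed

text \<open>A map whose graph lies in a conjugate of \<open>\<Delta>(P,\<phi>)\<close> is a restriction of \<open>\<phi>\<close> preceded and followed
  by conjugations in \<open>S\<close>. So \<open>F\<close>-generated elements only have marks at morphisms of \<open>F\<close>.\<close>
lemma morphism_conj_twist:
  assumes P: "subgroup P G" and Q: "subgroup Q G" and \<phi>: "\<phi> \<in> F P (carrier G)"
    and s: "s \<in> carrier G" and t: "t \<in> carrier G"
    and \<chi>: "\<chi> \<in> extensional Q"
    and sub: "twisted_diagonal Q \<chi> \<subseteq> conj_set (G \<times>\<times> G) (s, t) (twisted_diagonal P \<phi>)"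
  shows "\<chi> \<in> F Q (carrier G)"
proof -
  have S: "subgroup (carrier G) G" by (rule subgroup_self)
  have ex: "conj_by G (inv t) q \<in> P \<and> \<chi> q = conj_by G s (\<phi> (conj_by G (inv t) q))" if q: "q \<in> Q" for q
  proof -
    obtain u where u: "u \<in> P" "\<chi> q = conj_by G s (\<phi> u)" "q = conj_by G t u"
      using sub q unfolding twisted_diagonal_def conj_set_pair_image[OF is_group is_group s t] by auto
    then show ?thesis using subgroup.mem_carrier[OF P u(1)] t by simp
  qed
  have conj: "conj_map G a A = (\<lambda>u\<in>A. conj_by G a u)" for a A
    by (simp add: conj_map_def conj_by_def)
  have 1: "conj_map G (inv t) Q \<in> F Q P"
    by (rule morphism_conj[OF Q P]) (use t ex in \<open>auto simp: conj\<close>)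
  note 2 = morphism_compose[OF Q P S 1 \<phi>]
  have 3: "conj_map G s (carrier G) \<in> F (carrier G) (carrier G)"
    by (rule morphism_conj[OF S S s]) (use s in \<open>auto simp: conj\<close>)
  note 4 = morphism_compose[OF Q S S 2 3]
  have "\<phi> u \<in> carrier G" if "u \<in> P" for u
    using morphismD(4)[OF P S \<phi>] that by blast
  then have "\<chi> = compose Q (conj_map G s (carrier G)) (compose Q \<phi> (conj_map G (inv t) Q))"
    by (intro extensionalityI[OF \<chi>]) (use ex in \<open>simp_all add: compose_def conj\<close>)
  with 4 show ?thesis by simp
qed

end

text \<open>An orbit of a \<open>p\<close>-group with more than one point has cardinality divisible by \<open>p\<close>.\<close>
lemma (in group_action) p_dvd_card_nonfixed:
  assumes p: "prime p" and order: "order G = p ^ n" and E: "finite E"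
  shows "p dvd card {x \<in> E. \<not> carrier G \<subseteq> stabilizer G \<phi> x}"
proof -
  let ?nf = "\<lambda>x. of_bool (\<not> carrier G \<subseteq> stabilizer G \<phi> x) :: nat"
  have "p dvd (\<Sum>x\<in>C. ?nf x)" if C: "C \<in> orbits G E \<phi>" for C
  proof (cases "\<exists>x\<in>C. carrier G \<subseteq> stabilizer G \<phi> x")
    case True
    then obtain x where x: "x \<in> C" "carrier G \<subseteq> stabilizer G \<phi> x" by blast
    obtain w where w: "w \<in> E" "C = orbit G \<phi> w" using C by (auto simp: orbits_def)
    have xE: "x \<in> E" using x(1) w act_closed by (auto simp: orbit_def)
    have "w \<in> orbit G \<phi> x" using orbit_sym[OF w(1) xE] x(1) w(2) by simp
    then have "w = x" using x(2) by (auto simp: orbit_def stabilizer_def)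
    then have "C = {x}" using x(2) w orbit_refl[OF xE] by (auto simp: orbit_def stabilizer_def)
    then show ?thesis using x(2) by simp
  next
    case False
    then have sum: "(\<Sum>x\<in>C. ?nf x) = card C" by simp
    obtain w where w: "w \<in> E" "C = orbit G \<phi> w" using C by (auto simp: orbits_def)
    have wC: "w \<in> C" using w orbit_refl by simp
    have mult: "card C * card (stabilizer G \<phi> w) = p ^ n"
      using orbit_stabilizer_theorem[OF w(1)] order w(2) by simp
    then have "card C dvd p ^ n" by (metis dvd_triv_left)
    then obtain i where i: "card C = p ^ i" using divides_primepow_nat[OF p] by blast
    \<comment> \<open>A one-point orbit would be a fixed point.\<close>
    have "i \<noteq> 0"
    proof
      assume "i = 0"
      then have "C = {w}" using i wC by (metis card_1_singletonE power_0 singletonD)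
      then have "\<phi> g w = w" if "g \<in> carrier G" for g
        using that w(2) by (auto simp: orbit_def)
      then have "carrier G \<subseteq> stabilizer G \<phi> w" by (auto simp: stabilizer_def)
      with False wC show False by blast
    qed
    then show ?thesis unfolding sum i by (rule dvd_power[OF disjI1, OF neq0_conv[THEN iffD1]])
  qed
  then have "p dvd (\<Sum>C\<in>orbits G E \<phi>. \<Sum>x\<in>C. ?nf x)" by (rule dvd_sum)
  also have "(\<Sum>C\<in>orbits G E \<phi>. \<Sum>x\<in>C. ?nf x) = (\<Sum>x\<in>E. ?nf x)"
    by (rule disjoint_sum[OF E])
  also have "\<dots> = card {x \<in> E. \<not> carrier G \<subseteq> stabilizer G \<phi> x}"
    using E by (simp add: of_bool_def sum.If_cases Int_def)
  finally show ?thesis .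
qed

text \<open>The number of cosets in \<open>S/P\<close> fixed by \<open>Q\<close> is congruent to \<open>|S/P|\<close> modulo \<open>p\<close>; the left-hand side
  counts these cosets through \<open>stab_sum_lcosets\<close>.\<close>
lemma (in group) lcosets_fixed_points_mod_p:
  assumes p: "prime p" and order: "order G = p ^ n" and P: "subgroup P G" and Q: "subgroup Q G"
  obtains k :: nat where
    "(\<Sum>t\<in>carrier G. of_bool (Q \<subseteq> conj_set G t P)) / of_nat (card P)
      = (of_nat (order G) / of_nat (card P) - of_nat p * of_nat k :: rat)"
proof -
  have fin: "finite (carrier G)"
    using order prime_gt_0_nat[OF p] order_gt_0_iff_finite by simp
  have Psub: "P \<subseteq> carrier G" using P by (rule subgroup.subset)
  interpret group_action G "fst (lcosets_act G P)" "snd (lcosets_act G P)"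
    using Psub by (rule lcosets_action)
  let ?E = "fst (lcosets_act G P)" and ?St = "\<lambda>C. stabilizer G (snd (lcosets_act G P)) C"
  have finE: "finite ?E" using fin by (simp add: lcosets_act_carrier)
  interpret Q: group_action "G\<lparr>carrier := Q\<rparr>" ?E "snd (lcosets_act G P)"
    using Q by (rule induced_action)
  have "card Q dvd p ^ n"
    using lagrange[OF Q] order by (metis dvd_triv_right)
  then obtain i where "order (G\<lparr>carrier := Q\<rparr>) = p ^ i"
    using divides_primepow_nat[OF p] by (auto simp: order_def)
  from Q.p_dvd_card_nonfixed[OF p this finE]
  have "p dvd card {C \<in> ?E. \<not> Q \<subseteq> stabilizer (G\<lparr>carrier := Q\<rparr>) (snd (lcosets_act G P)) C}"
    by simp
  moreover have "Q \<subseteq> stabilizer (G\<lparr>carrier := Q\<rparr>) (snd (lcosets_act G P)) C \<longleftrightarrow> Q \<subseteq> ?St C" for C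
    using subgroup.subset[OF Q] by (auto simp: stabilizer_def)
  ultimately have "p dvd card {C \<in> ?E. \<not> Q \<subseteq> ?St C}" by simp
  then obtain k where k: "card {C \<in> ?E. \<not> Q \<subseteq> ?St C} = p * k" ..
  have sum_const: "(\<Sum>C\<in>?E. 1) = (of_nat (order G) / of_nat (card P) :: rat)"
    using stab_sum_lcosets[OF P fin, of "\<lambda>_. 1"] by (simp add: stab_sum_def order_def)
  have "(\<Sum>t\<in>carrier G. of_bool (Q \<subseteq> conj_set G t P)) / of_nat (card P) = (\<Sum>C\<in>?E. of_bool (Q \<subseteq> ?St C) :: rat)"
    using stab_sum_lcosets[OF P fin, of "\<lambda>M. of_bool (Q \<subseteq> M)"] by (simp add: stab_sum_def)
  also have "\<dots> = (\<Sum>C\<in>?E. 1) - (\<Sum>C\<in>?E. of_bool (\<not> Q \<subseteq> ?St C))"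
    unfolding sum_subtractf[symmetric] by (rule sum.cong[OF refl]) simp
  also have "(\<Sum>C\<in>?E. of_bool (\<not> Q \<subseteq> ?St C)) = (of_nat (card {C \<in> ?E. \<not> Q \<subseteq> ?St C}) :: rat)"
    using finE by (simp add: of_bool_def sum.If_cases Int_def)
  finally show thesis
    unfolding k sum_const by (intro that[of k]) simp
qed

section \<open>Marks of a characteristic idempotent\<close>

text \<open>When \<open>\<theta>\<close> is defined on all of \<open>K\<close>, conjugation by \<open>k\<close> before \<open>\<theta>\<close> is conjugation by \<open>\<theta> k\<close> after it,
  so all summands agree and composition is restriction of the left action along \<open>\<theta>\<close>.\<close>
lemma mark_comp_transitive_left_full:
  assumes p: "prime p" and G: "group G" and HK: "finite_groups H K"
    and x: "x \<in> carrier (free_bisets p G H)" and free: "supported_on G H (left_free G H) x"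
    and \<theta>: "\<theta> \<in> hom K H"
    and diag: "twisted_diagonal U \<phi> = pair_image (\<lambda>v. v) \<theta> (carrier K)"
    and Q: "Q \<subseteq> carrier G" and \<psi>: "\<And>q. q \<in> Q \<Longrightarrow> \<psi> q \<in> carrier K"
  shows "mark G K (twisted_diagonal Q \<psi>) (free_comp G H K (transitive_gen H K U \<phi>) x) =
    mark G H (twisted_diagonal Q (\<lambda>q. \<theta> (\<psi> q))) x"
proof -
  interpret G: group G by fact
  interpret finite_groups H K by fact
  interpret \<theta>: group_hom K H \<theta>
    using \<theta> by unfold_locales
  have \<theta>': "\<theta> \<in> hom (K\<lparr>carrier := carrier K\<rparr>) H"
    using \<theta> by (simp add: hom_def)
  have conj: "mark G H (twisted_diagonal Q (\<lambda>q. \<theta> (conj_by K (inv\<^bsub>K\<^esub> k) (\<psi> q)))) x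
      = mark G H (twisted_diagonal Q (\<lambda>q. \<theta> (\<psi> q))) x" if k: "k \<in> carrier K" for k
  proof -
    have "twisted_diagonal Q (\<lambda>q. \<theta> (conj_by K (inv\<^bsub>K\<^esub> k) (\<psi> q))) =
        pair_image (\<lambda>q. conj_by H (\<theta> (inv\<^bsub>K\<^esub> k)) (\<theta> (\<psi> q))) (\<lambda>q. q) Q"
      unfolding twisted_diagonal_def
      by (rule image_cong[OF refl]) (use k \<psi> in \<open>simp add: \<theta>.hom_conj_by\<close>)
    also have "mark G H \<dots> x = mark G H (pair_image (\<lambda>q. \<theta> (\<psi> q)) (\<lambda>q. q) Q) x"
      by (rule mark_conj_left[OF G.is_group dom.is_group x])
        (use Q k \<psi> \<theta>.hom_closed cod.inv_closed in blast)+
    finally show ?thesis by (simp only: twisted_diagonal_def)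
  qed
  have "card (carrier K) \<noteq> 0"
    using fin_cod cod.one_closed by auto
  have "mark G K (twisted_diagonal Q \<psi>) (free_comp G H K (transitive_gen H K U \<phi>) x) =
    (\<Sum>k\<in>carrier K. of_bool (\<forall>q\<in>Q. conj_by K (inv\<^bsub>K\<^esub> k) (\<psi> q) \<in> carrier K)
      * mark G H (twisted_diagonal Q (\<lambda>q. \<theta> (conj_by K (inv\<^bsub>K\<^esub> k) (\<psi> q)))) x) / of_nat (card (carrier K))"
    using p G HK x free cod.subgroup_self \<theta>' diag Q \<psi> by (rule mark_comp_transitive_left)
  also have "\<dots> = (\<Sum>k\<in>carrier K. mark G H (twisted_diagonal Q (\<lambda>q. \<theta> (\<psi> q))) x) / of_nat (card (carrier K))"
    using \<psi> by (simp add: conj)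
  also have "\<dots> = mark G H (twisted_diagonal Q (\<lambda>q. \<theta> (\<psi> q))) x"
    using \<open>card (carrier K) \<noteq> 0\<close> by simp
  finally show ?thesis .
qed

lemma transitive_elem_eq: "transitive_elem p A B U \<phi> = burnside_elem p A B (transitive_gen A B U \<phi>)"
  by (simp add: transitive_elem_def transitive_gen_def)

text \<open>A characteristic idempotent together with a representative \<open>x\<close> whose support consists of generators,
  so that statements about stabilizers can be checked on \<open>[P,\<phi>]\<close> with \<open>\<phi>\<close> in \<open>F\<close>.\<close>
locale characteristic_idempotent_rep = fusion_system G F for G (structure) and F +
  fixes p :: nat and x :: "('a, 'a) biset_class \<Rightarrow>\<^sub>0 rat"
  assumes p: "prime p"
    and order_p_power: "\<exists>n. order G = p ^ n"
    and x: "x \<in> carrier (free_bisets p G G)"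
    and generated: "Poly_Mapping.keys x \<subseteq>
      {iso_class G G (transitive_biset G G P \<phi>) | P \<phi>. subgroup P G \<and> \<phi> \<in> F P (carrier G)}"
    and right: "right_stable p G F (burnside_elem p G G x)"
    and left: "left_stable p G F (burnside_elem p G G x)"
    and unit: "\<exists>u\<in>localized_ints p. augmentation G (burnside_elem p G G x) * u = 1"
    and idempotent: "burnside_comp p G G G (burnside_elem p G G x) (burnside_elem p G G x) = burnside_elem p G G x"
begin

lemma finite_G: "finite (carrier G)"
  using order_p_power prime_gt_0_nat[OF p] order_gt_0_iff_finite by auto

sublocale finite_groups G G
  by unfold_locales (rule finite_G)+

lemma order_pos: "order G > 0"
  using finite_G order_gt_0_iff_finite by simp

lemma supported_on_generators:
  assumes "\<And>P \<phi> a. \<lbrakk>subgroup P G; \<phi> \<in> F P (carrier G); a \<in> carrier (G \<times>\<times> G)\<rbrakk>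
    \<Longrightarrow> N (conj_set (G \<times>\<times> G) a (twisted_diagonal P \<phi>))"
  shows "supported_on G G N x"
  unfolding supported_on_def
proof (intro allI impI)
  fix g :: "_ \<Rightarrow> rat" assume g: "\<forall>M. N M \<longrightarrow> g M = 0"
  have "stab_sum (G \<times>\<times> G) (biset_rep c) g = 0" if c: "c \<in> Poly_Mapping.keys x" for c
  proof -
    obtain P \<phi> where P\<phi>: "subgroup P G" "\<phi> \<in> F P (carrier G)" and c_eq: "c = iso_class G G (transitive_biset G G P \<phi>)"
      using generated c by blast
    note D = subgroup_twisted_diagonal[OF P\<phi>(1) morphism_hom[OF P\<phi>(1) subgroup_self P\<phi>(2)]]
    show ?thesis
      unfolding c_eq stab_sum_biset_rep[OF is_biset_transitive[OF subgroup.subset[OF D]]]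
        stab_sum_transitive_biset[OF D]
      using g assms[OF P\<phi>] by (simp del: carrier_DirProd)
  qed
  then show "burnside_sum G G x g = 0"
    by (simp add: burnside_sum_def)
qed

lemma left_free_x: "supported_on G G (left_free G G) x"
  by (rule supported_on_generators)
    (blast intro: left_free_conj_twisted_diagonal morphism_hom subgroup_self)

lemma mark_non_morphism:
  assumes Q: "subgroup Q G" and \<chi>: "\<chi> \<in> Q \<rightarrow>\<^sub>E carrier G" and nF: "\<chi> \<notin> F Q (carrier G)"
  shows "mark G G (twisted_diagonal Q \<chi>) x = 0"
proof -
  have "supported_on G G (\<lambda>M. \<not> twisted_diagonal Q \<chi> \<subseteq> M) x"
  proof (rule supported_on_generators)
    fix P \<phi> a assume P: "subgroup P G" and \<phi>: "\<phi> \<in> F P (carrier G)" and "a \<in> carrier (G \<times>\<times> G)"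
    then obtain s t where st: "a = (s, t)" "s \<in> carrier G" "t \<in> carrier G" by auto
    have ext: "\<chi> \<in> extensional Q" using \<chi> by (simp add: PiE_def)
    show "\<not> twisted_diagonal Q \<chi> \<subseteq> conj_set (G \<times>\<times> G) a (twisted_diagonal P \<phi>)"
      unfolding st(1) using morphism_conj_twist[OF P Q \<phi> st(2,3) ext] nF by blast
  qed
  from supported_on_cong[OF this, of "\<lambda>M. of_bool (twisted_diagonal Q \<chi> \<subseteq> M)" "\<lambda>M. 0"] show ?thesis
    by (simp add: mark_def burnside_sum_def stab_sum_def)
qed

lemma subgroup_finite_group:
  assumes P: "subgroup P G"
  shows "group (G\<lparr>carrier := P\<rparr>)" and "finite P"
  using subgroup_imp_group[OF P] finite_subset[OF subgroup.subset[OF P] finite_G] by simp_all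

text \<open>Right stability compared at \<open>\<Delta>(P,\<psi>)\<close>: by \<open>mark_comp_transitive_right\<close> the two composites have these
  two marks.\<close>
lemma mark_right_stable:
  assumes P: "subgroup P G" and \<phi>: "\<phi> \<in> F P (carrier G)"
    and \<psi>: "\<And>q. q \<in> P \<Longrightarrow> \<psi> q \<in> carrier G"
  shows "mark G G (pair_image \<psi> \<phi> P) x = mark G G (twisted_diagonal P \<psi>) x"
proof -
  let ?P = "G\<lparr>carrier := P\<rparr>"
  note P' = subgroup_finite_group[OF P]
  interpret PG: finite_groups ?P G
    by (intro finite_groups.intro finite_groups_axioms.intro P'(1) is_group) (simp_all add: P'(2) finite_G)
  have comp: "burnside_comp p ?P G G (burnside_elem p G G x) (transitive_elem p ?P G P \<theta>)
      = burnside_elem p ?P G (free_comp ?P G G x (transitive_gen ?P G P \<theta>))"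
    and mark: "mark ?P G (twisted_diagonal P \<psi>) (free_comp ?P G G x (transitive_gen ?P G P \<theta>))
      = mark G G (pair_image \<psi> \<theta> P) x"
    if \<theta>: "\<theta> \<in> hom ?P G" for \<theta>
  proof -
    have "subgroup (twisted_diagonal P \<theta>) (G \<times>\<times> ?P)"
      using PG.subgroup_twisted_diagonal[of P \<theta>] \<theta> subgroup_incl[OF P P] by simp
    then have gen: "transitive_gen ?P G P \<theta> \<in> carrier (free_bisets p ?P G)"
      using p subgroup.subset by (intro PG.transitive_gen_closed)
    show "burnside_comp p ?P G G (burnside_elem p G G x) (transitive_elem p ?P G P \<theta>)
      = burnside_elem p ?P G (free_comp ?P G G x (transitive_gen ?P G P \<theta>))"
      unfolding transitive_elem_eq
      using P' finite_G by (intro burnside_comp_burnside_elem p is_group x gen) simp_all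
    show "mark ?P G (twisted_diagonal P \<psi>) (free_comp ?P G G x (transitive_gen ?P G P \<theta>))
      = mark G G (pair_image \<psi> \<theta> P) x"
      using mark_comp_transitive_right[OF p PG.finite_groups_axioms is_group x \<theta>, of P \<psi>] \<psi> by simp
  qed
  have hom_\<phi>: "\<phi> \<in> hom ?P G"
    using morphism_hom[OF P subgroup_self \<phi>] .
  have hom_id: "id \<in> hom ?P G"
    using subgroup.subset[OF P] by (auto simp: hom_def)
  have "burnside_comp p ?P G G (burnside_elem p G G x) (transitive_elem p ?P G P \<phi>)
      = burnside_comp p ?P G G (burnside_elem p G G x) (transitive_elem p ?P G P id)"
    using right P \<phi> unfolding right_stable_def by blast
  then have "burnside_elem p ?P G (free_comp ?P G G x (transitive_gen ?P G P \<phi>))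
      = burnside_elem p ?P G (free_comp ?P G G x (transitive_gen ?P G P id))"
    unfolding comp[OF hom_\<phi>] comp[OF hom_id] .
  from burnside_sum_burnside_elem_cong[OF p this]
  have "mark G G (pair_image \<psi> \<phi> P) x = mark G G (pair_image \<psi> id P) x"
    unfolding mark[OF hom_\<phi>, symmetric] mark[OF hom_id, symmetric] by (simp add: mark_def)
  then show ?thesis
    by (simp add: twisted_diagonal_def)
qed

lemma mark_left_stable:
  assumes P: "subgroup P G" and \<phi>: "\<phi> \<in> F P (carrier G)"
    and Q: "Q \<subseteq> carrier G" and \<psi>: "\<And>q. q \<in> Q \<Longrightarrow> \<psi> q \<in> P"
  shows "mark G G (twisted_diagonal Q (\<lambda>q. \<phi> (\<psi> q))) x = mark G G (twisted_diagonal Q \<psi>) x"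
proof -
  let ?P = "G\<lparr>carrier := P\<rparr>"
  note P' = subgroup_finite_group[OF P]
  interpret GP: finite_groups G ?P
    by (intro finite_groups.intro finite_groups_axioms.intro P'(1) is_group) (simp_all add: P'(2) finite_G)
  have comp: "burnside_comp p G G ?P (transitive_elem p G ?P U \<rho>) (burnside_elem p G G x)
      = burnside_elem p G ?P (free_comp G G ?P (transitive_gen G ?P U \<rho>) x)"
    and mark: "mark G ?P (twisted_diagonal Q \<psi>) (free_comp G G ?P (transitive_gen G ?P U \<rho>) x)
      = mark G G (twisted_diagonal Q (\<lambda>q. \<theta> (\<psi> q))) x"
    if \<theta>: "\<theta> \<in> hom ?P G" and diag: "twisted_diagonal U \<rho> = pair_image (\<lambda>v. v) \<theta> P" for \<theta> U \<rho>
  proof -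
    have "subgroup (twisted_diagonal U \<rho>) (?P \<times>\<times> G)"
      using GP.subgroup_pair_image[OF P'(1) _ \<theta>, of "\<lambda>v. v"] diag by (simp add: hom_def)
    then have gen: "transitive_gen G ?P U \<rho> \<in> carrier (free_bisets p G ?P)"
      using p subgroup.subset by (intro GP.transitive_gen_closed)
    show "burnside_comp p G G ?P (transitive_elem p G ?P U \<rho>) (burnside_elem p G G x)
      = burnside_elem p G ?P (free_comp G G ?P (transitive_gen G ?P U \<rho>) x)"
      unfolding transitive_elem_eq
      using P' finite_G by (intro burnside_comp_burnside_elem p is_group x gen) simp_all
    show "mark G ?P (twisted_diagonal Q \<psi>) (free_comp G G ?P (transitive_gen G ?P U \<rho>) x)
      = mark G G (twisted_diagonal Q (\<lambda>q. \<theta> (\<psi> q))) x"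
      using mark_comp_transitive_left_full[OF p is_group GP.finite_groups_axioms x left_free_x \<theta>, of U \<rho> Q \<psi>]
        diag Q \<psi> by simp
  qed
  have hom_\<phi>: "\<phi> \<in> hom ?P G"
    using morphism_hom[OF P subgroup_self \<phi>] .
  have hom_id: "id \<in> hom ?P G"
    using subgroup.subset[OF P] by (auto simp: hom_def)
  have diag_\<phi>: "twisted_diagonal (\<phi> ` P) (inv_into P \<phi>) = pair_image (\<lambda>v. v) \<phi> P"
    using morphismD(2)[OF P subgroup_self \<phi>] by (force simp: twisted_diagonal_def image_image)
  have diag_id: "twisted_diagonal P id = pair_image (\<lambda>v. v) id P"
    by (simp add: twisted_diagonal_def)
  have "burnside_comp p G G ?P (transitive_elem p G ?P (\<phi> ` P) (inv_into P \<phi>)) (burnside_elem p G G x)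
      = burnside_comp p G G ?P (transitive_elem p G ?P P id) (burnside_elem p G G x)"
    using left P \<phi> unfolding left_stable_def by blast
  then have "burnside_elem p G ?P (free_comp G G ?P (transitive_gen G ?P (\<phi> ` P) (inv_into P \<phi>)) x)
      = burnside_elem p G ?P (free_comp G G ?P (transitive_gen G ?P P id) x)"
    unfolding comp[OF hom_\<phi> diag_\<phi>] comp[OF hom_id diag_id] .
  from burnside_sum_burnside_elem_cong[OF p this]
  have "mark G G (twisted_diagonal Q (\<lambda>q. \<phi> (\<psi> q))) x = mark G G (twisted_diagonal Q (\<lambda>q. id (\<psi> q))) x"
    unfolding mark[OF hom_\<phi> diag_\<phi>, symmetric] mark[OF hom_id diag_id, symmetric] by (simp add: mark_def)
  then show ?thesis by simp
qed

lemma mark_morphism: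
  assumes Q: "subgroup Q G" and \<chi>: "\<chi> \<in> F Q (carrier G)"
  shows "mark G G (twisted_diagonal Q \<chi>) x = mark G G (twisted_diagonal Q (\<lambda>q. q)) x"
  using mark_left_stable[OF Q \<chi> subgroup.subset[OF Q], of "\<lambda>q. q"] by simp

text \<open>Only morphisms contribute, and by left stability all with the mark of the inclusion.\<close>
lemma sum_marks_morphisms:
  assumes Q: "subgroup Q G"
  shows "(\<Sum>\<chi>\<in>Q \<rightarrow>\<^sub>E carrier G. w \<chi> * mark G G (twisted_diagonal Q \<chi>) x)
    = (\<Sum>\<chi>\<in>F Q (carrier G). w \<chi>) * mark G G (twisted_diagonal Q (\<lambda>q. q)) x"
proof -
  have "finite (Q \<rightarrow>\<^sub>E carrier G)"
    using finite_G subgroup_finite_group(2)[OF Q] by (intro finite_PiE) auto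
  then have "(\<Sum>\<chi>\<in>Q \<rightarrow>\<^sub>E carrier G. w \<chi> * mark G G (twisted_diagonal Q \<chi>) x)
    = (\<Sum>\<chi>\<in>F Q (carrier G). w \<chi> * mark G G (twisted_diagonal Q \<chi>) x)"
    using morphism_PiE[OF Q subgroup_self] mark_non_morphism[OF Q]
    by (intro sum.mono_neutral_right) auto
  also have "\<dots> = (\<Sum>\<chi>\<in>F Q (carrier G). w \<chi> * mark G G (twisted_diagonal Q (\<lambda>q. q)) x)"
    using mark_morphism[OF Q] by simp
  finally show ?thesis by (simp add: sum_distrib_right)
qed

text \<open>In the formula for the mark of \<open>x \<circ> x\<close> at the diagonal of \<open>Q\<close>, right stability evaluates the first
  factor and left stability the second, for each of the \<open>|F(Q,S)|\<close> maps that contribute.\<close>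
lemma mark_idempotent:
  assumes Q: "subgroup Q G"
  defines "m \<equiv> mark G G (twisted_diagonal Q (\<lambda>q. q)) x"
  shows "m * of_nat (order G) = of_nat (card (F Q (carrier G))) * m * m"
proof -
  have "burnside_elem p G G (free_comp G G G x x) = burnside_elem p G G x"
    using idempotent burnside_comp_burnside_elem[OF p is_group is_group is_group finite_G finite_G finite_G x x] by simp
  then have "m = mark G G (twisted_diagonal Q (\<lambda>q. q)) (free_comp G G G x x)"
    unfolding m_def mark_def using burnside_sum_burnside_elem_cong[OF p] by metis
  also have "\<dots> = (\<Sum>\<chi>\<in>Q \<rightarrow>\<^sub>E carrier G. mark G G (pair_image (\<lambda>q. q) \<chi> Q) x * mark G G (twisted_diagonal Q \<chi>) x)
      / of_nat (order G)"
    by (rule mark_free_comp[OF is_group is_group is_group finite_G x x left_free_x subgroup_finite_group(2)[OF Q]])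
  also have "\<dots> = (\<Sum>\<chi>\<in>F Q (carrier G). mark G G (pair_image (\<lambda>q. q) \<chi> Q) x) * m / of_nat (order G)"
    unfolding sum_marks_morphisms[OF Q] m_def ..
  also have "(\<Sum>\<chi>\<in>F Q (carrier G). mark G G (pair_image (\<lambda>q. q) \<chi> Q) x) = of_nat (card (F Q (carrier G))) * m"
    using mark_right_stable[OF Q, of _ "\<lambda>q. q"] subgroup.mem_carrier[OF Q] by (simp add: m_def)
  finally show ?thesis
    using order_pos by (simp add: field_simps)
qed

lemma augmentation_eq: "augmentation G (burnside_elem p G G x) = burnside_sum G G x (\<lambda>_. 1 / of_nat (order G))"
proof -
  have "(\<lambda>y. \<Sum>c\<in>Poly_Mapping.keys y. Poly_Mapping.lookup y c *
      (of_nat (card (fst (biset_rep c))) / of_nat (order G))) = (\<lambda>y. burnside_sum G G y (\<lambda>_. 1 / of_nat (order G)))"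
    by (simp add: burnside_sum_def stab_sum_def)
  moreover have "(\<lambda>y. burnside_sum G G y (\<lambda>_. 1 / of_nat (order G))) ` burnside_elem p G G x
      = {burnside_sum G G x (\<lambda>_. 1 / of_nat (order G))}"
  proof -
    have "burnside_sum G G y (\<lambda>_. 1 / of_nat (order G)) = burnside_sum G G x (\<lambda>_. 1 / of_nat (order G))"
      if "y \<in> burnside_elem p G G x" for y
      using burnside_elem_memD(2)[OF p that x] by (rule burnside_sum_burnside_elem_cong[OF p])
    then have "(\<lambda>y. burnside_sum G G y (\<lambda>_. 1 / of_nat (order G))) ` burnside_elem p G G x
        = (\<lambda>_. burnside_sum G G x (\<lambda>_. 1 / of_nat (order G))) ` burnside_elem p G G x"
      by (intro image_cong refl)
    then show ?thesis
      using image_constant[OF burnside_elem_self[OF p]] by metis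
  qed
  ultimately show ?thesis
    unfolding augmentation_def by (simp only: the_elem_eq)
qed

text \<open>The left-hand side counts the left \<open>S\<close>-orbits fixed by \<open>Q\<close>, since \<open>Q\<close> fixes the orbit of a point iff it
  lies in the right projection of the stabilizer. For \<open>[P,\<phi>]\<close> the orbit set is \<open>S/P\<close>, and its total
  number of points gives the augmentation.\<close>
lemma right_fixed_points_mod_p:
  assumes Q: "subgroup Q G"
  obtains z where "z \<in> localized_ints p"
    "burnside_sum G G x (\<lambda>M. of_bool (Q \<subseteq> snd ` M) / of_nat (order G))
      = augmentation G (burnside_elem p G G x) - of_nat p * z"
proof -
  let ?g = "\<lambda>M. of_bool (Q \<subseteq> snd ` M) / of_nat (order G) - 1 / of_nat (order G) :: rat"
  obtain n where n: "order G = p ^ n" using order_p_power by blast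
  have "\<exists>k::nat. stab_sum (G \<times>\<times> G) (biset_rep c) ?g = - (of_nat p * of_nat k)"
    if c: "c \<in> Poly_Mapping.keys x" for c
  proof -
    obtain P \<phi> where P\<phi>: "subgroup P G" "\<phi> \<in> F P (carrier G)" and c_eq: "c = iso_class G G (transitive_biset G G P \<phi>)"
      using generated c by blast
    note D = subgroup_twisted_diagonal[OF P\<phi>(1) morphism_hom[OF P\<phi>(1) subgroup_self P\<phi>(2)]]
    obtain k :: nat where k: "(\<Sum>t\<in>carrier G. of_bool (Q \<subseteq> conj_set G t P)) / of_nat (card P)
      = (of_nat (order G) / of_nat (card P) - of_nat p * of_nat k :: rat)"
      by (rule lcosets_fixed_points_mod_p[OF p n P\<phi>(1) Q])
    have snd_conj: "snd ` conj_set (G \<times>\<times> G) (s, t) (twisted_diagonal P \<phi>) = conj_set G t P"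
      if "s \<in> carrier G" "t \<in> carrier G" for s t
      by (simp add: twisted_diagonal_def image_image conj_by_DirProd[OF is_group is_group that])
    have "stab_sum (G \<times>\<times> G) (biset_rep c) ?g
        = (\<Sum>(s, t)\<in>carrier G \<times> carrier G. of_bool (Q \<subseteq> conj_set G t P) / of_nat (order G) - 1 / of_nat (order G))
          / of_nat (card P)"
      unfolding c_eq stab_sum_biset_rep[OF is_biset_transitive[OF subgroup.subset[OF D]]]
        stab_sum_transitive_biset[OF D] card_twisted_diagonal
      using snd_conj by (intro arg_cong2[where f = "(/)"] sum.cong refl) auto
    also have "\<dots> = (\<Sum>s\<in>carrier G. \<Sum>t\<in>carrier G. (of_bool (Q \<subseteq> conj_set G t P) - 1) / of_nat (order G)) / of_nat (card P)"
      by (simp only: sum.cartesian_product diff_divide_distrib)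
    also have "\<dots> = (\<Sum>t\<in>carrier G. of_bool (Q \<subseteq> conj_set G t P) - 1) / of_nat (card P)"
      using order_pos by (simp add: order_def flip: sum_divide_distrib)
    also have "\<dots> = - (of_nat p * of_nat k)"
      using k by (simp add: sum_subtractf diff_divide_distrib order_def)
    finally show ?thesis by blast
  qed
  then obtain k :: "_ \<Rightarrow> nat" where k: "\<And>c. c \<in> Poly_Mapping.keys x \<Longrightarrow>
      stab_sum (G \<times>\<times> G) (biset_rep c) ?g = - (of_nat p * of_nat (k c))"
    by metis
  define z where "z = (\<Sum>c\<in>Poly_Mapping.keys x. Poly_Mapping.lookup x c * of_nat (k c))"
  have "burnside_sum G G x ?g = - (of_nat p * z)"
    unfolding burnside_sum_def z_def by (simp add: k sum_distrib_left sum_negf mult_ac)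
  then have "burnside_sum G G x (\<lambda>M. of_bool (Q \<subseteq> snd ` M) / of_nat (order G))
      = augmentation G (burnside_elem p G G x) - of_nat p * z"
    by (simp add: burnside_sum_diff augmentation_eq)
  moreover have "z \<in> localized_ints p"
  proof -
    have "Poly_Mapping.lookup x c * of_nat (k c) \<in> localized_ints p" for c
      using localized_ints_mult[OF p _ localized_ints_of_int[OF p, of "int (k c)"]] x
      by (simp add: free_bisets_carrier_iff)
    then have "(\<Sum>c\<in>S. Poly_Mapping.lookup x c * of_nat (k c)) \<in> localized_ints p" for S
      by (induction S rule: infinite_finite_induct)
        (simp_all add: localized_ints_zero[OF p] localized_ints_add[OF p])
    then show ?thesis by (simp add: z_def)
  qed
  ultimately show thesis by (rule that[rotated])
qed

text \<open>Otherwise all marks at \<open>\<Delta>(Q,\<chi>)\<close> vanish, hence so does the number of orbits fixed by \<open>Q\<close>, and the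
  augmentation would be divisible by \<open>p\<close>.\<close>
lemma mark_diagonal_nonzero:
  assumes Q: "subgroup Q G"
  shows "mark G G (twisted_diagonal Q (\<lambda>q. q)) x \<noteq> 0"
proof
  assume zero: "mark G G (twisted_diagonal Q (\<lambda>q. q)) x = 0"
  note finQ = subgroup_finite_group(2)[OF Q]
  \<comment> \<open>Composing with the full relation on the left turns \<open>of_bool_relcomp\<close> into a count of the maps
    whose graph lies in \<open>M\<close>.\<close>
  have pointwise: "of_bool (Q \<subseteq> snd ` M) / of_nat (order G)
      = (\<Sum>\<chi>\<in>Q \<rightarrow>\<^sub>E carrier G. (1 / of_nat (order G)) * of_bool (twisted_diagonal Q \<chi> \<subseteq> M) :: rat)"
    if M: "left_free G G M" for M
  proof -
    have sub: "M \<subseteq> carrier G \<times> UNIV"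
      using M subgroup.subset[of M "G \<times>\<times> G"] by (auto simp: left_free_def)
    have "Q \<subseteq> snd ` M \<longleftrightarrow> twisted_diagonal Q (\<lambda>q. q) \<subseteq> UNIV O M"
      by (force simp: twisted_diagonal_def image_subset_iff)
    then have "(of_bool (Q \<subseteq> snd ` M) :: rat) = of_bool (twisted_diagonal Q (\<lambda>q. q) \<subseteq> UNIV O M)"
      by simp
    also have "\<dots> = (\<Sum>\<chi>\<in>Q \<rightarrow>\<^sub>E carrier G.
        of_bool (pair_image (\<lambda>q. q) \<chi> Q \<subseteq> UNIV) * of_bool (twisted_diagonal Q \<chi> \<subseteq> M))"
      using left_free_unique[OF is_group is_group M] by (intro of_bool_relcomp finQ finite_G sub)
    finally show ?thesis
      by (simp add: sum_divide_distrib)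
  qed
  have "burnside_sum G G x (\<lambda>M. of_bool (Q \<subseteq> snd ` M) / of_nat (order G))
      = (\<Sum>\<chi>\<in>Q \<rightarrow>\<^sub>E carrier G. (1 / of_nat (order G)) * mark G G (twisted_diagonal Q \<chi>) x)"
    unfolding mark_def burnside_sum_linear[symmetric]
    by (rule supported_on_cong[OF left_free_x pointwise])
  also have "\<dots> = 0"
    unfolding sum_marks_morphisms[OF Q] zero by simp
  finally have "burnside_sum G G x (\<lambda>M. of_bool (Q \<subseteq> snd ` M) / of_nat (order G)) = 0" .
  then obtain z where z: "z \<in> localized_ints p" "augmentation G (burnside_elem p G G x) = of_nat p * z"
    using right_fixed_points_mod_p[OF Q] by (metis eq_iff_diff_eq_0)
  obtain u where u: "u \<in> localized_ints p" "augmentation G (burnside_elem p G G x) * u = 1"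
    using unit by blast
  have "z * u \<in> localized_ints p"
    using z u by (intro localized_ints_mult p)
  then obtain a b where ab: "z * u = of_int a / of_int b" "\<not> int p dvd b"
    by (auto simp: localized_ints_def)
  have "b \<noteq> 0" using ab(2) by auto
  moreover have "of_nat p * (z * u) = 1"
    using u z by (simp add: mult_ac)
  ultimately have "of_int (int p * a) = (of_int b :: rat)"
    unfolding ab(1) by (simp add: field_simps)
  then have "int p * a = b" by (simp only: of_int_eq_iff)
  with ab(2) show False by auto
qed

lemma card_morphisms_pos:
  assumes "subgroup Q G"
  shows "card (F Q (carrier G)) > 0"
  using finite_morphisms[OF assms subgroup_self finite_G]
    inclusion_morphism[OF assms subgroup_self subgroup.subset[OF assms]] by (auto simp: card_gt_0_iff)

theorem mark_eq:
  assumes Q: "subgroup Q G" and \<chi>: "\<chi> \<in> Q \<rightarrow>\<^sub>E carrier G"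
  shows "mark G G (twisted_diagonal Q \<chi>) x =
    (if \<chi> \<in> F Q (carrier G) then of_nat (order G) / of_nat (card (F Q (carrier G))) else 0)"
proof (cases "\<chi> \<in> F Q (carrier G)")
  case True
  have "of_nat (order G) = of_nat (card (F Q (carrier G))) * mark G G (twisted_diagonal Q (\<lambda>q. q)) x"
    using mark_idempotent[OF Q] mark_diagonal_nonzero[OF Q] by simp
  then show ?thesis
    using True mark_morphism[OF Q True] card_morphisms_pos[OF Q] by simp
qed (use mark_non_morphism[OF Q \<chi>] in simp)

end

lemma characteristic_idempotent_rep_exists:
  assumes F: "saturated_fusion_system p G F" and \<omega>: "characteristic_idempotent p G F \<omega>"
  obtains x where "characteristic_idempotent_rep G F p x" "\<omega> = burnside_elem p G G x"
proof -
  interpret saturated_fusion_system p G F by fact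
  obtain x where x: "x \<in> carrier (free_bisets p G G)"
    "Poly_Mapping.keys x \<subseteq> {iso_class G G (transitive_biset G G P \<phi>) | P \<phi>. subgroup P G \<and> \<phi> \<in> F P (carrier G)}"
    "\<omega> = burnside_elem p G G x"
    using \<omega> unfolding characteristic_idempotent_def characteristic_def fusion_generated_def by blast
  have "characteristic_idempotent_rep G F p x"
  proof
    show "prime p" by (rule prime_p)
    show "\<exists>n. order G = p ^ n" by (rule order_p_power)
  qed (use \<omega> x in \<open>auto simp: characteristic_idempotent_def characteristic_def\<close>)
  then show thesis using x(3) by (rule that)
qed

section \<open>Counting factorisations through the intersection\<close>

context fusion_system
begin

lemma compose_PiE_eq:
  assumes "\<tau> \<in> extensional (\<chi> ` Q)" "\<tau>' \<in> extensional (\<chi> ` Q)" "compose Q \<tau> \<chi> = compose Q \<tau>' \<chi>"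
  shows "\<tau> = \<tau>'"
proof (rule extensionalityI[OF assms(1,2)])
  fix u assume "u \<in> \<chi> ` Q"
  then obtain q where "q \<in> Q" "u = \<chi> q" by blast
  then show "\<tau> u = \<tau>' u"
    using fun_cong[OF assms(3), of q] by (simp add: compose_def)
qed

lemma morphism_inverse_onto:
  assumes Q: "subgroup Q G" and Q': "subgroup Q' G" and \<chi>: "\<chi> \<in> F Q Q'"
  shows "(\<lambda>u\<in>\<chi> ` Q. inv_into Q \<chi> u) \<in> F (\<chi> ` Q) Q"
  using morphism_inverse[OF Q Q' \<chi>] by simp

lemma morphism_divide:
  assumes Q: "subgroup Q G" and Q': "subgroup Q' G" and \<chi>: "\<chi> \<in> F Q Q'"
    and U: "subgroup U G" and \<tau>: "\<tau> \<in> F Q U"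
  shows "(\<lambda>u\<in>\<chi> ` Q. \<tau> (inv_into Q \<chi> u)) \<in> F (\<chi> ` Q) U"
proof -
  have "compose (\<chi> ` Q) \<tau> (\<lambda>u\<in>\<chi> ` Q. inv_into Q \<chi> u) \<in> F (\<chi> ` Q) U"
    using morphism_compose[OF morphism_image_subgroup[OF Q Q' \<chi>] Q U morphism_inverse_onto[OF Q Q' \<chi>] \<tau>] .
  moreover have "compose (\<chi> ` Q) \<tau> (\<lambda>u\<in>\<chi> ` Q. inv_into Q \<chi> u) = (\<lambda>u\<in>\<chi> ` Q. \<tau> (inv_into Q \<chi> u))"
    by (auto simp: compose_def)
  ultimately show ?thesis by simp
qed

lemma card_morphisms_image:
  assumes Q: "subgroup Q G" and Q': "subgroup Q' G" and \<chi>: "\<chi> \<in> F Q Q'" and U: "subgroup U G"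
  shows "card (F (\<chi> ` Q) U) = card (F Q U)"
proof (rule bij_betw_same_card)
  note I = morphism_image_subgroup[OF Q Q' \<chi>] and inj = morphismD(2)[OF Q Q' \<chi>]
  show "bij_betw (\<lambda>\<tau>. compose Q \<tau> \<chi>) (F (\<chi> ` Q) U) (F Q U)"
    unfolding bij_betw_def
  proof (intro conjI inj_onI equalityI subsetI)
    fix \<tau> \<tau>' assume \<tau>: "\<tau> \<in> F (\<chi> ` Q) U" "\<tau>' \<in> F (\<chi> ` Q) U" "compose Q \<tau> \<chi> = compose Q \<tau>' \<chi>"
    show "\<tau> = \<tau>'"
      using morphismD(3)[OF I U \<tau>(1)] morphismD(3)[OF I U \<tau>(2)] \<tau>(3) by (rule compose_PiE_eq)
  next
    fix \<rho> assume "\<rho> \<in> (\<lambda>\<tau>. compose Q \<tau> \<chi>) ` F (\<chi> ` Q) U"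
    then obtain \<tau> where \<tau>: "\<tau> \<in> F (\<chi> ` Q) U" "\<rho> = compose Q \<tau> \<chi>" by blast
    show "\<rho> \<in> F Q U"
      unfolding \<tau>(2) using morphism_compose[OF Q I U morphism_onto_image[OF Q Q' \<chi>] \<tau>(1)] .
  next
    fix \<rho> assume \<rho>: "\<rho> \<in> F Q U"
    have "\<rho> = compose Q (\<lambda>u\<in>\<chi> ` Q. \<rho> (inv_into Q \<chi> u)) \<chi>"
      by (rule extensionalityI[OF morphismD(3)[OF Q U \<rho>]]) (use inj in \<open>simp_all add: compose_def\<close>)
    then show "\<rho> \<in> (\<lambda>\<tau>. compose Q \<tau> \<chi>) ` F (\<chi> ` Q) U"
      using morphism_divide[OF Q Q' \<chi> U \<rho>] by (rule image_eqI)
  qed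
qed

lemma morphisms_trivial: "subgroup U G \<Longrightarrow> F {\<one>} U = {\<lambda>u\<in>{\<one>}. \<one>}"
proof -
  assume U: "subgroup U G"
  note triv = triv_subgroup
  have "(\<lambda>u\<in>{\<one>}. u) = (\<lambda>u\<in>{\<one>}. \<one>)"
    by (rule restrict_ext) simp
  then have "(\<lambda>u\<in>{\<one>}. \<one>) \<in> F {\<one>} U"
    using inclusion_morphism[OF triv U] subgroup.one_closed[OF U] by simp
  moreover have "\<phi> = (\<lambda>u\<in>{\<one>}. \<one>)" if \<phi>: "\<phi> \<in> F {\<one>} U" for \<phi>
  proof (rule extensionalityI[OF morphismD(3)[OF triv U \<phi>]])
    interpret group_hom "G\<lparr>carrier := {\<one>}\<rparr>" G \<phi>
      using subgroup_imp_group[OF triv] is_group morphism_hom[OF triv U \<phi>]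
      by (intro group_hom.intro group_hom_axioms.intro)
    show "\<phi> u = (\<lambda>u\<in>{\<one>}. \<one>) u" if "u \<in> {\<one>}" for u
      using hom_one that by simp
  qed simp
  ultimately show ?thesis by blast
qed

end

text \<open>Each element \<open>r t\<close> of the product set is obtained from exactly the pairs \<open>(r d, d\<inverse> t)\<close> with \<open>d\<close> in the
  intersection.\<close>
lemma (in group) card_set_mult:
  assumes R: "subgroup R G" and T: "subgroup T G" and fin: "finite (carrier G)"
  shows "card (R <#> T) * card (R \<inter> T) = card R * card T"
proof -
  have Rc: "r \<in> R \<Longrightarrow> r \<in> carrier G" and Tc: "t \<in> T \<Longrightarrow> t \<in> carrier G" for r t
    using subgroup.mem_carrier[OF R] subgroup.mem_carrier[OF T] by auto
  let ?f = "\<lambda>z. fst z \<otimes> snd z"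
  have finRT: "finite (R \<times> T)"
    using finite_subset[OF subgroup.subset[OF R] fin] finite_subset[OF subgroup.subset[OF T] fin] by simp
  have img: "R <#> T = ?f ` (R \<times> T)"
    by (force simp: set_mult_def)
  have fibre: "card {z \<in> R \<times> T. ?f z = s} = card (R \<inter> T)" if s: "s \<in> ?f ` (R \<times> T)" for s
  proof -
    obtain r t where rt: "r \<in> R" "t \<in> T" "s = r \<otimes> t" using s by auto
    let ?g = "\<lambda>d. (r \<otimes> d, inv d \<otimes> t)"
    have "{z \<in> R \<times> T. ?f z = s} = ?g ` (R \<inter> T)"
    proof (intro equalityI subsetI)
      fix z assume "z \<in> {z \<in> R \<times> T. ?f z = s}"
      then obtain a b where ab: "z = (a, b)" "a \<in> R" "b \<in> T" "a \<otimes> b = r \<otimes> t"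
        using rt(3) by (cases z) auto
      have eq: "inv r \<otimes> a = t \<otimes> inv b"
      proof -
        have "inv r \<otimes> (a \<otimes> b) \<otimes> inv b = inv r \<otimes> (r \<otimes> t) \<otimes> inv b" using ab(4) by simp
        moreover have "inv r \<otimes> (a \<otimes> b) \<otimes> inv b = inv r \<otimes> a \<otimes> (b \<otimes> inv b)"
          using ab(2,3) rt(1,2) by (simp only: m_assoc m_closed inv_closed Rc Tc)
        moreover have "inv r \<otimes> (r \<otimes> t) \<otimes> inv b = (inv r \<otimes> r) \<otimes> t \<otimes> inv b"
          using ab(2,3) rt(1,2) by (simp only: m_assoc m_closed inv_closed Rc Tc)
        ultimately show ?thesis using ab rt by (simp add: Rc Tc)
      qed
      let ?d = "inv r \<otimes> a"
      have "?d \<in> R" using R ab(2) rt(1) by (simp add: subgroup.m_closed subgroup.m_inv_closed)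
      moreover have "?d \<in> T"
        unfolding eq using T ab(3) rt(2) by (simp add: subgroup.m_closed subgroup.m_inv_closed)
      moreover have "r \<otimes> ?d = a"
        using ab rt by (simp add: m_assoc[symmetric] Rc)
      moreover have "inv ?d \<otimes> t = b"
        unfolding eq using ab rt by (simp add: inv_mult_group m_assoc Rc Tc)
      ultimately show "z \<in> ?g ` (R \<inter> T)"
        using ab(1) by (intro image_eqI[where x = ?d]) auto
    next
      fix z assume "z \<in> ?g ` (R \<inter> T)"
      then obtain d where d: "d \<in> R" "d \<in> T" "z = (r \<otimes> d, inv d \<otimes> t)" by auto
      have "r \<otimes> d \<otimes> (inv d \<otimes> t) = r \<otimes> (d \<otimes> inv d) \<otimes> t"
        using rt d by (simp only: m_assoc m_closed inv_closed Rc Tc)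
      then have "r \<otimes> d \<otimes> (inv d \<otimes> t) = s"
        using rt d by (simp add: Rc Tc)
      then show "z \<in> {z \<in> R \<times> T. ?f z = s}"
        using d rt R T by (simp add: subgroup.m_closed subgroup.m_inv_closed)
    qed
    moreover have "inj_on ?g (R \<inter> T)"
      using rt by (auto simp: inj_on_def Rc)
    ultimately show ?thesis by (simp add: card_image)
  qed
  have "card R * card T = (\<Sum>z\<in>R \<times> T. 1)" by (simp add: card_cartesian_product)
  also have "\<dots> = (\<Sum>s\<in>?f ` (R \<times> T). \<Sum>z\<in>{z \<in> R \<times> T. ?f z = s}. 1)"
    by (rule sum.image_gen[OF finRT])
  also have "\<dots> = card (R <#> T) * card (R \<inter> T)"
    using fibre by (simp add: img)
  finally show ?thesis by simp
qed

locale fusion_subsystem_pair = fusion_system G F for G (structure) and F +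
  fixes R H T K
  assumes fin: "finite (carrier G)"
    and H_sub: "fusion_subsystem G F R H" and K_sub: "fusion_subsystem G F T K"
begin

abbreviation "GR \<equiv> G\<lparr>carrier := R\<rparr>"
abbreviation "GT \<equiv> G\<lparr>carrier := T\<rparr>"

lemma R: "subgroup R G" and T: "subgroup T G"
  using H_sub K_sub by (simp_all add: fusion_subsystem_def)

sublocale H: fusion_system GR H
  using H_sub by (simp add: fusion_subsystem_def)

sublocale K: fusion_system GT K
  using K_sub by (simp add: fusion_subsystem_def)

lemma subgroup_GR: "subgroup P GR \<longleftrightarrow> subgroup P G \<and> P \<subseteq> R"
  using incl_subgroup[OF R] subgroup_incl[OF _ R] subgroup.subset[of P GR] by auto

lemma subgroup_GT: "subgroup P GT \<longleftrightarrow> subgroup P G \<and> P \<subseteq> T"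
  using incl_subgroup[OF T] subgroup_incl[OF _ T] subgroup.subset[of P GT] by auto

lemma RT: "subgroup (R \<inter> T) G"
  using R T by (rule subgroups_Inter_pair)

lemma subgroup_RT: "subgroup P (G\<lparr>carrier := R \<inter> T\<rparr>) \<longleftrightarrow> subgroup P G \<and> P \<subseteq> R \<and> P \<subseteq> T"
  using incl_subgroup[OF RT] subgroup_incl[OF _ RT] subgroup.subset[of P "G\<lparr>carrier := R \<inter> T\<rparr>"] by auto

lemma H_le_F: "\<lbrakk>subgroup P G; P \<subseteq> R; subgroup Q G; Q \<subseteq> R; \<phi> \<in> H P Q\<rbrakk> \<Longrightarrow> \<phi> \<in> F P Q"
  using H_sub subgroup_GR unfolding fusion_subsystem_def by blast

lemma K_le_F: "\<lbrakk>subgroup P G; P \<subseteq> T; subgroup Q G; Q \<subseteq> T; \<phi> \<in> K P Q\<rbrakk> \<Longrightarrow> \<phi> \<in> F P Q"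
  using K_sub subgroup_GT unfolding fusion_subsystem_def by blast

text \<open>The map \<open>\<psi> \<chi>\<inverse>\<close> on the image of \<open>\<chi>\<close>.\<close>
definition divide :: "'a set \<Rightarrow> ('a \<Rightarrow> 'a) \<Rightarrow> ('a \<Rightarrow> 'a) \<Rightarrow> 'a \<Rightarrow> 'a" where
  "divide Q \<psi> \<chi> = (\<lambda>u\<in>\<chi> ` Q. \<psi> (inv_into Q \<chi> u))"

lemma divide_compose:
  assumes "inj_on \<chi> Q" "\<psi> \<in> extensional Q"
  shows "compose Q (divide Q \<psi> \<chi>) \<chi> = \<psi>"
  by (rule extensionalityI[of _ Q]) (use assms in \<open>simp_all add: compose_def divide_def\<close>)

text \<open>The sum, over the factorisations of \<open>\<psi>\<close> into a \<open>K\<close>-morphism to \<open>R \<inter> T\<close> followed by an \<open>H\<close>-morphism to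
  \<open>R\<close>, that occurs in the marks of the right-hand composite.\<close>
definition factor_sum :: "'a set \<Rightarrow> ('a \<Rightarrow> 'a) \<Rightarrow> rat" where
  "factor_sum Q \<psi> = (\<Sum>\<chi>\<in>K Q (R \<inter> T). if divide Q \<psi> \<chi> \<in> H (\<chi> ` Q) R then 1 / of_nat (card (H (\<chi> ` Q) R)) else 0)"

lemma K_into_RT:
  assumes Q: "subgroup Q G" "Q \<subseteq> T" and \<chi>: "\<chi> \<in> K Q (R \<inter> T)"
  shows "inj_on \<chi> Q" "\<chi> \<in> extensional Q" "subgroup (\<chi> ` Q) G" "\<chi> ` Q \<subseteq> R" "\<chi> ` Q \<subseteq> T"
    "\<chi> \<in> K Q (\<chi> ` Q)"
proof -
  have 1: "subgroup Q GT" "subgroup (R \<inter> T) GT"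
    using Q RT by (simp_all add: subgroup_GT)
  show "inj_on \<chi> Q" "\<chi> \<in> extensional Q" "\<chi> ` Q \<subseteq> R" "\<chi> ` Q \<subseteq> T"
    using K.morphismD[OF 1 \<chi>] by auto
  show "subgroup (\<chi> ` Q) G"
    using K.morphism_image_subgroup[OF 1 \<chi>] by (simp add: subgroup_GT)
  show "\<chi> \<in> K Q (\<chi> ` Q)"
    using K.morphism_onto_image[OF 1 \<chi>] .
qed

lemma factor_sum_eq_0:
  assumes Q: "subgroup Q G" "Q \<subseteq> T" and \<psi>: "\<psi> \<in> extensional Q" and nF: "\<psi> \<notin> F Q R"
  shows "factor_sum Q \<psi> = 0"
  unfolding factor_sum_def
proof (rule sum.neutral, rule ballI)
  fix \<chi> assume \<chi>: "\<chi> \<in> K Q (R \<inter> T)"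
  note \<chi>' = K_into_RT[OF Q \<chi>]
  have "divide Q \<psi> \<chi> \<notin> H (\<chi> ` Q) R"
  proof
    assume "divide Q \<psi> \<chi> \<in> H (\<chi> ` Q) R"
    then have "divide Q \<psi> \<chi> \<in> F (\<chi> ` Q) R"
      by (rule H_le_F[OF \<chi>'(3,4) R order_refl])
    moreover have "\<chi> \<in> F Q (\<chi> ` Q)"
      using K_le_F[OF Q \<chi>'(3,5,6)] .
    ultimately have "compose Q (divide Q \<psi> \<chi>) \<chi> \<in> F Q R"
      by (intro morphism_compose[OF Q(1) \<chi>'(3) R])
    with nF show False by (simp add: divide_compose[OF \<chi>'(1) \<psi>])
  qed
  then show "(if divide Q \<psi> \<chi> \<in> H (\<chi> ` Q) R then 1 / of_nat (card (H (\<chi> ` Q) R)) else 0) = (0 :: rat)"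
    by simp
qed

text \<open>Given one factorisation \<open>\<sigma> \<rho>\<close>, the map \<open>\<tau> \<mapsto> \<tau> \<rho>\<close> is a bijection from the morphisms
  \<open>\<rho> Q \<rightarrow> R \<inter> T\<close> of \<open>H \<inter> K\<close> to the first factors \<open>\<chi>\<close> of all factorisations. The summand does not depend on
  \<open>\<tau>\<close>, because \<open>\<chi> Q\<close> and \<open>\<rho> Q\<close> are \<open>H\<close>-conjugate.\<close>
lemma factor_sum_factorised:
  assumes Q: "subgroup Q G" "Q \<subseteq> T" and \<rho>: "\<rho> \<in> K Q (R \<inter> T)" and \<sigma>: "\<sigma> \<in> H (\<rho> ` Q) R"
  shows "factor_sum Q (compose Q \<sigma> \<rho>)
    = of_nat (card (fusion_inter H K (\<rho> ` Q) (R \<inter> T))) / of_nat (card (H (\<rho> ` Q) R))"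
proof -
  define \<psi> where "\<psi> = compose Q \<sigma> \<rho>"
  define Q1 where "Q1 = \<rho> ` Q"
  note \<rho>' = K_into_RT[OF Q \<rho>, folded Q1_def] and \<sigma>1 = \<sigma>[folded Q1_def]
  have Q1: "subgroup Q1 GR" "subgroup Q1 GT" and RR: "subgroup R GR" "subgroup (R \<inter> T) GR"
    and QT: "subgroup Q GT" "subgroup (R \<inter> T) GT"
    using \<rho>' R RT Q by (simp_all add: subgroup_GR subgroup_GT)
  have \<psi>_eq: "\<psi> q = \<sigma> (\<rho> q)" if "q \<in> Q" for q
    using that by (simp add: \<psi>_def compose_def)
  let ?X = "{\<chi> \<in> K Q (R \<inter> T). divide Q \<psi> \<chi> \<in> H (\<chi> ` Q) R}"
  let ?Y = "fusion_inter H K Q1 (R \<inter> T)"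
  have Y: "\<tau> \<in> ?Y \<longleftrightarrow> \<tau> \<in> H Q1 (R \<inter> T) \<and> \<tau> \<in> K Q1 (R \<inter> T)" for \<tau>
    by (simp add: fusion_inter_def)
  have img: "compose Q \<tau> \<rho> ` Q = \<tau> ` Q1" for \<tau>
    by (simp add: Q1_def compose_def image_image cong: image_cong_simp)
  have to_X: "compose Q \<tau> \<rho> \<in> ?X" if \<tau>: "\<tau> \<in> ?Y" for \<tau>
  proof -
    have \<tau>H: "\<tau> \<in> H Q1 (R \<inter> T)" and \<tau>K: "\<tau> \<in> K Q1 (R \<inter> T)" using \<tau> Y by auto
    have \<chi>: "compose Q \<tau> \<rho> \<in> K Q (R \<inter> T)"
      using K.morphism_compose[OF QT(1) Q1(2) QT(2) \<rho>'(6) \<tau>K] .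
    note \<chi>' = K_into_RT[OF Q \<chi>] and inj\<tau> = H.morphismD(2)[OF Q1(1) RR(2) \<tau>H]
    have "divide Q \<psi> (compose Q \<tau> \<rho>) = (\<lambda>u\<in>\<tau> ` Q1. \<sigma> (inv_into Q1 \<tau> u))"
    proof (rule extensionalityI[of _ "\<tau> ` Q1"])
      fix u assume "u \<in> \<tau> ` Q1"
      then obtain q where q: "q \<in> Q" "u = \<tau> (\<rho> q)" by (auto simp: Q1_def)
      have "u = compose Q \<tau> \<rho> q" using q by (simp add: compose_def)
      then have "divide Q \<psi> (compose Q \<tau> \<rho>) u = \<psi> q"
        using q \<chi>'(1) by (simp add: divide_def)
      moreover have "inv_into Q1 \<tau> u = \<rho> q"
        using q inj\<tau> by (simp add: Q1_def)
      ultimately show "divide Q \<psi> (compose Q \<tau> \<rho>) u = (\<lambda>u\<in>\<tau> ` Q1. \<sigma> (inv_into Q1 \<tau> u)) u"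
        using q \<psi>_eq \<open>u \<in> \<tau> ` Q1\<close> by simp
    qed (simp_all add: divide_def img)
    then have "divide Q \<psi> (compose Q \<tau> \<rho>) \<in> H (compose Q \<tau> \<rho> ` Q) R"
      using H.morphism_divide[OF Q1(1) RR(2) \<tau>H RR(1) \<sigma>1] by (simp add: img)
    with \<chi> show ?thesis by simp
  qed
  have from_X: "\<chi> \<in> (\<lambda>\<tau>. compose Q \<tau> \<rho>) ` ?Y" if "\<chi> \<in> ?X" for \<chi>
  proof -
    have \<chi>: "\<chi> \<in> K Q (R \<inter> T)" and d: "divide Q \<psi> \<chi> \<in> H (\<chi> ` Q) R" using that by auto
    note \<chi>' = K_into_RT[OF Q \<chi>]
    have \<chi>Q: "subgroup (\<chi> ` Q) GR" using \<chi>' by (simp add: subgroup_GR)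
    let ?\<tau> = "divide Q \<chi> \<rho>"
    \<comment> \<open>As \<open>\<tau> = \<chi> \<rho>\<inverse> = (\<psi> \<chi>\<inverse>)\<inverse> \<sigma>\<close> on \<open>\<rho> Q\<close>, it is a morphism of both \<open>K\<close> and \<open>H\<close>.\<close>
    have \<tau>K: "?\<tau> \<in> K Q1 (R \<inter> T)"
      unfolding divide_def Q1_def using K.morphism_divide[OF QT \<rho> QT(2) \<chi>] .
    have dom: "divide Q \<psi> \<chi> ` (\<chi> ` Q) = \<sigma> ` Q1"
      using \<chi>'(1) \<psi>_eq by (simp add: divide_def image_image Q1_def)
    let ?\<delta> = "divide Q \<psi> \<chi>"
    have inv_\<delta>: "(\<lambda>u\<in>\<sigma> ` Q1. inv_into (\<chi> ` Q) ?\<delta> u) \<in> H (\<sigma> ` Q1) (\<chi> ` Q)"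
      using H.morphism_inverse_onto[OF \<chi>Q RR(1) d] by (simp add: dom)
    have \<sigma>onto: "\<sigma> \<in> H Q1 (\<sigma> ` Q1)"
      using H.morphism_onto_image[OF Q1(1) RR(1) \<sigma>1] .
    have \<sigma>Q1: "subgroup (\<sigma> ` Q1) GR"
      using H.morphism_image_subgroup[OF Q1(1) RR(1) \<sigma>1] .
    have "compose Q1 (\<lambda>u\<in>\<sigma> ` Q1. inv_into (\<chi> ` Q) ?\<delta> u) \<sigma> \<in> H Q1 (\<chi> ` Q)"
      using H.morphism_compose[OF Q1(1) \<sigma>Q1 \<chi>Q \<sigma>onto inv_\<delta>] .
    moreover have "compose Q1 (\<lambda>u\<in>\<sigma> ` Q1. inv_into (\<chi> ` Q) ?\<delta> u) \<sigma> = ?\<tau>"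
    proof (rule extensionalityI[of _ Q1])
      fix v assume v: "v \<in> Q1"
      then obtain q where q: "q \<in> Q" "v = \<rho> q" by (auto simp: Q1_def)
      have "?\<delta> (\<chi> q) = \<sigma> v"
        using q \<chi>'(1) \<psi>_eq by (simp add: divide_def)
      then have "inv_into (\<chi> ` Q) ?\<delta> (\<sigma> v) = \<chi> q"
        using H.morphismD(2)[OF \<chi>Q RR(1) d] q by (metis imageI inv_into_f_f)
      moreover have "?\<tau> v = \<chi> q"
        using q \<rho>'(1) by (simp add: divide_def)
      ultimately show "compose Q1 (\<lambda>u\<in>\<sigma> ` Q1. inv_into (\<chi> ` Q) ?\<delta> u) \<sigma> v = ?\<tau> v"
        using v by (simp add: compose_def)
    qed (simp_all add: compose_def divide_def Q1_def)
    ultimately have \<tau>H': "?\<tau> \<in> H Q1 (\<chi> ` Q)" by simp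
    have "?\<tau> ` Q1 \<subseteq> R \<inter> T"
      using H.morphismD(4)[OF Q1(1) \<chi>Q \<tau>H'] \<chi>'(4,5) by blast
    then have "?\<tau> \<in> H Q1 (R \<inter> T)"
      using H.morphism_codomain[OF Q1(1) \<chi>Q \<tau>H' RR(2)] by blast
    then have "?\<tau> \<in> ?Y" using \<tau>K Y by blast
    moreover have "\<chi> = compose Q ?\<tau> \<rho>"
      using divide_compose[OF \<rho>'(1) \<chi>'(2)] by simp
    ultimately show ?thesis by (intro image_eqI)
  qed
  have inj: "inj_on (\<lambda>\<tau>. compose Q \<tau> \<rho>) ?Y"
  proof (rule inj_onI)
    fix \<tau> \<tau>' assume \<tau>: "\<tau> \<in> ?Y" "\<tau>' \<in> ?Y" and eq: "compose Q \<tau> \<rho> = compose Q \<tau>' \<rho>"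
    have "\<tau> \<in> extensional (\<rho> ` Q)" "\<tau>' \<in> extensional (\<rho> ` Q)"
      using \<tau> Y H.morphismD(3)[OF Q1(1) RR(2), of \<tau>] H.morphismD(3)[OF Q1(1) RR(2), of \<tau>']
      by (simp_all add: Q1_def)
    then show "\<tau> = \<tau>'" using eq by (rule compose_PiE_eq)
  qed
  have X_img: "?X = (\<lambda>\<tau>. compose Q \<tau> \<rho>) ` ?Y"
    using to_X from_X by blast
  have finK: "finite (K Q (R \<inter> T))"
    using K.finite_morphisms[OF QT] finite_subset[OF subgroup.subset[OF T] fin] by simp
  have "factor_sum Q \<psi> = (\<Sum>\<chi>\<in>?X. 1 / of_nat (card (H (\<chi> ` Q) R)))"
    unfolding factor_sum_def using finK by (simp add: sum.inter_filter)
  also have "\<dots> = (\<Sum>\<tau>\<in>?Y. 1 / of_nat (card (H (compose Q \<tau> \<rho> ` Q) R)))"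
    unfolding X_img by (simp add: sum.reindex[OF inj])
  also have "\<dots> = (\<Sum>\<tau>\<in>?Y. 1 / of_nat (card (H Q1 R)))"
    using H.card_morphisms_image[OF Q1(1) RR(2) _ RR(1)] Y by (intro sum.cong refl) (simp add: img)
  finally show ?thesis
    by (simp add: \<psi>_def Q1_def)
qed

lemma factorisation_exists:
  assumes Q: "subgroup Q G" "Q \<subseteq> T" and nz: "factor_sum Q \<psi> \<noteq> 0"
  obtains \<rho> where "\<rho> \<in> K Q (R \<inter> T)" "divide Q \<psi> \<rho> \<in> H (\<rho> ` Q) R"
proof -
  have "\<exists>\<rho>\<in>K Q (R \<inter> T). divide Q \<psi> \<rho> \<in> H (\<rho> ` Q) R"
  proof (rule ccontr)
    assume "\<not> ?thesis"
    then have "factor_sum Q \<psi> = 0"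
      unfolding factor_sum_def by (intro sum.neutral) auto
    with nz show False by simp
  qed
  then show thesis using that by blast
qed

text \<open>The equation for the trivial subgroup reads \<open>|S| = |R||T|/|R \<inter> T|\<close>, which is \<open>S = RT\<close>; for the
  inclusion of \<open>Q \<le> R \<inter> T\<close> it is the counting formula; for \<open>\<psi> \<in> F(Q,R)\<close> its left side is nonzero, so some
  factorisation exists. In the converse direction a factorisation of \<open>\<psi>\<close> moves the equation from \<open>Q\<close>
  to the subgroup \<open>\<rho> Q\<close> of \<open>R \<inter> T\<close>, where it is the counting formula.\<close>
theorem factor_sum_iff:
  "(\<forall>Q. subgroup Q GT \<longrightarrow> (\<forall>\<psi>\<in>Q \<rightarrow>\<^sub>E R.
      (if \<psi> \<in> F Q (carrier G) then of_nat (order G) / of_nat (card (F Q (carrier G))) else 0)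
        = of_nat (card R) * of_nat (card T) / (of_nat (card (R \<inter> T)) * of_nat (card (K Q T))) * factor_sum Q \<psi>))
   \<longleftrightarrow> weak_composition_product G F R H T K \<and>
     (\<forall>Q. subgroup Q (G\<lparr>carrier := R \<inter> T\<rparr>) \<longrightarrow>
        real (card (F Q (carrier G))) =
          real (card (H Q R)) * real (card (K Q T)) / real (card (fusion_inter H K Q (R \<inter> T))))"
  (is "?marks \<longleftrightarrow> ?weak \<and> ?count")
proof -
  have S: "subgroup (carrier G) G" by (rule subgroup_self)
  have finR: "finite R" and finT: "finite T"
    using finite_subset[OF subgroup.subset[OF R] fin] finite_subset[OF subgroup.subset[OF T] fin] .
  have posRT: "card (R \<inter> T) > 0" and posS: "order G > 0"
    using subgroup.one_closed[OF R] subgroup.one_closed[OF T] finR order_gt_0_iff_finite fin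
    by (auto simp: card_gt_0_iff)
  have posF: "card (F Q (carrier G)) > 0" if "subgroup Q G" for Q
    using finite_morphisms[OF that S fin] inclusion_morphism[OF that S subgroup.subset[OF that]]
    by (auto simp: card_gt_0_iff)
  have posH: "card (H Q R) > 0" if "subgroup Q G" "Q \<subseteq> R" for Q
    using H.finite_morphisms[of Q R] H.inclusion_morphism[of Q R] that R finR
    by (auto simp: card_gt_0_iff subgroup_GR)
  have posK: "card (K Q T) > 0" if "subgroup Q G" "Q \<subseteq> T" for Q
    using K.finite_morphisms[of Q T] K.inclusion_morphism[of Q T] that T finT
    by (auto simp: card_gt_0_iff subgroup_GT)
  have incl: "(\<lambda>u\<in>Q. u) \<in> H Q (R \<inter> T)" "(\<lambda>u\<in>Q. u) \<in> K Q (R \<inter> T)" "(\<lambda>u\<in>Q. u) \<in> H Q R"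
    if "subgroup Q G" "Q \<subseteq> R" "Q \<subseteq> T" for Q
    using that H.inclusion_morphism[of Q "R \<inter> T"] K.inclusion_morphism[of Q "R \<inter> T"] H.inclusion_morphism[of Q R] R T RT
    by (simp_all add: subgroup_GR subgroup_GT)
  have posHK: "card (fusion_inter H K Q (R \<inter> T)) > 0" if Q: "subgroup Q G" "Q \<subseteq> R" "Q \<subseteq> T" for Q
  proof -
    have "finite (H Q (R \<inter> T))"
      using H.finite_morphisms[of Q "R \<inter> T"] Q RT finR by (simp add: subgroup_GR)
    then show ?thesis
      using incl[OF Q] by (auto simp: card_gt_0_iff fusion_inter_def)
  qed
  have F_R: "\<psi> \<in> F Q R \<longleftrightarrow> \<psi> \<in> F Q (carrier G)" if Q: "subgroup Q G" and \<psi>: "\<psi> \<in> Q \<rightarrow>\<^sub>E R" for Q \<psi>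
    using morphism_codomain[OF Q S _ R, of \<psi>] morphism_codomain[OF Q R _ S, of \<psi>] \<psi> subgroup.subset[OF R]
    by (auto simp: PiE_def)
  have factor_incl: "factor_sum Q (\<lambda>u\<in>Q. u) = of_nat (card (fusion_inter H K Q (R \<inter> T))) / of_nat (card (H Q R))"
    if Q: "subgroup Q G" "Q \<subseteq> R" "Q \<subseteq> T" for Q
  proof -
    have "compose Q (\<lambda>u\<in>Q. u) (\<lambda>u\<in>Q. u) = (\<lambda>u\<in>Q. u)" and "(\<lambda>u\<in>Q. u) ` Q = Q"
      by (auto simp: compose_def)
    then show ?thesis
      using factor_sum_factorised[OF Q(1,3) incl(2)[OF Q], of "\<lambda>u\<in>Q. u"] incl(3)[OF Q] by simp
  qed
  have S_iff: "carrier G = R <#> T \<longleftrightarrow> order G * card (R \<inter> T) = card R * card T"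
  proof
    assume "carrier G = R <#> T"
    then show "order G * card (R \<inter> T) = card R * card T"
      using card_set_mult[OF R T fin] by (simp add: order_def)
  next
    assume eq: "order G * card (R \<inter> T) = card R * card T"
    have "R <#> T \<subseteq> carrier G"
      using subgroup.subset[OF R] subgroup.subset[OF T] by (rule set_mult_closed)
    moreover have "card (R <#> T) * card (R \<inter> T) = card (carrier G) * card (R \<inter> T)"
      using eq card_set_mult[OF R T fin] by (simp add: order_def)
    then have "card (R <#> T) = card (carrier G)"
      using posRT by simp
    ultimately show "carrier G = R <#> T"
      using card_subset_eq[OF fin] by blast
  qed
  have count_iff: "real (card (F Q (carrier G))) =
          real (card (H Q R)) * real (card (K Q T)) / real (card (fusion_inter H K Q (R \<inter> T)))
      \<longleftrightarrow> card (F Q (carrier G)) * card (fusion_inter H K Q (R \<inter> T)) = card (H Q R) * card (K Q T)"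
    if Q: "subgroup Q G" "Q \<subseteq> R" "Q \<subseteq> T" for Q
    using posHK[OF Q] by (simp add: eq_divide_eq flip: of_nat_mult)
  show ?thesis
  proof
    assume marks: ?marks
    have diag: "of_nat (order G) / of_nat (card (F Q (carrier G))) =
        (of_nat (card R) * of_nat (card T) / (of_nat (card (R \<inter> T)) * of_nat (card (K Q T)))
          * (of_nat (card (fusion_inter H K Q (R \<inter> T))) / of_nat (card (H Q R))) :: rat)"
      if Q: "subgroup Q G" "Q \<subseteq> R" "Q \<subseteq> T" for Q
    proof -
      have QT: "subgroup Q GT" using Q by (simp add: subgroup_GT)
      have \<iota>: "(\<lambda>u\<in>Q. u) \<in> Q \<rightarrow>\<^sub>E R" using Q by auto
      have "(\<lambda>u\<in>Q. u) \<in> F Q (carrier G)"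
        using inclusion_morphism[OF Q(1) S subgroup.subset[OF Q(1)]] .
      then show ?thesis
        using marks[rule_format, OF QT \<iota>] by (simp only: if_True factor_incl[OF Q])
    qed
    have triv: "subgroup {\<one>} G" "{\<one>} \<subseteq> R" "{\<one>} \<subseteq> T"
      using triv_subgroup subgroup.one_closed[OF R] subgroup.one_closed[OF T] by auto
    have sub': "subgroup R GR" "subgroup T GT" "subgroup (R \<inter> T) GR" "subgroup (R \<inter> T) GT"
      using R T RT by (simp_all add: subgroup_GR subgroup_GT)
    have "order G * card (R \<inter> T) = card R * card T"
    proof -
      have "of_nat (order G) = (of_nat (card R) * of_nat (card T) / of_nat (card (R \<inter> T)) :: rat)"
        using diag[OF triv] morphisms_trivial[OF S] H.morphisms_trivial[OF sub'(1)] K.morphisms_trivial[OF sub'(2)]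
          H.morphisms_trivial[OF sub'(3)] K.morphisms_trivial[OF sub'(4)]
        by (simp add: fusion_inter_def)
      then have "of_nat (order G * card (R \<inter> T)) = (of_nat (card R * card T) :: rat)"
        using posRT by (simp add: field_simps)
      then show ?thesis by (simp only: of_nat_eq_iff)
    qed
    note order_eq = this
    have ?count
    proof (intro allI impI)
      fix Q assume "subgroup Q (G\<lparr>carrier := R \<inter> T\<rparr>)"
      then have Q: "subgroup Q G" "Q \<subseteq> R" "Q \<subseteq> T" by (simp_all add: subgroup_RT)
      have ord: "of_nat (card R) * of_nat (card T) = (of_nat (order G) * of_nat (card (R \<inter> T)) :: rat)"
        using order_eq by (simp flip: of_nat_mult)
      have "of_nat (order G) / of_nat (card (F Q (carrier G))) =
        (of_nat (order G) * (of_nat (card (fusion_inter H K Q (R \<inter> T))) / (of_nat (card (H Q R)) * of_nat (card (K Q T)))) :: rat)"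
        unfolding diag[OF Q] ord using posRT by simp
      then have "1 / of_nat (card (F Q (carrier G))) =
        (of_nat (card (fusion_inter H K Q (R \<inter> T))) / (of_nat (card (H Q R)) * of_nat (card (K Q T))) :: rat)"
        using posS by (simp only: divide_inverse mult_cancel_left) simp
      then have "of_nat (card (F Q (carrier G)) * card (fusion_inter H K Q (R \<inter> T)))
          = (of_nat (card (H Q R) * card (K Q T)) :: rat)"
        using posF[OF Q(1)] posH[OF Q(1,2)] posK[OF Q(1,3)] by (simp add: field_simps)
      then have "card (F Q (carrier G)) * card (fusion_inter H K Q (R \<inter> T)) = card (H Q R) * card (K Q T)"
        by (simp only: of_nat_eq_iff)
      then show "real (card (F Q (carrier G))) =
          real (card (H Q R)) * real (card (K Q T)) / real (card (fusion_inter H K Q (R \<inter> T)))"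
        using count_iff[OF Q] by blast
    qed
    moreover have ?weak
      unfolding weak_composition_product_def
    proof (intro conjI allI impI ballI)
      show "carrier G = R <#> T" using order_eq S_iff by blast
      fix Q \<psi> assume QT: "subgroup Q GT" and \<psi>: "\<psi> \<in> F Q R"
      then have Q: "subgroup Q G" "Q \<subseteq> T" by (simp_all add: subgroup_GT)
      have \<psi>E: "\<psi> \<in> Q \<rightarrow>\<^sub>E R" using morphism_PiE[OF Q(1) R \<psi>] .
      then have "\<psi> \<in> F Q (carrier G)" using F_R[OF Q(1)] \<psi> by blast
      then have "of_nat (order G) / of_nat (card (F Q (carrier G)))
        = of_nat (card R) * of_nat (card T) / (of_nat (card (R \<inter> T)) * of_nat (card (K Q T))) * factor_sum Q \<psi>"
        using marks[rule_format, OF QT \<psi>E] by (simp only: if_True)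
      then have "factor_sum Q \<psi> \<noteq> 0"
        using posS posF[OF Q(1)] by auto
      then obtain \<rho> where \<rho>: "\<rho> \<in> K Q (R \<inter> T)" "divide Q \<psi> \<rho> \<in> H (\<rho> ` Q) R"
        by (rule factorisation_exists[OF Q])
      note \<rho>' = K_into_RT[OF Q \<rho>(1)]
      show "\<exists>Q'. subgroup Q' GR \<and> subgroup Q' GT \<and> (\<exists>\<rho>\<in>K Q Q'. \<exists>\<psi>'\<in>H Q' R. \<psi> = compose Q \<psi>' \<rho>)"
      proof (intro exI conjI bexI)
        show "subgroup (\<rho> ` Q) GR" "subgroup (\<rho> ` Q) GT"
          using \<rho>' by (simp_all add: subgroup_GR subgroup_GT)
        show "\<psi> = compose Q (divide Q \<psi> \<rho>) \<rho>"
          using divide_compose[OF \<rho>'(1)] \<psi>E by (simp add: PiE_def)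
      qed (use \<rho> \<rho>' in auto)
    qed
    ultimately show "?weak \<and> ?count" by blast
  next
    assume wc: "?weak \<and> ?count"
    then have ord: "order G * card (R \<inter> T) = card R * card T"
      using S_iff unfolding weak_composition_product_def by blast
    show ?marks
    proof (intro allI impI ballI)
      fix Q \<psi> assume QT: "subgroup Q GT" and \<psi>E: "\<psi> \<in> Q \<rightarrow>\<^sub>E R"
      then have Q: "subgroup Q G" "Q \<subseteq> T" by (simp_all add: subgroup_GT)
      let ?r = "of_nat (card R) * of_nat (card T) / (of_nat (card (R \<inter> T)) * of_nat (card (K Q T))) * factor_sum Q \<psi>"
      show "(if \<psi> \<in> F Q (carrier G) then of_nat (order G) / of_nat (card (F Q (carrier G))) else 0) = ?r"
      proof (cases "\<psi> \<in> F Q (carrier G)")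
        case False
        then have "\<psi> \<notin> F Q R" using F_R[OF Q(1) \<psi>E] by blast
        then show ?thesis
          using False factor_sum_eq_0[OF Q] \<psi>E by (simp add: PiE_def)
      next
        case True
        then have "\<psi> \<in> F Q R" using F_R[OF Q(1) \<psi>E] by blast
        then obtain Q' \<rho> \<psi>' where Q': "subgroup Q' GR" "subgroup Q' GT" and \<rho>: "\<rho> \<in> K Q Q'"
          and \<psi>': "\<psi>' \<in> H Q' R" and \<psi>_eq: "\<psi> = compose Q \<psi>' \<rho>"
          using wc QT unfolding weak_composition_product_def by blast
        have Q'': "subgroup Q' G" "Q' \<subseteq> R" "Q' \<subseteq> T" using Q' by (simp_all add: subgroup_GR subgroup_GT)
        have sub': "subgroup R GR" "subgroup T GT" "subgroup (R \<inter> T) GT"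
          using R T RT by (simp_all add: subgroup_GR subgroup_GT)
        have \<rho>img: "\<rho> ` Q \<subseteq> Q'" using K.morphismD(4)[OF QT Q'(2) \<rho>] .
        have \<rho>RT: "\<rho> \<in> K Q (R \<inter> T)"
          using K.morphism_codomain[OF QT Q'(2) \<rho> sub'(3)] \<rho>img Q'' by blast
        note \<rho>' = K_into_RT[OF Q \<rho>RT]
        define \<sigma> where "\<sigma> = restrict \<psi>' (\<rho> ` Q)"
        have \<rho>Q: "subgroup (\<rho> ` Q) GR" using \<rho>' by (simp add: subgroup_GR)
        have \<sigma>: "\<sigma> \<in> H (\<rho> ` Q) R"
          unfolding \<sigma>_def using H.morphism_restrict[OF Q'(1) sub'(1) \<psi>' \<rho>Q \<rho>img] .
        have "\<psi> = compose Q \<sigma> \<rho>"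
          unfolding \<psi>_eq \<sigma>_def by (auto simp: compose_def)
        then have fs: "factor_sum Q \<psi> = of_nat (card (fusion_inter H K (\<rho> ` Q) (R \<inter> T))) / of_nat (card (H (\<rho> ` Q) R))"
          using factor_sum_factorised[OF Q \<rho>RT \<sigma>] by simp
        have cardK: "card (K Q T) = card (K (\<rho> ` Q) T)"
          using K.card_morphisms_image[OF QT sub'(3) \<rho>RT sub'(2)] by simp
        have \<rho>F: "\<rho> \<in> F Q (\<rho> ` Q)"
          using K_le_F[OF Q \<rho>'(3,5,6)] .
        have cardF: "card (F Q (carrier G)) = card (F (\<rho> ` Q) (carrier G))"
          using card_morphisms_image[OF Q(1) \<rho>'(3) \<rho>F S] by simp
        have count: "card (F (\<rho> ` Q) (carrier G)) * card (fusion_inter H K (\<rho> ` Q) (R \<inter> T))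
            = card (H (\<rho> ` Q) R) * card (K (\<rho> ` Q) T)"
          using wc count_iff[OF \<rho>'(3,4,5)] \<rho>' by (simp add: subgroup_RT)
        define f h k n s r t i where "f = (of_nat (card (F (\<rho> ` Q) (carrier G))) :: rat)"
          and "h = (of_nat (card (H (\<rho> ` Q) R)) :: rat)" and "k = (of_nat (card (K (\<rho> ` Q) T)) :: rat)"
          and "n = (of_nat (card (fusion_inter H K (\<rho> ` Q) (R \<inter> T))) :: rat)"
          and "s = (of_nat (order G) :: rat)" and "r = (of_nat (card R) :: rat)" and "t = (of_nat (card T) :: rat)"
          and "i = (of_nat (card (R \<inter> T)) :: rat)"
        note defs = f_def h_def k_def n_def s_def r_def t_def i_def
        have nz: "f \<noteq> 0" "h \<noteq> 0" "k \<noteq> 0" "i \<noteq> 0"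
          using posF[OF \<rho>'(3)] posH[OF \<rho>'(3,4)] posK[OF \<rho>'(3,5)] posRT by (simp_all add: defs)
        have "f * n = h * k" "s * i = r * t"
          using count ord by (simp_all add: defs flip: of_nat_mult)
        then have "s / f = r * t / (i * k) * (n / h)"
          using nz by (simp add: divide_eq_eq eq_divide_eq) (metis (no_types, lifting) mult.assoc mult.commute)
        then show ?thesis
          using True by (simp add: fs cardK cardF defs)
      qed
    qed
  qed
qed

end

section \<open>Comparing the two composites\<close>

lemma (in group) bij_betw_conj_PiE:
  assumes r: "r \<in> carrier G"
  shows "bij_betw (\<lambda>\<chi>. \<lambda>q\<in>Q. conj_by G (inv r) (\<chi> q)) (Q \<rightarrow>\<^sub>E carrier G) (Q \<rightarrow>\<^sub>E carrier G)"
proof (rule bij_betw_byWitness[where f' = "\<lambda>\<chi>. \<lambda>q\<in>Q. conj_by G r (\<chi> q)"])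
  have closed: "\<chi> q \<in> carrier G" if "\<chi> \<in> Q \<rightarrow>\<^sub>E carrier G" "q \<in> Q" for \<chi> q
    using that by auto
  show "(\<lambda>\<chi>. \<lambda>q\<in>Q. conj_by G (inv r) (\<chi> q)) ` (Q \<rightarrow>\<^sub>E carrier G) \<subseteq> Q \<rightarrow>\<^sub>E carrier G"
    "(\<lambda>\<chi>. \<lambda>q\<in>Q. conj_by G r (\<chi> q)) ` (Q \<rightarrow>\<^sub>E carrier G) \<subseteq> Q \<rightarrow>\<^sub>E carrier G"
    using r closed by auto
qed (use r in \<open>auto simp: fun_eq_iff PiE_def extensional_def Pi_iff\<close>)

locale characteristic_idempotent_reps = fusion_subsystem_pair G F R H T K
  for G (structure) and F R H T K +
  fixes p :: nat and xF xH xK :: "('a, 'a) biset_class \<Rightarrow>\<^sub>0 rat"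
  assumes F_rep: "characteristic_idempotent_rep G F p xF"
    and H_rep: "characteristic_idempotent_rep (G\<lparr>carrier := R\<rparr>) H p xH"
    and K_rep: "characteristic_idempotent_rep (G\<lparr>carrier := T\<rparr>) K p xK"
begin

lemma p: "prime p"
  using F_rep by (rule characteristic_idempotent_rep.p)

lemma finite_R: "finite R" and finite_T: "finite T"
  using finite_subset[OF subgroup.subset[OF R] fin] finite_subset[OF subgroup.subset[OF T] fin] .

lemma finite_group_pairs: "finite_groups G GR" "finite_groups GT G" "finite_groups GT GR"
  by (intro finite_groups.intro finite_groups_axioms.intro H.is_group K.is_group is_group;
    simp add: fin finite_R finite_T)+

text \<open>Composition with these elements restricts the left action to \<open>R\<close>, restricts the right action to \<open>T\<close>, and
  passes from \<open>T\<close> to \<open>R\<close> through \<open>R \<inter> T\<close>, respectively.\<close>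
abbreviation "restrict_R \<equiv> transitive_gen G GR R id"
abbreviation "restrict_T \<equiv> transitive_gen GT G T id"
abbreviation "restrict_RT \<equiv> transitive_gen GT GR (R \<inter> T) id"

lemma hom_id: "\<lbrakk>U \<subseteq> carrier A; \<And>x y. x \<otimes>\<^bsub>A\<^esub> y = x \<otimes>\<^bsub>B\<^esub> y\<rbrakk> \<Longrightarrow> id \<in> hom (B\<lparr>carrier := U\<rparr>) A"
  by (auto simp: hom_def)

lemma restrict_R: "restrict_R \<in> carrier (free_bisets p G GR)" "supported_on G GR (left_free G GR) restrict_R"
proof -
  interpret finite_groups G GR by (rule finite_group_pairs)
  have id: "id \<in> hom (G\<lparr>carrier := R\<rparr>) GR" by (rule hom_id) simp_all
  show "restrict_R \<in> carrier (free_bisets p G GR)" "supported_on G GR (left_free G GR) restrict_R"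
    using transitive_gen_of_hom[OF R id] p by blast+
qed

lemma restrict_T: "restrict_T \<in> carrier (free_bisets p GT G)" "supported_on GT G (left_free GT G) restrict_T"
proof -
  interpret finite_groups GT G by (rule finite_group_pairs)
  have id: "id \<in> hom (GT\<lparr>carrier := T\<rparr>) G" by (rule hom_id) (use subgroup.subset[OF T] in simp_all)
  have T': "subgroup T GT" using T by (simp add: subgroup_GT)
  show "restrict_T \<in> carrier (free_bisets p GT G)" "supported_on GT G (left_free GT G) restrict_T"
    using transitive_gen_of_hom[OF T' id] p by blast+
qed

lemma restrict_RT: "restrict_RT \<in> carrier (free_bisets p GT GR)" "supported_on GT GR (left_free GT GR) restrict_RT"
proof -
  interpret finite_groups GT GR by (rule finite_group_pairs)
  have id: "id \<in> hom (GT\<lparr>carrier := R \<inter> T\<rparr>) GR" by (rule hom_id) simp_all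
  have RT': "subgroup (R \<inter> T) GT" using RT by (simp add: subgroup_GT)
  show "restrict_RT \<in> carrier (free_bisets p GT GR)" "supported_on GT GR (left_free GT GR) restrict_RT"
    using transitive_gen_of_hom[OF RT' id] p by blast+
qed

lemma xF: "xF \<in> carrier (free_bisets p G G)" "supported_on G G (left_free G G) xF"
  using F_rep characteristic_idempotent_rep.x characteristic_idempotent_rep.left_free_x by blast+

lemma xH: "xH \<in> carrier (free_bisets p GR GR)" "supported_on GR GR (left_free GR GR) xH"
  using H_rep characteristic_idempotent_rep.x characteristic_idempotent_rep.left_free_x by blast+

lemma xK: "xK \<in> carrier (free_bisets p GT GT)" "supported_on GT GT (left_free GT GT) xK"
  using K_rep characteristic_idempotent_rep.x characteristic_idempotent_rep.left_free_x by blast+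

text \<open>Representatives of the two sides of the identity.\<close>
definition "restricted = free_comp GT G GR restrict_R (free_comp GT G G xF restrict_T)"

definition "product = free_comp GT GR GR xH (free_comp GT GT GR restrict_RT xK)"

lemma finite_carriers: "finite (carrier GR)" "finite (carrier GT)"
  by (simp_all add: finite_R finite_T)

lemma restricted_inner:
  "free_comp GT G G xF restrict_T \<in> carrier (free_bisets p GT G)"
  "supported_on GT G (left_free GT G) (free_comp GT G G xF restrict_T)"
  using free_comp_closed[OF p K.is_group is_group is_group fin xF(1) restrict_T(1)]
    supported_on_left_free_comp[OF p K.is_group is_group is_group fin xF(1) restrict_T(1) xF(2) restrict_T(2)] .

lemma product_inner:
  "free_comp GT GT GR restrict_RT xK \<in> carrier (free_bisets p GT GR)"
  "supported_on GT GR (left_free GT GR) (free_comp GT GT GR restrict_RT xK)"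
  using free_comp_closed[OF p K.is_group K.is_group H.is_group finite_carriers(2) restrict_RT(1) xK(1)]
    supported_on_left_free_comp[OF p K.is_group K.is_group H.is_group finite_carriers(2) restrict_RT(1) xK(1) restrict_RT(2) xK(2)] .

lemma restricted:
  "restricted \<in> carrier (free_bisets p GT GR)" "supported_on GT GR (left_free GT GR) restricted"
  unfolding restricted_def
  using free_comp_closed[OF p K.is_group is_group H.is_group fin restrict_R(1) restricted_inner(1)]
    supported_on_left_free_comp[OF p K.is_group is_group H.is_group fin restrict_R(1) restricted_inner(1)
      restrict_R(2) restricted_inner(2)] .

lemma product:
  "product \<in> carrier (free_bisets p GT GR)" "supported_on GT GR (left_free GT GR) product"
  unfolding product_def
  using free_comp_closed[OF p K.is_group H.is_group H.is_group finite_carriers(1) xH(1) product_inner(1)]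
    supported_on_left_free_comp[OF p K.is_group H.is_group H.is_group finite_carriers(1) xH(1) product_inner(1)
      xH(2) product_inner(2)] .

text \<open>Both restrictions keep the mark of \<open>\<omega>\<^sub>F\<close>.\<close>
lemma mark_restricted:
  assumes QT: "subgroup Q GT" and \<psi>: "\<psi> \<in> Q \<rightarrow>\<^sub>E R"
  shows "mark GT GR (twisted_diagonal Q \<psi>) restricted =
    (if \<psi> \<in> F Q (carrier G) then of_nat (order G) / of_nat (card (F Q (carrier G))) else 0)"
proof -
  interpret XF: characteristic_idempotent_rep G F p xF by (rule F_rep)
  have Q: "subgroup Q G" "Q \<subseteq> T" using QT by (simp_all add: subgroup_GT)
  have QT': "Q \<subseteq> carrier GT" using Q by simp
  have \<psi>R: "\<psi> q \<in> R" and \<psi>S: "\<psi> q \<in> carrier G" if "q \<in> Q" for q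
    using \<psi> that subgroup.subset[OF R] by auto
  have "id \<in> hom GR G" using subgroup.subset[OF R] by (auto simp: hom_def)
  moreover have "twisted_diagonal R id = pair_image (\<lambda>v. v) id (carrier GR)"
    by (simp add: twisted_diagonal_def)
  moreover have "\<psi> q \<in> carrier GR" if "q \<in> Q" for q
    using \<psi>R[OF that] by simp
  ultimately have "mark GT GR (twisted_diagonal Q \<psi>) restricted
      = mark GT G (twisted_diagonal Q (\<lambda>q. id (\<psi> q))) (free_comp GT G G xF restrict_T)"
    unfolding restricted_def
    by (intro mark_comp_transitive_left_full[OF p K.is_group finite_group_pairs(1) restricted_inner(1) restricted_inner(2)] QT')
  also have "\<dots> = mark GT G (twisted_diagonal Q \<psi>) (free_comp GT G G xF (transitive_gen GT G (carrier GT) id))"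
    by simp
  also have "\<dots> = mark G G (pair_image \<psi> id Q) xF"
    using p finite_group_pairs(2) is_group xF(1) _ QT' \<psi>S
    by (rule mark_comp_transitive_right) (use subgroup.subset[OF T] in \<open>auto simp: hom_def\<close>)
  also have "\<dots> = mark G G (twisted_diagonal Q \<psi>) xF"
    by (simp add: twisted_diagonal_def)
  also have "\<dots> = (if \<psi> \<in> F Q (carrier G) then of_nat (order G) / of_nat (card (F Q (carrier G))) else 0)"
    by (rule XF.mark_eq[OF Q(1)]) (use \<psi> \<psi>S in auto)
  finally show ?thesis .
qed

lemma mark_restrict_RT_comp:
  assumes Q: "Q \<subseteq> T" and \<chi>: "\<And>q. q \<in> Q \<Longrightarrow> \<chi> q \<in> R"
  shows "mark GT GR (twisted_diagonal Q \<chi>) (free_comp GT GT GR restrict_RT xK) =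
    (\<Sum>r\<in>R. of_bool (\<forall>q\<in>Q. conj_by GR (inv\<^bsub>GR\<^esub> r) (\<chi> q) \<in> R \<inter> T)
      * mark GT GT (twisted_diagonal Q (\<lambda>q. conj_by GR (inv\<^bsub>GR\<^esub> r) (\<chi> q))) xK) / of_nat (card (R \<inter> T))"
proof -
  have V: "subgroup (R \<inter> T) GR" using RT by (simp add: subgroup_GR)
  have \<theta>: "id \<in> hom (GR\<lparr>carrier := R \<inter> T\<rparr>) GT" by (auto simp: hom_def)
  have diag: "twisted_diagonal (R \<inter> T) id = pair_image (\<lambda>v. v) id (R \<inter> T)"
    by (simp add: twisted_diagonal_def)
  have Q': "Q \<subseteq> carrier GT" and \<chi>': "\<And>q. q \<in> Q \<Longrightarrow> \<chi> q \<in> carrier GR" using Q \<chi> by simp_all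
  show ?thesis
    using mark_comp_transitive_left[OF p K.is_group finite_group_pairs(3) xK V \<theta> diag Q', of \<chi>] \<chi>' by simp
qed

lemma pair_image_eq_divide:
  assumes "inj_on \<chi> Q"
  shows "pair_image \<psi> \<chi> Q = twisted_diagonal (\<chi> ` Q) (divide Q \<psi> \<chi>)"
  using assms by (force simp: twisted_diagonal_def divide_def image_image)

text \<open>Expanding at the middle group \<open>R\<close> gives a sum over maps \<open>\<chi> : Q \<rightarrow> R\<close>, in which \<open>[R \<inter> T, id]\<close> contributes
  an average over conjugates of \<open>\<chi>\<close> by elements of \<open>R\<close> with values in \<open>R \<inter> T\<close>. Conjugation permutes the
  maps \<open>\<chi>\<close> and preserves the mark of \<open>\<omega>\<^sub>H\<close>, so the average collapses to the sum over \<open>\<chi> : Q \<rightarrow> R \<inter> T\<close>;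
  the remaining two marks are given by \<open>mark_eq\<close>.\<close>
lemma mark_product:
  assumes QT: "subgroup Q GT" and \<psi>: "\<psi> \<in> Q \<rightarrow>\<^sub>E R"
  shows "mark GT GR (twisted_diagonal Q \<psi>) product =
    of_nat (card R) * of_nat (card T) / (of_nat (card (R \<inter> T)) * of_nat (card (K Q T))) * factor_sum Q \<psi>"
proof -
  interpret XH: characteristic_idempotent_rep GR H p xH by (rule H_rep)
  interpret XK: characteristic_idempotent_rep GT K p xK by (rule K_rep)
  have Q: "subgroup Q G" "Q \<subseteq> T" using QT by (simp_all add: subgroup_GT)
  have finQ: "finite Q" using Q(2) finite_T by (rule finite_subset)
  let ?I = "Q \<rightarrow>\<^sub>E R"
  define w where "w \<chi> = of_bool (\<chi> \<in> Q \<rightarrow> R \<inter> T) * mark GT GT (twisted_diagonal Q \<chi>) xK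
    * mark GR GR (pair_image \<psi> \<chi> Q) xH" for \<chi>
  have inner: "mark GR GR (pair_image \<psi> \<chi> Q) xH * mark GT GR (twisted_diagonal Q \<chi>) (free_comp GT GT GR restrict_RT xK)
      = (\<Sum>r\<in>R. w (\<lambda>q\<in>Q. conj_by GR (inv\<^bsub>GR\<^esub> r) (\<chi> q))) / of_nat (card (R \<inter> T))"
    if \<chi>: "\<chi> \<in> ?I" for \<chi>
  proof -
    have \<chi>R: "\<chi> q \<in> R" if "q \<in> Q" for q using \<chi> that by auto
    have "mark GR GR (pair_image \<psi> \<chi> Q) xH * (of_bool (\<forall>q\<in>Q. conj_by GR (inv\<^bsub>GR\<^esub> r) (\<chi> q) \<in> R \<inter> T)
      * mark GT GT (twisted_diagonal Q (\<lambda>q. conj_by GR (inv\<^bsub>GR\<^esub> r) (\<chi> q))) xK) = w (\<lambda>q\<in>Q. conj_by GR (inv\<^bsub>GR\<^esub> r) (\<chi> q))"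
      if r: "r \<in> R" for r
    proof -
      have r': "inv\<^bsub>GR\<^esub> r \<in> carrier GR" using r by (intro H.inv_closed) simp
      have "pair_image \<psi> (\<lambda>q\<in>Q. conj_by GR (inv\<^bsub>GR\<^esub> r) (\<chi> q)) Q
        = pair_image \<psi> (\<lambda>q. conj_by GR (inv\<^bsub>GR\<^esub> r) (\<chi> q)) Q"
        by simp
      also have "mark GR GR \<dots> xH = mark GR GR (pair_image \<psi> \<chi> Q) xH"
        by (rule mark_conj_right[OF H.is_group H.is_group xH(1) _ _ r']) (use \<psi> \<chi> in auto)
      finally have m: "mark GR GR (pair_image \<psi> (\<lambda>q\<in>Q. conj_by GR (inv\<^bsub>GR\<^esub> r) (\<chi> q)) Q) xH = mark GR GR (pair_image \<psi> \<chi> Q) xH" .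
      have t: "twisted_diagonal Q (\<lambda>q\<in>Q. conj_by GR (inv\<^bsub>GR\<^esub> r) (\<chi> q)) = twisted_diagonal Q (\<lambda>q. conj_by GR (inv\<^bsub>GR\<^esub> r) (\<chi> q))"
        by (simp add: twisted_diagonal_def)
      have b: "(\<lambda>q\<in>Q. conj_by GR (inv\<^bsub>GR\<^esub> r) (\<chi> q)) \<in> Q \<rightarrow> R \<inter> T \<longleftrightarrow> (\<forall>q\<in>Q. conj_by GR (inv\<^bsub>GR\<^esub> r) (\<chi> q) \<in> R \<inter> T)"
        by (auto simp: Pi_iff)
      show ?thesis
        unfolding w_def m t b by (simp only: mult_ac)
    qed
    then have "mark GR GR (pair_image \<psi> \<chi> Q) xH * (\<Sum>r\<in>R. of_bool (\<forall>q\<in>Q. conj_by GR (inv\<^bsub>GR\<^esub> r) (\<chi> q) \<in> R \<inter> T)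
      * mark GT GT (twisted_diagonal Q (\<lambda>q. conj_by GR (inv\<^bsub>GR\<^esub> r) (\<chi> q))) xK) = (\<Sum>r\<in>R. w (\<lambda>q\<in>Q. conj_by GR (inv\<^bsub>GR\<^esub> r) (\<chi> q)))"
      unfolding sum_distrib_left by (rule sum.cong[OF refl])
    moreover have "mark GT GR (twisted_diagonal Q \<chi>) (free_comp GT GT GR restrict_RT xK) =
      (\<Sum>r\<in>R. of_bool (\<forall>q\<in>Q. conj_by GR (inv\<^bsub>GR\<^esub> r) (\<chi> q) \<in> R \<inter> T)
        * mark GT GT (twisted_diagonal Q (\<lambda>q. conj_by GR (inv\<^bsub>GR\<^esub> r) (\<chi> q))) xK) / of_nat (card (R \<inter> T))"
      using Q(2) \<chi>R by (rule mark_restrict_RT_comp)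
    ultimately show ?thesis by (simp only: times_divide_eq_right)
  qed
  have reindex: "(\<Sum>\<chi>\<in>?I. w (\<lambda>q\<in>Q. conj_by GR (inv\<^bsub>GR\<^esub> r) (\<chi> q))) = (\<Sum>\<chi>\<in>?I. w \<chi>)" if r: "r \<in> R" for r
  proof -
    have "bij_betw (\<lambda>\<chi>. \<lambda>q\<in>Q. conj_by GR (inv\<^bsub>GR\<^esub> r) (\<chi> q)) ?I ?I"
      using H.bij_betw_conj_PiE[of r Q] r by simp
    then show ?thesis by (rule sum.reindex_bij_betw)
  qed
  have "mark GT GR (twisted_diagonal Q \<psi>) product
    = (\<Sum>\<chi>\<in>Q \<rightarrow>\<^sub>E carrier GR. mark GR GR (pair_image \<psi> \<chi> Q) xH
        * mark GT GR (twisted_diagonal Q \<chi>) (free_comp GT GT GR restrict_RT xK)) / of_nat (order GR)"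
    unfolding product_def
    by (rule mark_free_comp[OF K.is_group H.is_group H.is_group finite_carriers(1) xH(1) product_inner finQ])
  also have "\<dots> = (\<Sum>\<chi>\<in>?I. (\<Sum>r\<in>R. w (\<lambda>q\<in>Q. conj_by GR (inv\<^bsub>GR\<^esub> r) (\<chi> q))) / of_nat (card (R \<inter> T))) / of_nat (card R)"
    using inner by (simp add: order_def)
  also have "\<dots> = (\<Sum>r\<in>R. \<Sum>\<chi>\<in>?I. w (\<lambda>q\<in>Q. conj_by GR (inv\<^bsub>GR\<^esub> r) (\<chi> q))) / of_nat (card (R \<inter> T)) / of_nat (card R)"
    unfolding sum_divide_distrib[symmetric] by (subst sum.swap) (rule refl)
  also have "\<dots> = (\<Sum>\<chi>\<in>?I. w \<chi>) / of_nat (card (R \<inter> T))"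
    using reindex finite_R H.one_closed by auto
  also have "(\<Sum>\<chi>\<in>?I. w \<chi>) = (\<Sum>\<chi>\<in>K Q (R \<inter> T). w \<chi>)"
  proof (rule sum.mono_neutral_right)
    show "finite ?I" using finQ finite_R by (intro finite_PiE)
    have sub: "subgroup (R \<inter> T) GT" "subgroup T GT" using RT T by (simp_all add: subgroup_GT)
    show "K Q (R \<inter> T) \<subseteq> ?I"
      using K.morphism_PiE[OF QT sub(1)] by auto
    show "\<forall>\<chi>\<in>?I - K Q (R \<inter> T). w \<chi> = 0"
    proof
      fix \<chi> assume \<chi>: "\<chi> \<in> ?I - K Q (R \<inter> T)"
      show "w \<chi> = 0"
      proof (cases "\<chi> \<in> Q \<rightarrow> R \<inter> T")
        case True
        then have \<chi>T: "\<chi> \<in> Q \<rightarrow>\<^sub>E carrier GT" and img: "\<chi> ` Q \<subseteq> R \<inter> T" using \<chi> by (auto simp: PiE_def)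
        have "\<chi> \<notin> K Q (carrier GT)"
          using K.morphism_codomain[OF QT sub(2) _ sub(1) img] \<chi> by auto
        then show ?thesis
          using XK.mark_non_morphism[OF QT \<chi>T] by (simp add: w_def)
      qed (simp add: w_def)
    qed
  qed
  also have "\<dots> = (\<Sum>\<chi>\<in>K Q (R \<inter> T). of_nat (card R) * of_nat (card T) / of_nat (card (K Q T))
      * (if divide Q \<psi> \<chi> \<in> H (\<chi> ` Q) R then 1 / of_nat (card (H (\<chi> ` Q) R)) else 0))"
  proof (rule sum.cong[OF refl])
    fix \<chi> assume \<chi>: "\<chi> \<in> K Q (R \<inter> T)"
    note \<chi>' = K_into_RT[OF Q \<chi>]
    have sub: "subgroup (R \<inter> T) GT" "subgroup T GT" using RT T by (simp_all add: subgroup_GT)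
    have \<chi>T: "\<chi> \<in> K Q T"
      using K.morphism_codomain[OF QT sub(1) \<chi> sub(2)] \<chi>'(5) by blast
    have into: "\<chi> \<in> Q \<rightarrow> R \<inter> T" using \<chi>'(4,5) by auto
    have "\<chi> \<in> Q \<rightarrow>\<^sub>E carrier GT" using K.morphism_PiE[OF QT sub(2) \<chi>T] by simp
    then have mK: "mark GT GT (twisted_diagonal Q \<chi>) xK = of_nat (card T) / of_nat (card (K Q T))"
      using XK.mark_eq[OF QT] \<chi>T by (simp add: order_def)
    have "divide Q \<psi> \<chi> \<in> \<chi> ` Q \<rightarrow>\<^sub>E carrier GR"
      using \<psi> \<chi>'(1) by (auto simp: divide_def)
    moreover have "subgroup (\<chi> ` Q) GR" using \<chi>' by (simp add: subgroup_GR)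
    ultimately have mH: "mark GR GR (pair_image \<psi> \<chi> Q) xH =
        (if divide Q \<psi> \<chi> \<in> H (\<chi> ` Q) R then of_nat (card R) / of_nat (card (H (\<chi> ` Q) R)) else 0)"
      unfolding pair_image_eq_divide[OF \<chi>'(1)] using XH.mark_eq by (simp add: order_def)
    show "w \<chi> = of_nat (card R) * of_nat (card T) / of_nat (card (K Q T))
      * (if divide Q \<psi> \<chi> \<in> H (\<chi> ` Q) R then 1 / of_nat (card (H (\<chi> ` Q) R)) else 0)"
      using into by (simp add: w_def mK mH)
  qed
  finally show ?thesis
    unfolding sum_distrib_left[symmetric] factor_sum_def[symmetric] by (simp add: mult_ac)
qed

text \<open>Left freeness makes such a subgroup the graph of a map on its right projection.\<close>
lemma left_free_subgroup_twisted_diagonal: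
  assumes D: "left_free GT GR D"
  obtains Q \<psi> where "subgroup Q GT" "\<psi> \<in> Q \<rightarrow>\<^sub>E R" "D = twisted_diagonal Q \<psi>"
proof -
  have sub: "subgroup D (GR \<times>\<times> GT)" using D by (simp add: left_free_def)
  have "snd \<in> hom (GR \<times>\<times> GT) GT" by (auto simp: hom_def mult_DirProd')
  then interpret snd: group_hom "GR \<times>\<times> GT" GT snd
    using DirProd_group[OF H.is_group K.is_group] K.is_group by (intro group_hom.intro group_hom_axioms.intro)
  define Q where "Q = snd ` D"
  have "subgroup Q GT"
    unfolding Q_def using sub by (rule snd.subgroup_img_is_subgroup)
  define \<psi> where "\<psi> = (\<lambda>q\<in>Q. THE h. (h, q) \<in> D)"
  have \<psi>: "\<psi> q = h" if "(h, q) \<in> D" for h q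
  proof -
    have "q \<in> Q" using that by (force simp: Q_def)
    moreover have "(THE h. (h, q) \<in> D) = h"
      using that left_free_unique[OF K.is_group H.is_group D] by (intro the_equality)
    ultimately show ?thesis by (simp add: \<psi>_def)
  qed
  have "D = twisted_diagonal Q \<psi>"
    using \<psi> by (force simp: twisted_diagonal_def Q_def)
  moreover have "\<psi> \<in> Q \<rightarrow>\<^sub>E R"
  proof (rule PiE_I)
    fix q assume "q \<in> Q"
    then obtain h where "(h, q) \<in> D" by (force simp: Q_def)
    then show "\<psi> q \<in> R" using \<psi> subgroup.subset[OF sub] by auto
  qed (simp add: \<psi>_def)
  ultimately show thesis using \<open>subgroup Q GT\<close> that by blast
qed

theorem restricted_eq_product_iff:
  "burnside_elem p GT GR restricted = burnside_elem p GT GR product \<longleftrightarrow>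
    (\<forall>Q. subgroup Q GT \<longrightarrow> (\<forall>\<psi>\<in>Q \<rightarrow>\<^sub>E R.
      mark GT GR (twisted_diagonal Q \<psi>) restricted = mark GT GR (twisted_diagonal Q \<psi>) product))"
proof
  assume eq: "burnside_elem p GT GR restricted = burnside_elem p GT GR product"
  show "\<forall>Q. subgroup Q GT \<longrightarrow> (\<forall>\<psi>\<in>Q \<rightarrow>\<^sub>E R.
      mark GT GR (twisted_diagonal Q \<psi>) restricted = mark GT GR (twisted_diagonal Q \<psi>) product)"
    unfolding mark_def using burnside_sum_burnside_elem_cong[OF p eq] by simp
next
  assume marks: "\<forall>Q. subgroup Q GT \<longrightarrow> (\<forall>\<psi>\<in>Q \<rightarrow>\<^sub>E R.
      mark GT GR (twisted_diagonal Q \<psi>) restricted = mark GT GR (twisted_diagonal Q \<psi>) product)"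
  have "mark GT GR D restricted = mark GT GR D product" if sub: "subgroup D (GR \<times>\<times> GT)" for D
  proof (cases "left_free GT GR D")
    case True
    then show ?thesis
      using marks by (metis left_free_subgroup_twisted_diagonal)
  next
    case False
    then obtain h where "(h, \<one>\<^bsub>GT\<^esub>) \<in> D" "h \<noteq> \<one>\<^bsub>GR\<^esub>"
      using sub unfolding left_free_def by blast
    then show ?thesis
      using mark_eq_0_left_free[OF restricted(2)] mark_eq_0_left_free[OF product(2)] by metis
  qed
  then show "burnside_elem p GT GR restricted = burnside_elem p GT GR product"
    using burnside_elem_eq_iff_marks[OF p _ restricted(1) product(1)] finite_carriers by simp
qed

end

theorem theorem5:
  fixes p :: nat
    and G :: "('a, 'm) monoid_scheme"
    and F H K :: "'a hom_sets"
    and R T :: "'a set"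
    and \<omega>\<^sub>F \<omega>\<^sub>H \<omega>\<^sub>K :: "(('a, 'a) biset_class \<Rightarrow>\<^sub>0 rat) set"
  assumes "saturated_fusion_system p G F"
    and "fusion_subsystem G F R H"
    and "saturated_fusion_system p (G\<lparr>carrier := R\<rparr>) H"
    and "fusion_subsystem G F T K"
    and "saturated_fusion_system p (G\<lparr>carrier := T\<rparr>) K"
    and "characteristic_idempotent p G F \<omega>\<^sub>F"
    and "characteristic_idempotent p (G\<lparr>carrier := R\<rparr>) H \<omega>\<^sub>H"
    and "characteristic_idempotent p (G\<lparr>carrier := T\<rparr>) K \<omega>\<^sub>K"
  shows
    "burnside_comp p (G\<lparr>carrier := T\<rparr>) G (G\<lparr>carrier := R\<rparr>)
       (transitive_elem p G (G\<lparr>carrier := R\<rparr>) R id)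
       (burnside_comp p (G\<lparr>carrier := T\<rparr>) G G \<omega>\<^sub>F (transitive_elem p (G\<lparr>carrier := T\<rparr>) G T id))
     = burnside_comp p (G\<lparr>carrier := T\<rparr>) (G\<lparr>carrier := R\<rparr>) (G\<lparr>carrier := R\<rparr>)
         \<omega>\<^sub>H
         (burnside_comp p (G\<lparr>carrier := T\<rparr>) (G\<lparr>carrier := T\<rparr>) (G\<lparr>carrier := R\<rparr>)
            (transitive_elem p (G\<lparr>carrier := T\<rparr>) (G\<lparr>carrier := R\<rparr>) (R \<inter> T) id) \<omega>\<^sub>K)
     \<longleftrightarrow>
     weak_composition_product G F R H T K \<and>
     (\<forall>Q. subgroup Q (G\<lparr>carrier := R \<inter> T\<rparr>) \<longrightarrow>
        real (card (F Q (carrier G))) =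
          real (card (H Q R)) * real (card (K Q T)) / real (card (fusion_inter H K Q (R \<inter> T))))"
proof -
  obtain xF where xF: "characteristic_idempotent_rep G F p xF" "\<omega>\<^sub>F = burnside_elem p G G xF"
    using assms(1,6) by (rule characteristic_idempotent_rep_exists)
  obtain xH where xH: "characteristic_idempotent_rep (G\<lparr>carrier := R\<rparr>) H p xH"
    "\<omega>\<^sub>H = burnside_elem p (G\<lparr>carrier := R\<rparr>) (G\<lparr>carrier := R\<rparr>) xH"
    using assms(3,7) by (rule characteristic_idempotent_rep_exists)
  obtain xK where xK: "characteristic_idempotent_rep (G\<lparr>carrier := T\<rparr>) K p xK"
    "\<omega>\<^sub>K = burnside_elem p (G\<lparr>carrier := T\<rparr>) (G\<lparr>carrier := T\<rparr>) xK"
    using assms(5,8) by (rule characteristic_idempotent_rep_exists)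
  interpret XF: characteristic_idempotent_rep G F p xF by (rule xF)
  interpret P: characteristic_idempotent_reps G F R H T K p xF xH xK
    by (intro characteristic_idempotent_reps.intro characteristic_idempotent_reps_axioms.intro
      fusion_subsystem_pair.intro fusion_subsystem_pair_axioms.intro XF.fusion_system_axioms XF.finite_G
      assms(2,4) xF(1) xH(1) xK(1))
  have lhs: "burnside_comp p (G\<lparr>carrier := T\<rparr>) G (G\<lparr>carrier := R\<rparr>)
       (transitive_elem p G (G\<lparr>carrier := R\<rparr>) R id)
       (burnside_comp p (G\<lparr>carrier := T\<rparr>) G G \<omega>\<^sub>F (transitive_elem p (G\<lparr>carrier := T\<rparr>) G T id))
     = burnside_elem p (G\<lparr>carrier := T\<rparr>) (G\<lparr>carrier := R\<rparr>) P.restricted"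
    unfolding xF(2) transitive_elem_eq P.restricted_def
      burnside_comp_burnside_elem[OF P.p P.K.is_group XF.is_group XF.is_group P.finite_carriers(2) P.fin P.fin P.xF(1) P.restrict_T(1)]
    by (rule burnside_comp_burnside_elem[OF P.p P.K.is_group XF.is_group P.H.is_group P.finite_carriers(2) P.fin P.finite_carriers(1)
      P.restrict_R(1) P.restricted_inner(1)])
  have rhs: "burnside_comp p (G\<lparr>carrier := T\<rparr>) (G\<lparr>carrier := R\<rparr>) (G\<lparr>carrier := R\<rparr>)
         \<omega>\<^sub>H
         (burnside_comp p (G\<lparr>carrier := T\<rparr>) (G\<lparr>carrier := T\<rparr>) (G\<lparr>carrier := R\<rparr>)
            (transitive_elem p (G\<lparr>carrier := T\<rparr>) (G\<lparr>carrier := R\<rparr>) (R \<inter> T) id) \<omega>\<^sub>K)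
     = burnside_elem p (G\<lparr>carrier := T\<rparr>) (G\<lparr>carrier := R\<rparr>) P.product"
    unfolding xH(2) xK(2) transitive_elem_eq P.product_def
      burnside_comp_burnside_elem[OF P.p P.K.is_group P.K.is_group P.H.is_group P.finite_carriers(2) P.finite_carriers(2) P.finite_carriers(1)
        P.restrict_RT(1) P.xK(1)]
    by (rule burnside_comp_burnside_elem[OF P.p P.K.is_group P.H.is_group P.H.is_group P.finite_carriers(2) P.finite_carriers(1) P.finite_carriers(1)
      P.xH(1) P.product_inner(1)])
  show ?thesis
    unfolding lhs rhs P.restricted_eq_product_iff P.factor_sum_iff[symmetric]
    by (simp add: P.mark_restricted P.mark_product)
qed

end
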